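(* Let $C$ be a coalgebra in an abelian monoidal category $(\mathcal{M},\otimes,\mathbf{1})$. The following assertions are equivalent: (a) $C$ is coseparable, i.e. the comultiplication $\Delta:C\to C\otimes C$ has a retraction in ${}^C\mathcal{M}^C$. (b) $C$ is $\mathcal{I}$-injective in ${}^C\mathcal{M}^C$. (c) $\mathbf{H}^1(M,C)=0$ for all $M\in{}^C\mathcal{M}^C$. (d) $\mathbf{H}^n(M,C)=0$ for all $M\in{}^C\mathcal{M}^C$ and all $n>0$.
   Context: $(\mathcal{M},\otimes,\mathbf{1})$ is a monoidal category with $\mathcal{M}$ abelian. A coalgebra in $\mathcal{M}$ is an algebra in the opposite monoidal category $\mathcal{M}^\circ$; ${}^C\mathcal{M}^C$ is the (abelian) category of $(C,C)$-bicomodules in $\mathcal{M}$, i.e. of $(C,C)$-bimodules in $\mathcal{M}^\circ$. Let $\mathcal{I}$ be the class of monomorphisms of ${}^C\mathcal{M}^C$ that have a retraction in $\mathcal{M}$. A bicomodule $Q$ is $\mathcal{I}$-injective if ${}^C\mathcal{M}^C(j,Q)$ is surjective for all $j\in\mathcal{I}$. $\mathbf{Ext}^\bullet_{\mathcal{I}}(M,N)$ denotes the cohomology of ${}^C\mathcal{M}^C(M,Q^\bullet)$, where $0\to N\to Q^0\to Q^1\to\cdots$ is an exact sequence with all $Q^n$ $\mathcal{I}$-injective and in which the monomorphism in the canonical (mono)$\circ$(epi) factorization of each map is in $\mathcal{I}$. Hochschild cohomology: $\mathbf{H}^\bullet(M,C)=\mathbf{Ext}^\bullet_{\mathcal{I}}(M,C)$.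 *)

theory Defs
  imports "HOL-Algebra.Elementary_Groups"
begin

section \<open>Categories\<close>

text \<open>Hom-sets need not be disjoint: composition and addition act on bare arrows, while
  identities and zero morphisms are indexed by objects. Hence the same arrow may be a morphism
  between several pairs of objects, as happens for bicomodules sharing underlying objects.\<close>

record ('o, 'm) category =
  Obj :: "'o set"
  Hom :: "'o \<Rightarrow> 'o \<Rightarrow> 'm set"
  ident :: "'o \<Rightarrow> 'm"
  comp :: "'m \<Rightarrow> 'm \<Rightarrow> 'm"  (infixr \<open>\<cdot>\<index>\<close> 70)

locale category =
  fixes A :: "('o, 'm, 'x) category_scheme" (structure)
  assumes ident_hom: "X \<in> Obj A \<Longrightarrow> ident A X \<in> Hom A X X"
    and comp_hom: "\<lbrakk>X \<in> Obj A; Y \<in> Obj A; Z \<in> Obj A; f \<in> Hom A X Y; g \<in> Hom A Y Z\<rbrakk>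
      \<Longrightarrow> g \<cdot> f \<in> Hom A X Z"
    and comp_ident: "\<lbrakk>X \<in> Obj A; Y \<in> Obj A; f \<in> Hom A X Y\<rbrakk> \<Longrightarrow> f \<cdot> ident A X = f"
    and ident_comp: "\<lbrakk>X \<in> Obj A; Y \<in> Obj A; f \<in> Hom A X Y\<rbrakk> \<Longrightarrow> ident A Y \<cdot> f = f"
    and comp_assoc: "\<lbrakk>W \<in> Obj A; X \<in> Obj A; Y \<in> Obj A; Z \<in> Obj A;
      f \<in> Hom A W X; g \<in> Hom A X Y; h \<in> Hom A Y Z\<rbrakk> \<Longrightarrow> (h \<cdot> g) \<cdot> f = h \<cdot> (g \<cdot> f)"

definition is_mono :: "('o, 'm, 'x) category_scheme \<Rightarrow> 'o \<Rightarrow> 'o \<Rightarrow> 'm \<Rightarrow> bool" where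
  "is_mono A X Y f \<longleftrightarrow> X \<in> Obj A \<and> Y \<in> Obj A \<and> f \<in> Hom A X Y \<and>
    (\<forall>W\<in>Obj A. \<forall>g\<in>Hom A W X. \<forall>h\<in>Hom A W X. f \<cdot>\<^bsub>A\<^esub> g = f \<cdot>\<^bsub>A\<^esub> h \<longrightarrow> g = h)"

definition is_epi :: "('o, 'm, 'x) category_scheme \<Rightarrow> 'o \<Rightarrow> 'o \<Rightarrow> 'm \<Rightarrow> bool" where
  "is_epi A X Y f \<longleftrightarrow> X \<in> Obj A \<and> Y \<in> Obj A \<and> f \<in> Hom A X Y \<and>
    (\<forall>Z\<in>Obj A. \<forall>g\<in>Hom A Y Z. \<forall>h\<in>Hom A Y Z. g \<cdot>\<^bsub>A\<^esub> f = h \<cdot>\<^bsub>A\<^esub> f \<longrightarrow> g = h)"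

definition is_inverse :: "('o, 'm, 'x) category_scheme \<Rightarrow> 'o \<Rightarrow> 'o \<Rightarrow> 'm \<Rightarrow> 'm \<Rightarrow> bool" where
  "is_inverse A X Y f g \<longleftrightarrow> f \<in> Hom A X Y \<and> g \<in> Hom A Y X \<and>
    g \<cdot>\<^bsub>A\<^esub> f = ident A X \<and> f \<cdot>\<^bsub>A\<^esub> g = ident A Y"

definition is_iso :: "('o, 'm, 'x) category_scheme \<Rightarrow> 'o \<Rightarrow> 'o \<Rightarrow> 'm \<Rightarrow> bool" where
  "is_iso A X Y f \<longleftrightarrow> (\<exists>g. is_inverse A X Y f g)"

definition inverse_mor :: "('o, 'm, 'x) category_scheme \<Rightarrow> 'o \<Rightarrow> 'o \<Rightarrow> 'm \<Rightarrow> 'm" where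
  "inverse_mor A X Y f = (THE g. is_inverse A X Y f g)"

definition has_retraction :: "('o, 'm, 'x) category_scheme \<Rightarrow> 'o \<Rightarrow> 'o \<Rightarrow> 'm \<Rightarrow> bool" where
  "has_retraction A X Y j \<longleftrightarrow> (\<exists>r\<in>Hom A Y X. r \<cdot>\<^bsub>A\<^esub> j = ident A X)"

definition is_zero_object :: "('o, 'm, 'x) category_scheme \<Rightarrow> 'o \<Rightarrow> bool" where
  "is_zero_object A Z \<longleftrightarrow> Z \<in> Obj A \<and>
    (\<forall>X\<in>Obj A. (\<exists>!f. f \<in> Hom A Z X) \<and> (\<exists>!f. f \<in> Hom A X Z))"


section \<open>Abelian categories\<close>

record ('o, 'm) preadditive = "('o, 'm) category" +
  add :: "'m \<Rightarrow> 'm \<Rightarrow> 'm"  (infixl \<open>\<boxplus>\<index>\<close> 65)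
  zero_mor :: "'o \<Rightarrow> 'o \<Rightarrow> 'm"

definition hom_group :: "('o, 'm, 'x) preadditive_scheme \<Rightarrow> 'o \<Rightarrow> 'o \<Rightarrow> 'm monoid" where
  "hom_group A X Y = \<lparr>carrier = Hom A X Y, mult = add A, one = zero_mor A X Y\<rparr>"

locale preadditive_category = category A
  for A :: "('o, 'm, 'x) preadditive_scheme" (structure) +
  assumes hom_comm_group: "\<lbrakk>X \<in> Obj A; Y \<in> Obj A\<rbrakk> \<Longrightarrow> comm_group (hom_group A X Y)"
    and comp_add: "\<lbrakk>X \<in> Obj A; Y \<in> Obj A; Z \<in> Obj A;
      f \<in> Hom A X Y; g \<in> Hom A X Y; h \<in> Hom A Y Z\<rbrakk> \<Longrightarrow> h \<cdot> (f \<boxplus> g) = (h \<cdot> f) \<boxplus> (h \<cdot> g)"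
    and add_comp: "\<lbrakk>X \<in> Obj A; Y \<in> Obj A; Z \<in> Obj A;
      f \<in> Hom A Y Z; g \<in> Hom A Y Z; h \<in> Hom A X Y\<rbrakk> \<Longrightarrow> (f \<boxplus> g) \<cdot> h = (f \<cdot> h) \<boxplus> (g \<cdot> h)"

definition is_kernel ::
  "('o, 'm, 'x) preadditive_scheme \<Rightarrow> 'o \<Rightarrow> 'o \<Rightarrow> 'm \<Rightarrow> 'o \<Rightarrow> 'm \<Rightarrow> bool" where
  "is_kernel A X Y f K k \<longleftrightarrow>
    X \<in> Obj A \<and> Y \<in> Obj A \<and> f \<in> Hom A X Y \<and> K \<in> Obj A \<and> k \<in> Hom A K X \<and>
    f \<cdot>\<^bsub>A\<^esub> k = zero_mor A K Y \<and>
    (\<forall>W\<in>Obj A. \<forall>h\<in>Hom A W X. f \<cdot>\<^bsub>A\<^esub> h = zero_mor A W Y \<longrightarrow>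
      (\<exists>!u. u \<in> Hom A W K \<and> k \<cdot>\<^bsub>A\<^esub> u = h))"

definition is_cokernel ::
  "('o, 'm, 'x) preadditive_scheme \<Rightarrow> 'o \<Rightarrow> 'o \<Rightarrow> 'm \<Rightarrow> 'o \<Rightarrow> 'm \<Rightarrow> bool" where
  "is_cokernel A X Y f Q q \<longleftrightarrow>
    X \<in> Obj A \<and> Y \<in> Obj A \<and> f \<in> Hom A X Y \<and> Q \<in> Obj A \<and> q \<in> Hom A Y Q \<and>
    q \<cdot>\<^bsub>A\<^esub> f = zero_mor A X Q \<and>
    (\<forall>W\<in>Obj A. \<forall>h\<in>Hom A Y W. h \<cdot>\<^bsub>A\<^esub> f = zero_mor A X W \<longrightarrow>
      (\<exists>!u. u \<in> Hom A Q W \<and> u \<cdot>\<^bsub>A\<^esub> q = h))"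

definition is_biproduct ::
  "('o, 'm, 'x) preadditive_scheme \<Rightarrow> 'o \<Rightarrow> 'o \<Rightarrow> 'o \<Rightarrow> 'm \<Rightarrow> 'm \<Rightarrow> 'm \<Rightarrow> 'm \<Rightarrow> bool" where
  "is_biproduct A X Y B i1 i2 p1 p2 \<longleftrightarrow> B \<in> Obj A \<and>
    i1 \<in> Hom A X B \<and> i2 \<in> Hom A Y B \<and> p1 \<in> Hom A B X \<and> p2 \<in> Hom A B Y \<and>
    p1 \<cdot>\<^bsub>A\<^esub> i1 = ident A X \<and> p2 \<cdot>\<^bsub>A\<^esub> i2 = ident A Y \<and>
    (i1 \<cdot>\<^bsub>A\<^esub> p1) \<boxplus>\<^bsub>A\<^esub> (i2 \<cdot>\<^bsub>A\<^esub> p2) = ident A B"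

locale abelian_category = preadditive_category A
  for A :: "('o, 'm, 'x) preadditive_scheme" (structure) +
  assumes ex_zero_object: "\<exists>Z. is_zero_object A Z"
    and ex_biproduct: "\<lbrakk>X \<in> Obj A; Y \<in> Obj A\<rbrakk> \<Longrightarrow> \<exists>B i1 i2 p1 p2. is_biproduct A X Y B i1 i2 p1 p2"
    and ex_kernel: "\<lbrakk>X \<in> Obj A; Y \<in> Obj A; f \<in> Hom A X Y\<rbrakk> \<Longrightarrow> \<exists>K k. is_kernel A X Y f K k"
    and ex_cokernel: "\<lbrakk>X \<in> Obj A; Y \<in> Obj A; f \<in> Hom A X Y\<rbrakk> \<Longrightarrow> \<exists>Q q. is_cokernel A X Y f Q q"
    and mono_normal: "is_mono A X Y f \<Longrightarrow> \<exists>Z g. is_kernel A Y Z g X f"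
    and epi_normal: "is_epi A X Y f \<Longrightarrow> \<exists>Z g. is_cokernel A Z X g Y f"


section \<open>Relative injectivity and relative Ext groups\<close>

text \<open>As arrows do not determine their domain and codomain, a class of morphisms is a predicate
  on a pair of objects and an arrow.\<close>

definition rel_injective ::
  "('o, 'm, 'x) category_scheme \<Rightarrow> ('o \<Rightarrow> 'o \<Rightarrow> 'm \<Rightarrow> bool) \<Rightarrow> 'o \<Rightarrow> bool" where
  "rel_injective A I Q \<longleftrightarrow> Q \<in> Obj A \<and>
    (\<forall>X\<in>Obj A. \<forall>Y\<in>Obj A. \<forall>j\<in>Hom A X Y. I X Y j \<longrightarrow>
      (\<lambda>g. g \<cdot>\<^bsub>A\<^esub> j) ` Hom A Y Q = Hom A X Q)"

text \<open>The image is the kernel of the cokernel, the coimage the cokernel of the kernel.\<close>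

definition is_image ::
  "('o, 'm, 'x) preadditive_scheme \<Rightarrow> 'o \<Rightarrow> 'o \<Rightarrow> 'm \<Rightarrow> 'o \<Rightarrow> 'm \<Rightarrow> bool" where
  "is_image A X Y f E j \<longleftrightarrow> (\<exists>Q q. is_cokernel A X Y f Q q \<and> is_kernel A Y Q q E j)"

definition is_coimage ::
  "('o, 'm, 'x) preadditive_scheme \<Rightarrow> 'o \<Rightarrow> 'o \<Rightarrow> 'm \<Rightarrow> 'o \<Rightarrow> 'm \<Rightarrow> bool" where
  "is_coimage A X Y f E p \<longleftrightarrow> (\<exists>K k. is_kernel A X Y f K k \<and> is_cokernel A K X k E p)"

definition canonical_factorization ::
  "('o, 'm, 'x) preadditive_scheme \<Rightarrow> 'o \<Rightarrow> 'o \<Rightarrow> 'm \<Rightarrow> 'o \<Rightarrow> 'm \<Rightarrow> 'm \<Rightarrow> bool" where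
  "canonical_factorization A X Y f E j p \<longleftrightarrow>
    is_coimage A X Y f E p \<and> is_image A X Y f E j \<and> f = j \<cdot>\<^bsub>A\<^esub> p"

definition exact_at ::
  "('o, 'm, 'x) preadditive_scheme \<Rightarrow> 'o \<Rightarrow> 'm \<Rightarrow> 'o \<Rightarrow> 'm \<Rightarrow> 'o \<Rightarrow> bool" where
  "exact_at A X f Y g Z \<longleftrightarrow> (\<exists>E j. is_image A X Y f E j \<and> is_kernel A Y Z g E j)"

definition admissible ::
  "('o, 'm, 'x) preadditive_scheme \<Rightarrow> ('o \<Rightarrow> 'o \<Rightarrow> 'm \<Rightarrow> bool) \<Rightarrow> 'o \<Rightarrow> 'o \<Rightarrow> 'm \<Rightarrow> bool" where
  "admissible A I X Y f \<longleftrightarrow> (\<exists>E j p. canonical_factorization A X Y f E j p \<and> I E Y j)"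

text \<open>The sequence is \<open>0 \<rightarrow> N \<rightarrow> Q 0 \<rightarrow> Q 1 \<rightarrow> \<dots>\<close> with augmentation \<open>\<eta>\<close> and differentials
  \<open>d n\<close> from \<open>Q n\<close> to \<open>Q (Suc n)\<close>; exactness at \<open>N\<close> says that \<open>\<eta>\<close> is a monomorphism.\<close>

definition rel_injective_resolution ::
  "('o, 'm, 'x) preadditive_scheme \<Rightarrow> ('o \<Rightarrow> 'o \<Rightarrow> 'm \<Rightarrow> bool) \<Rightarrow> 'o \<Rightarrow>
    (nat \<Rightarrow> 'o) \<Rightarrow> (nat \<Rightarrow> 'm) \<Rightarrow> 'm \<Rightarrow> bool" where
  "rel_injective_resolution A I N Q d \<eta> \<longleftrightarrow>
    (\<forall>n. rel_injective A I (Q n)) \<and>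
    is_mono A N (Q 0) \<eta> \<and>
    exact_at A N \<eta> (Q 0) (d 0) (Q 1) \<and>
    (\<forall>n. exact_at A (Q n) (d n) (Q (Suc n)) (d (Suc n)) (Q (Suc (Suc n)))) \<and>
    admissible A I N (Q 0) \<eta> \<and>
    (\<forall>n. admissible A I (Q n) (Q (Suc n)) (d n))"

definition hom_cocycles ::
  "('o, 'm, 'x) preadditive_scheme \<Rightarrow> 'o \<Rightarrow> (nat \<Rightarrow> 'o) \<Rightarrow> (nat \<Rightarrow> 'm) \<Rightarrow> nat \<Rightarrow> 'm set" where
  "hom_cocycles A X Q d n =
    kernel (hom_group A X (Q n)) (hom_group A X (Q (Suc n))) (\<lambda>f. d n \<cdot>\<^bsub>A\<^esub> f)"

fun hom_coboundaries ::
  "('o, 'm, 'x) preadditive_scheme \<Rightarrow> 'o \<Rightarrow> (nat \<Rightarrow> 'o) \<Rightarrow> (nat \<Rightarrow> 'm) \<Rightarrow> nat \<Rightarrow> 'm set" where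
  "hom_coboundaries A X Q d 0 = {zero_mor A X (Q 0)}"
| "hom_coboundaries A X Q d (Suc n) = (\<lambda>f. d n \<cdot>\<^bsub>A\<^esub> f) ` Hom A X (Q n)"

definition hom_cohomology ::
  "('o, 'm, 'x) preadditive_scheme \<Rightarrow> 'o \<Rightarrow> (nat \<Rightarrow> 'o) \<Rightarrow> (nat \<Rightarrow> 'm) \<Rightarrow> nat \<Rightarrow> 'm set monoid" where
  "hom_cohomology A X Q d n =
    (hom_group A X (Q n))\<lparr>carrier := hom_cocycles A X Q d n\<rparr> Mod hom_coboundaries A X Q d n"

text \<open>As usual, the groups are computed from a chosen resolution; different choices give
  isomorphic groups. For bicomodules resolutions always exist, since every \<open>N\<close> embeds into the cofree
  bicomodule \<open>C \<otimes> N \<otimes> C\<close> by a monomorphism split by the counits.\<close>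

definition rel_Ext ::
  "('o, 'm, 'x) preadditive_scheme \<Rightarrow> ('o \<Rightarrow> 'o \<Rightarrow> 'm \<Rightarrow> bool) \<Rightarrow> nat \<Rightarrow> 'o \<Rightarrow> 'o \<Rightarrow> 'm set monoid" where
  "rel_Ext A I n X N =
    (let (Q, d, \<eta>) = (SOME (Q, d, \<eta>). rel_injective_resolution A I N Q d \<eta>)
     in hom_cohomology A X Q d n)"


section \<open>Abelian monoidal categories\<close>

record ('o, 'm) monoidal = "('o, 'm) preadditive" +
  tensor :: "'o \<Rightarrow> 'o \<Rightarrow> 'o"  (infixr \<open>\<boxtimes>\<index>\<close> 75)
  tensor_mor :: "'m \<Rightarrow> 'm \<Rightarrow> 'm"  (infixr \<open>\<star>\<index>\<close> 75)
  unit_obj :: "'o"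
  associator :: "'o \<Rightarrow> 'o \<Rightarrow> 'o \<Rightarrow> 'm"
  lunitor :: "'o \<Rightarrow> 'm"
  runitor :: "'o \<Rightarrow> 'm"

locale monoidal_category = category M
  for M :: "('o, 'm, 'x) monoidal_scheme" (structure) +
  assumes unit_obj: "unit_obj M \<in> Obj M"
    and tensor_obj: "\<lbrakk>X \<in> Obj M; Y \<in> Obj M\<rbrakk> \<Longrightarrow> X \<boxtimes> Y \<in> Obj M"
    and tensor_hom: "\<lbrakk>X \<in> Obj M; X' \<in> Obj M; Y \<in> Obj M; Y' \<in> Obj M;
      f \<in> Hom M X X'; g \<in> Hom M Y Y'\<rbrakk> \<Longrightarrow> f \<star> g \<in> Hom M (X \<boxtimes> Y) (X' \<boxtimes> Y')"
    and tensor_ident: "\<lbrakk>X \<in> Obj M; Y \<in> Obj M\<rbrakk> \<Longrightarrow> ident M X \<star> ident M Y = ident M (X \<boxtimes> Y)"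
    and tensor_comp: "\<lbrakk>X \<in> Obj M; X' \<in> Obj M; X'' \<in> Obj M; Y \<in> Obj M; Y' \<in> Obj M; Y'' \<in> Obj M;
      f \<in> Hom M X X'; f' \<in> Hom M X' X''; g \<in> Hom M Y Y'; g' \<in> Hom M Y' Y''\<rbrakk>
      \<Longrightarrow> (f' \<cdot> f) \<star> (g' \<cdot> g) = (f' \<star> g') \<cdot> (f \<star> g)"
    and associator_iso: "\<lbrakk>X \<in> Obj M; Y \<in> Obj M; Z \<in> Obj M\<rbrakk>
      \<Longrightarrow> is_iso M ((X \<boxtimes> Y) \<boxtimes> Z) (X \<boxtimes> (Y \<boxtimes> Z)) (associator M X Y Z)"
    and associator_natural: "\<lbrakk>X \<in> Obj M; X' \<in> Obj M; Y \<in> Obj M; Y' \<in> Obj M; Z \<in> Obj M; Z' \<in> Obj M;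
      f \<in> Hom M X X'; g \<in> Hom M Y Y'; h \<in> Hom M Z Z'\<rbrakk>
      \<Longrightarrow> associator M X' Y' Z' \<cdot> ((f \<star> g) \<star> h) = (f \<star> (g \<star> h)) \<cdot> associator M X Y Z"
    and lunitor_iso: "X \<in> Obj M \<Longrightarrow> is_iso M (unit_obj M \<boxtimes> X) X (lunitor M X)"
    and lunitor_natural: "\<lbrakk>X \<in> Obj M; Y \<in> Obj M; f \<in> Hom M X Y\<rbrakk>
      \<Longrightarrow> lunitor M Y \<cdot> (ident M (unit_obj M) \<star> f) = f \<cdot> lunitor M X"
    and runitor_iso: "X \<in> Obj M \<Longrightarrow> is_iso M (X \<boxtimes> unit_obj M) X (runitor M X)"
    and runitor_natural: "\<lbrakk>X \<in> Obj M; Y \<in> Obj M; f \<in> Hom M X Y\<rbrakk>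
      \<Longrightarrow> runitor M Y \<cdot> (f \<star> ident M (unit_obj M)) = f \<cdot> runitor M X"
    and pentagon: "\<lbrakk>W \<in> Obj M; X \<in> Obj M; Y \<in> Obj M; Z \<in> Obj M\<rbrakk>
      \<Longrightarrow> associator M W X (Y \<boxtimes> Z) \<cdot> associator M (W \<boxtimes> X) Y Z =
          (ident M W \<star> associator M X Y Z) \<cdot> associator M W (X \<boxtimes> Y) Z \<cdot>
          (associator M W X Y \<star> ident M Z)"
    and triangle: "\<lbrakk>X \<in> Obj M; Y \<in> Obj M\<rbrakk>
      \<Longrightarrow> (ident M X \<star> lunitor M Y) \<cdot> associator M X (unit_obj M) Y = runitor M X \<star> ident M Y"

text \<open>Biadditivity of the tensor product is what makes the sum of two bicomodule morphisms a
  bicomodule morphism. No exactness of the tensor product is required.\<close>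

locale abelian_monoidal_category = abelian_category M + monoidal_category M
  for M :: "('o, 'm, 'x) monoidal_scheme" (structure) +
  assumes tensor_add_right: "\<lbrakk>X \<in> Obj M; Y \<in> Obj M; Z \<in> Obj M; f \<in> Hom M Y Z; g \<in> Hom M Y Z\<rbrakk>
      \<Longrightarrow> ident M X \<star> (f \<boxplus> g) = (ident M X \<star> f) \<boxplus> (ident M X \<star> g)"
    and tensor_add_left: "\<lbrakk>X \<in> Obj M; Y \<in> Obj M; Z \<in> Obj M; f \<in> Hom M Y Z; g \<in> Hom M Y Z\<rbrakk>
      \<Longrightarrow> (f \<boxplus> g) \<star> ident M X = (f \<star> ident M X) \<boxplus> (g \<star> ident M X)"


section \<open>Coalgebras and bicomodules\<close>

locale coalgebra = monoidal_category M
  for M :: "('o, 'm, 'x) monoidal_scheme" (structure) +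
  fixes C :: 'o and \<Delta> :: 'm and \<epsilon> :: 'm
  assumes coalg_obj: "C \<in> Obj M"
    and comult_hom: "\<Delta> \<in> Hom M C (C \<boxtimes> C)"
    and counit_hom: "\<epsilon> \<in> Hom M C (unit_obj M)"
    and coassociative: "associator M C C C \<cdot> (\<Delta> \<star> ident M C) \<cdot> \<Delta> = (ident M C \<star> \<Delta>) \<cdot> \<Delta>"
    and counit_left: "lunitor M C \<cdot> (\<epsilon> \<star> ident M C) \<cdot> \<Delta> = ident M C"
    and counit_right: "runitor M C \<cdot> (ident M C \<star> \<epsilon>) \<cdot> \<Delta> = ident M C"

definition left_comodule ::
  "('o, 'm, 'x) monoidal_scheme \<Rightarrow> 'o \<Rightarrow> 'm \<Rightarrow> 'm \<Rightarrow> 'o \<Rightarrow> 'm \<Rightarrow> bool" where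
  "left_comodule M C \<Delta> \<epsilon> X l \<longleftrightarrow> X \<in> Obj M \<and> l \<in> Hom M X (C \<boxtimes>\<^bsub>M\<^esub> X) \<and>
    associator M C C X \<cdot>\<^bsub>M\<^esub> (\<Delta> \<star>\<^bsub>M\<^esub> ident M X) \<cdot>\<^bsub>M\<^esub> l = (ident M C \<star>\<^bsub>M\<^esub> l) \<cdot>\<^bsub>M\<^esub> l \<and>
    lunitor M X \<cdot>\<^bsub>M\<^esub> (\<epsilon> \<star>\<^bsub>M\<^esub> ident M X) \<cdot>\<^bsub>M\<^esub> l = ident M X"

definition right_comodule ::
  "('o, 'm, 'x) monoidal_scheme \<Rightarrow> 'o \<Rightarrow> 'm \<Rightarrow> 'm \<Rightarrow> 'o \<Rightarrow> 'm \<Rightarrow> bool" where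
  "right_comodule M C \<Delta> \<epsilon> X r \<longleftrightarrow> X \<in> Obj M \<and> r \<in> Hom M X (X \<boxtimes>\<^bsub>M\<^esub> C) \<and>
    associator M X C C \<cdot>\<^bsub>M\<^esub> (r \<star>\<^bsub>M\<^esub> ident M C) \<cdot>\<^bsub>M\<^esub> r = (ident M X \<star>\<^bsub>M\<^esub> \<Delta>) \<cdot>\<^bsub>M\<^esub> r \<and>
    runitor M X \<cdot>\<^bsub>M\<^esub> (ident M X \<star>\<^bsub>M\<^esub> \<epsilon>) \<cdot>\<^bsub>M\<^esub> r = ident M X"

definition bicomodule ::
  "('o, 'm, 'x) monoidal_scheme \<Rightarrow> 'o \<Rightarrow> 'm \<Rightarrow> 'm \<Rightarrow> 'o \<Rightarrow> 'm \<Rightarrow> 'm \<Rightarrow> bool" where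
  "bicomodule M C \<Delta> \<epsilon> X l r \<longleftrightarrow> left_comodule M C \<Delta> \<epsilon> X l \<and> right_comodule M C \<Delta> \<epsilon> X r \<and>
    associator M C X C \<cdot>\<^bsub>M\<^esub> (l \<star>\<^bsub>M\<^esub> ident M C) \<cdot>\<^bsub>M\<^esub> r = (ident M C \<star>\<^bsub>M\<^esub> r) \<cdot>\<^bsub>M\<^esub> l"

definition bicomodule_hom ::
  "('o, 'm, 'x) monoidal_scheme \<Rightarrow> 'o \<Rightarrow> 'o \<times> 'm \<times> 'm \<Rightarrow> 'o \<times> 'm \<times> 'm \<Rightarrow> 'm set" where
  "bicomodule_hom M C = (\<lambda>(X, l, r) (Y, l', r').
    {f \<in> Hom M X Y. l' \<cdot>\<^bsub>M\<^esub> f = (ident M C \<star>\<^bsub>M\<^esub> f) \<cdot>\<^bsub>M\<^esub> l \<and>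
                    r' \<cdot>\<^bsub>M\<^esub> f = (f \<star>\<^bsub>M\<^esub> ident M C) \<cdot>\<^bsub>M\<^esub> r})"

definition bicomodule_category ::
  "('o, 'm, 'x) monoidal_scheme \<Rightarrow> 'o \<Rightarrow> 'm \<Rightarrow> 'm \<Rightarrow> ('o \<times> 'm \<times> 'm, 'm) preadditive" where
  "bicomodule_category M C \<Delta> \<epsilon> =
    \<lparr>Obj = {(X, l, r). bicomodule M C \<Delta> \<epsilon> X l r},
     Hom = bicomodule_hom M C,
     ident = (\<lambda>(X, l, r). ident M X),
     comp = comp M,
     add = add M,
     zero_mor = (\<lambda>(X, l, r) (Y, l', r'). zero_mor M X Y)\<rparr>"

definition regular_bicomodule :: "'o \<Rightarrow> 'm \<Rightarrow> 'o \<times> 'm \<times> 'm" where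
  "regular_bicomodule C \<Delta> = (C, \<Delta>, \<Delta>)"

text \<open>\<open>C \<otimes> C\<close> with the left coaction of the first and the right coaction of the second factor.\<close>

definition tensor_square_bicomodule ::
  "('o, 'm, 'x) monoidal_scheme \<Rightarrow> 'o \<Rightarrow> 'm \<Rightarrow> 'o \<times> 'm \<times> 'm" where
  "tensor_square_bicomodule M C \<Delta> =
    (C \<boxtimes>\<^bsub>M\<^esub> C,
     associator M C C C \<cdot>\<^bsub>M\<^esub> (\<Delta> \<star>\<^bsub>M\<^esub> ident M C),
     inverse_mor M ((C \<boxtimes>\<^bsub>M\<^esub> C) \<boxtimes>\<^bsub>M\<^esub> C) (C \<boxtimes>\<^bsub>M\<^esub> (C \<boxtimes>\<^bsub>M\<^esub> C)) (associator M C C C)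
       \<cdot>\<^bsub>M\<^esub> (ident M C \<star>\<^bsub>M\<^esub> \<Delta>))"

definition coseparable :: "('o, 'm, 'x) monoidal_scheme \<Rightarrow> 'o \<Rightarrow> 'm \<Rightarrow> 'm \<Rightarrow> bool" where
  "coseparable M C \<Delta> \<epsilon> \<longleftrightarrow>
    has_retraction (bicomodule_category M C \<Delta> \<epsilon>)
      (regular_bicomodule C \<Delta>) (tensor_square_bicomodule M C \<Delta>) \<Delta>"

definition split_mono_class ::
  "('o, 'm, 'x) monoidal_scheme \<Rightarrow> 'o \<Rightarrow> 'm \<Rightarrow> 'm \<Rightarrow>
    'o \<times> 'm \<times> 'm \<Rightarrow> 'o \<times> 'm \<times> 'm \<Rightarrow> 'm \<Rightarrow> bool" where
  "split_mono_class M C \<Delta> \<epsilon> X Y j \<longleftrightarrow>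
    is_mono (bicomodule_category M C \<Delta> \<epsilon>) X Y j \<and> has_retraction M (fst X) (fst Y) j"

definition hochschild ::
  "('o, 'm, 'x) monoidal_scheme \<Rightarrow> 'o \<Rightarrow> 'm \<Rightarrow> 'm \<Rightarrow> nat \<Rightarrow> 'o \<times> 'm \<times> 'm \<Rightarrow> 'm set monoid" where
  "hochschild M C \<Delta> \<epsilon> n X =
    rel_Ext (bicomodule_category M C \<Delta> \<epsilon>) (split_mono_class M C \<Delta> \<epsilon>) n X (regular_bicomodule C \<Delta>)"

end

theory Submission
  imports Defs
begin

text \<open>The functors \<open>C \<otimes> -\<close> and \<open>- \<otimes> C\<close> are comonads and the associator is a distributive law between
  them; bicomodules are the objects carrying compatible coalgebra structures for both. Hence the cofree
  bicomodules \<open>C \<otimes> (N \<otimes> C)\<close>, and likewise \<open>C \<otimes> C\<close>, are relatively injective, every bicomodule embeds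
  into a cofree one by a map split by the counits, and \<open>C\<close> is relatively injective iff it is a retract
  of \<open>C \<otimes> C\<close>. The tensor product need not be exact, but cokernels of monomorphisms that split in the
  underlying category are preserved by every additive functor, so they lift to bicomodules and relative
  injective resolutions exist. A resolution is a splice of short exact sequences
  \<open>0 \<rightarrow> E n \<rightarrow> Q n \<rightarrow> E (Suc n) \<rightarrow> 0\<close> with \<open>E 0 = C\<close>. If the first cohomology vanishes, the inclusion of
  \<open>E 1\<close> into \<open>Q 1\<close> is a coboundary, which splits the first sequence and makes \<open>C\<close> a retract of \<open>Q 0\<close>.
  If \<open>C\<close> is relatively injective, all the sequences split one after the other.\<close>

section \<open>Kernels and cokernels in preadditive categories\<close>

text \<open>When the tensor product is not exact, kernels and cokernels need not lift to
  bicomodules. The homological part therefore lives in a preadditive category with a zero object,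
  under the hypothesis that each object starts a short exact sequence whose first map lies in the
  class and whose middle term is relatively injective. Images are determined only up to isomorphism,
  and exactness and admissibility each bring their own; they are compared through the maps that
  kernels and cokernels annihilate.

  The two cofree bicomodules in play are both of the form C \<otimes> Y with Y a right comodule: Y =
  N \<otimes> C serves for the embedding, Y = C gives C \<otimes> C. Transposing along the
  adjunction for C \<otimes> - reduces the extension of a bicomodule map to that of a right comodule
  map into Y. For Y = N \<otimes> C a second transposition leads down to the underlying category,
  where the given retraction solves the problem; Y = C inherits the solution as a retract of the
  cofree right comodule on C.\<close>

lemma hom_group_simps [simp]:
  "carrier (hom_group A X Y) = Hom A X Y"
  "mult (hom_group A X Y) = add A"
  "one (hom_group A X Y) = zero_mor A X Y"
  by (simp_all add: hom_group_def)

context preadditive_category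
begin

lemma zero_hom: "\<lbrakk>X \<in> Obj A; Y \<in> Obj A\<rbrakk> \<Longrightarrow> zero_mor A X Y \<in> Hom A X Y"
  using monoid.one_closed[OF group.is_monoid[OF comm_group.axioms(2)[OF hom_comm_group]]] by simp

lemma zero_add:
  "\<lbrakk>X \<in> Obj A; Y \<in> Obj A; f \<in> Hom A X Y\<rbrakk> \<Longrightarrow> zero_mor A X Y \<boxplus> f = f"
  using monoid.l_one[OF group.is_monoid[OF comm_group.axioms(2)[OF hom_comm_group]]] by simp

lemma add_zero:
  "\<lbrakk>X \<in> Obj A; Y \<in> Obj A; f \<in> Hom A X Y\<rbrakk> \<Longrightarrow> f \<boxplus> zero_mor A X Y = f"
  using monoid.r_one[OF group.is_monoid[OF comm_group.axioms(2)[OF hom_comm_group]]] by simp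

lemma add_idem_imp_zero:
  "\<lbrakk>X \<in> Obj A; Y \<in> Obj A; f \<in> Hom A X Y; f \<boxplus> f = f\<rbrakk> \<Longrightarrow> f = zero_mor A X Y"
  using group.r_cancel_one[OF comm_group.axioms(2)[OF hom_comm_group, of X Y], of f f] by simp

text \<open>The record has no negation; \<open>h\<close> is the difference of \<open>g\<close> and
  \<open>f\<close>. With \<open>g\<close> an identity and \<open>f\<close> an idempotent it becomes
  the complementary idempotent.\<close>

lemma ex_complement:
  assumes "X \<in> Obj A" "Y \<in> Obj A" "f \<in> Hom A X Y" "g \<in> Hom A X Y"
  obtains h where "h \<in> Hom A X Y" "h \<boxplus> f = g"
proof -
  interpret G: comm_group "hom_group A X Y" using hom_comm_group assms by blast
  have c: "f \<in> carrier (hom_group A X Y)" "g \<in> carrier (hom_group A X Y)" using assms by simp_all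
  have "mult (hom_group A X Y) (mult (hom_group A X Y) g (m_inv (hom_group A X Y) f)) f = g"
    using c by (simp add: G.m_assoc del: hom_group_simps)
  moreover have "mult (hom_group A X Y) g (m_inv (hom_group A X Y) f) \<in> Hom A X Y"
    using G.m_closed[of g "m_inv (hom_group A X Y) f"] G.inv_closed assms by simp
  ultimately show thesis using that by simp
qed

lemma add_eq_right_imp_zero:
  "\<lbrakk>X \<in> Obj A; Y \<in> Obj A; f \<in> Hom A X Y; g \<in> Hom A X Y; f \<boxplus> g = g\<rbrakk> \<Longrightarrow> f = zero_mor A X Y"
  using group.r_cancel_one[OF comm_group.axioms(2)[OF hom_comm_group, of X Y], of g f] by simp

lemma comp_zero:
  assumes "X \<in> Obj A" "Y \<in> Obj A" "Z \<in> Obj A" "h \<in> Hom A Y Z"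
  shows "h \<cdot> zero_mor A X Y = zero_mor A X Z"
  using comp_add[OF assms(1-3) zero_hom zero_hom assms(4)] assms
  by (intro add_idem_imp_zero) (auto intro: comp_hom zero_hom simp: zero_add zero_hom)

lemma zero_comp:
  assumes "X \<in> Obj A" "Y \<in> Obj A" "Z \<in> Obj A" "h \<in> Hom A X Y"
  shows "zero_mor A Y Z \<cdot> h = zero_mor A X Z"
  using add_comp[OF assms(1-3) zero_hom zero_hom assms(4)] assms
  by (intro add_idem_imp_zero) (auto intro: comp_hom zero_hom simp: zero_add zero_hom)

lemma kernel_imp_mono:
  assumes "is_kernel A X Y f K k"
  shows "is_mono A K X k"
  unfolding is_mono_def
proof (intro conjI ballI impI)
  have ob: "X \<in> Obj A" "Y \<in> Obj A" "f \<in> Hom A X Y" "K \<in> Obj A" "k \<in> Hom A K X"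
    and fk: "f \<cdot> k = zero_mor A K Y"
    and uni: "\<And>W h. \<lbrakk>W \<in> Obj A; h \<in> Hom A W X; f \<cdot> h = zero_mor A W Y\<rbrakk>
      \<Longrightarrow> \<exists>!u. u \<in> Hom A W K \<and> k \<cdot> u = h"
    using assms unfolding is_kernel_def by blast+
  show "K \<in> Obj A" "X \<in> Obj A" "k \<in> Hom A K X" by fact+
  fix W g h assume W: "W \<in> Obj A" "g \<in> Hom A W K" "h \<in> Hom A W K" "k \<cdot> g = k \<cdot> h"
  have "f \<cdot> (k \<cdot> g) = zero_mor A W Y"
    using comp_assoc[OF W(1) ob(4,1,2) W(2) ob(5,3)] fk zero_comp[OF W(1) ob(4,2) W(2)] by simp
  from uni[OF W(1) comp_hom[OF W(1) ob(4,1) W(2) ob(5)] this] W show "g = h" by metis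
qed

lemma cokernel_imp_epi:
  assumes "is_cokernel A X Y f Q q"
  shows "is_epi A Y Q q"
  unfolding is_epi_def
proof (intro conjI ballI impI)
  have ob: "X \<in> Obj A" "Y \<in> Obj A" "f \<in> Hom A X Y" "Q \<in> Obj A" "q \<in> Hom A Y Q"
    and fk: "q \<cdot> f = zero_mor A X Q"
    and uni: "\<And>W h. \<lbrakk>W \<in> Obj A; h \<in> Hom A Y W; h \<cdot> f = zero_mor A X W\<rbrakk>
      \<Longrightarrow> \<exists>!u. u \<in> Hom A Q W \<and> u \<cdot> q = h"
    using assms unfolding is_cokernel_def by blast+
  show "Y \<in> Obj A" "Q \<in> Obj A" "q \<in> Hom A Y Q" by fact+
  fix W g h assume W: "W \<in> Obj A" "g \<in> Hom A Q W" "h \<in> Hom A Q W" "g \<cdot> q = h \<cdot> q"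
  have "(g \<cdot> q) \<cdot> f = zero_mor A X W"
    using comp_assoc[OF ob(1,2,4) W(1) ob(3,5) W(2)] fk comp_zero[OF ob(1,4) W(1,2)] by simp
  from uni[OF W(1) comp_hom[OF ob(2,4) W(1) ob(5) W(2)] this] W show "g = h" by metis
qed

text \<open>The universal property mentions the morphism only through the maps that it annihilates,
  so morphisms with different targets may share a kernel.\<close>

lemma kernel_cong:
  assumes "is_kernel A X Y f K k" "Y' \<in> Obj A" "f' \<in> Hom A X Y'"
    and "\<And>W h. \<lbrakk>W \<in> Obj A; h \<in> Hom A W X\<rbrakk> \<Longrightarrow>
      f \<cdot> h = zero_mor A W Y \<longleftrightarrow> f' \<cdot> h = zero_mor A W Y'"
  shows "is_kernel A X Y' f' K k"
proof -
  have "f' \<cdot> k = zero_mor A K Y'" using assms unfolding is_kernel_def by blast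
  then show ?thesis using assms unfolding is_kernel_def by simp
qed

lemma cokernel_cong:
  assumes "is_cokernel A X Y f Q q" "X' \<in> Obj A" "f' \<in> Hom A X' Y"
    and "\<And>W h. \<lbrakk>W \<in> Obj A; h \<in> Hom A Y W\<rbrakk> \<Longrightarrow>
      h \<cdot> f = zero_mor A X W \<longleftrightarrow> h \<cdot> f' = zero_mor A X' W"
  shows "is_cokernel A X' Y f' Q q"
proof -
  have "q \<cdot> f' = zero_mor A X' Q" using assms unfolding is_cokernel_def by blast
  then show ?thesis using assms unfolding is_cokernel_def by simp
qed

lemma kernel_annihilates_iff:
  assumes "is_kernel A X Y f K k" "W \<in> Obj A" "h \<in> Hom A W X"
  shows "f \<cdot> h = zero_mor A W Y \<longleftrightarrow> (\<exists>u\<in>Hom A W K. h = k \<cdot> u)"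
proof
  assume "f \<cdot> h = zero_mor A W Y"
  then show "\<exists>u\<in>Hom A W K. h = k \<cdot> u" using assms unfolding is_kernel_def by metis
next
  have ob: "X \<in> Obj A" "Y \<in> Obj A" "f \<in> Hom A X Y" "K \<in> Obj A" "k \<in> Hom A K X"
    and fk: "f \<cdot> k = zero_mor A K Y"
    using assms unfolding is_kernel_def by blast+
  assume "\<exists>u\<in>Hom A W K. h = k \<cdot> u"
  then obtain u where u: "u \<in> Hom A W K" "h = k \<cdot> u" by blast
  then show "f \<cdot> h = zero_mor A W Y"
    using comp_assoc[OF assms(2) ob(4,1,2) u(1) ob(5,3)] fk zero_comp[OF assms(2) ob(4,2) u(1)]
    by simp
qed

lemma cokernel_annihilates_iff:
  assumes "is_cokernel A X Y f Q q" "W \<in> Obj A" "h \<in> Hom A Y W"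
  shows "h \<cdot> f = zero_mor A X W \<longleftrightarrow> (\<exists>u\<in>Hom A Q W. h = u \<cdot> q)"
proof
  assume "h \<cdot> f = zero_mor A X W"
  then show "\<exists>u\<in>Hom A Q W. h = u \<cdot> q" using assms unfolding is_cokernel_def by metis
next
  have ob: "X \<in> Obj A" "Y \<in> Obj A" "f \<in> Hom A X Y" "Q \<in> Obj A" "q \<in> Hom A Y Q"
    and fk: "q \<cdot> f = zero_mor A X Q"
    using assms unfolding is_cokernel_def by blast+
  assume "\<exists>u\<in>Hom A Q W. h = u \<cdot> q"
  then obtain u where u: "u \<in> Hom A Q W" "h = u \<cdot> q" by blast
  then show "h \<cdot> f = zero_mor A X W"
    using comp_assoc[OF ob(1,2,4) assms(2) ob(3,5) u(1)] fk comp_zero[OF ob(1,4) assms(2) u(1)]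
    by simp
qed

lemma kernels_annihilate_same:
  assumes "is_kernel A X Y f K k" "is_kernel A X Y' f' K k" "W \<in> Obj A" "h \<in> Hom A W X"
  shows "f \<cdot> h = zero_mor A W Y \<longleftrightarrow> f' \<cdot> h = zero_mor A W Y'"
  using kernel_annihilates_iff[OF assms(1,3,4)] kernel_annihilates_iff[OF assms(2,3,4)] by simp

lemma kernel_of_cokernel_unique:
  assumes "is_cokernel A X Y f Q q" "is_cokernel A X Y f Q' q'" "is_kernel A Y Q q E j"
  shows "is_kernel A Y Q' q' E j"
proof (rule kernel_cong[OF assms(3)])
  have ob: "X \<in> Obj A" "Y \<in> Obj A" "f \<in> Hom A X Y" "Q \<in> Obj A" "q \<in> Hom A Y Q"
     "Q' \<in> Obj A" "q' \<in> Hom A Y Q'"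
    and z: "q \<cdot> f = zero_mor A X Q" "q' \<cdot> f = zero_mor A X Q'"
    using assms unfolding is_cokernel_def by blast+
  show "Q' \<in> Obj A" "q' \<in> Hom A Y Q'" by fact+
  obtain u v where u: "u \<in> Hom A Q Q'" "q' = u \<cdot> q" and v: "v \<in> Hom A Q' Q" "q = v \<cdot> q'"
    using cokernel_annihilates_iff[OF assms(1) ob(6,7)] cokernel_annihilates_iff[OF assms(2) ob(4,5)] z
    by metis
  fix W h assume W: "W \<in> Obj A" "h \<in> Hom A W Y"
  show "q \<cdot> h = zero_mor A W Q \<longleftrightarrow> q' \<cdot> h = zero_mor A W Q'"
    using comp_assoc[OF W(1) ob(2,4,6) W(2) ob(5) u(1)] comp_assoc[OF W(1) ob(2,6,4) W(2) ob(7) v(1)]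
      comp_zero[OF W(1) ob(4,6) u(1)] comp_zero[OF W(1) ob(6,4) v(1)] u(2) v(2) by metis
qed

text \<open>\<open>exact_at\<close> provides the kernel property for some image \<open>E'\<close>.
  Both \<open>E\<close> and \<open>E'\<close> are kernels of the same cokernel \<open>q'\<close>,
  and \<open>g\<close> annihilates the same maps as \<open>q'\<close> because they share the kernel
  \<open>E'\<close>; hence \<open>E\<close> is a kernel of \<open>g\<close> as well.\<close>

lemma exact_at_image_is_kernel:
  assumes "exact_at A X f Y g Z" "is_image A X Y f E j"
  shows "is_kernel A Y Z g E j"
proof -
  obtain E' j' Q' q' where 1: "is_cokernel A X Y f Q' q'" "is_kernel A Y Q' q' E' j'" "is_kernel A Y Z g E' j'"
    using assms(1) unfolding exact_at_def is_image_def by blast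
  obtain Q q where 2: "is_cokernel A X Y f Q q" "is_kernel A Y Q q E j"
    using assms(2) unfolding is_image_def by blast
  have "is_kernel A Y Q' q' E j" using kernel_of_cokernel_unique[OF 2(1) 1(1) 2(2)] .
  then show ?thesis
    by (rule kernel_cong)
      (use 1 kernels_annihilate_same[OF 1(2,3)] in \<open>auto simp: is_kernel_def\<close>)
qed

lemma cokernel_of_kernel_unique:
  assumes "is_kernel A X Y f K k" "is_kernel A X Y f K' k'" "is_cokernel A K X k E p"
  shows "is_cokernel A K' X k' E p"
proof (rule cokernel_cong[OF assms(3)])
  have ob: "X \<in> Obj A" "Y \<in> Obj A" "f \<in> Hom A X Y" "K \<in> Obj A" "k \<in> Hom A K X"
     "K' \<in> Obj A" "k' \<in> Hom A K' X"
    and z: "f \<cdot> k = zero_mor A K Y" "f \<cdot> k' = zero_mor A K' Y"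
    using assms unfolding is_kernel_def by blast+
  show "K' \<in> Obj A" "k' \<in> Hom A K' X" by fact+
  obtain u v where u: "u \<in> Hom A K' K" "k' = k \<cdot> u" and v: "v \<in> Hom A K K'" "k = k' \<cdot> v"
    using kernel_annihilates_iff[OF assms(1) ob(6,7)] kernel_annihilates_iff[OF assms(2) ob(4,5)] z
    by metis
  fix W h assume W: "W \<in> Obj A" "h \<in> Hom A X W"
  show "h \<cdot> k = zero_mor A K W \<longleftrightarrow> h \<cdot> k' = zero_mor A K' W"
    using comp_assoc[OF ob(6,4,1) W(1) u(1) ob(5) W(2)] comp_assoc[OF ob(4,6,1) W(1) v(1) ob(7) W(2)]
      zero_comp[OF ob(6,4) W(1) u(1)] zero_comp[OF ob(4,6) W(1) v(1)] u(2) v(2) by metis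
qed

text \<open>The complement \<open>n\<close> of the idempotent \<open>j \<cdot> s\<close> kills
  \<open>j\<close>, so it factors as \<open>t \<cdot> p\<close>; then
  \<open>p \<cdot> t \<cdot> p = p\<close>, and \<open>p\<close> is epi. The decomposition of the
  identity is kept because it later shows that \<open>j\<close> is the kernel of
  \<open>p\<close>.\<close>

lemma split_mono_cokernel:
  assumes "is_cokernel A X Y j P p" "s \<in> Hom A Y X" "s \<cdot> j = ident A X"
  obtains t where "t \<in> Hom A P Y" "p \<cdot> t = ident A P" "(t \<cdot> p) \<boxplus> (j \<cdot> s) = ident A Y"
proof -
  have ob: "X \<in> Obj A" "Y \<in> Obj A" "P \<in> Obj A" and j: "j \<in> Hom A X Y" and p: "p \<in> Hom A Y P"
    and pj: "p \<cdot> j = zero_mor A X P"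
    using assms(1) unfolding is_cokernel_def by blast+
  note s = assms(2)
  have js: "j \<cdot> s \<in> Hom A Y Y" using comp_hom[OF ob(2,1,2) s j] .
  obtain n where n: "n \<in> Hom A Y Y" "n \<boxplus> (j \<cdot> s) = ident A Y"
    using ex_complement[OF ob(2,2) js ident_hom[OF ob(2)]] .
  have "(n \<cdot> j) \<boxplus> j = j"
    using add_comp[OF ob(1,2,2) n(1) js j] n(2) comp_assoc[OF ob(1,2,1,2) j s j] assms(3)
      comp_ident[OF ob(1,2) j] ident_comp[OF ob(1,2) j] by simp
  then have "n \<cdot> j = zero_mor A X Y"
    by (rule add_eq_right_imp_zero[OF ob(1,2) comp_hom[OF ob(1,2,2) j n(1)] j])
  then obtain t where t: "t \<in> Hom A P Y" "n = t \<cdot> p"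
    using cokernel_annihilates_iff[OF assms(1) ob(2) n(1)] by blast
  have "(p \<cdot> n) \<boxplus> (p \<cdot> (j \<cdot> s)) = p"
    using comp_add[OF ob(2,2,3) n(1) js p] n(2) comp_ident[OF ob(2,3) p] by simp
  moreover have "p \<cdot> (j \<cdot> s) = zero_mor A Y P"
    using comp_assoc[OF ob(2,1,2,3) s j p] pj zero_comp[OF ob(2,1,3) s] by simp
  ultimately have "(p \<cdot> t) \<cdot> p = p"
    using add_zero[OF ob(2,3) comp_hom[OF ob(2,2,3) n(1) p]] t(2) comp_assoc[OF ob(2,3,2,3) p t(1) p]
    by simp
  then have "p \<cdot> t = ident A P"
    using cokernel_imp_epi[OF assms(1)] ident_comp[OF ob(2,3) p] comp_hom[OF ob(3,2,3) t(1) p]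
      ident_hom[OF ob(3)] ob unfolding is_epi_def by metis
  then show thesis using that t n by simp
qed

text \<open>Dual argument: the complement of \<open>t \<cdot> p\<close> is killed by
  \<open>p\<close>, so it factors as \<open>j \<cdot> s\<close>, and \<open>j\<close> is cancelled
  as a monomorphism.\<close>

lemma split_epi_kernel:
  assumes "is_kernel A Y P p X j" "t \<in> Hom A P Y" "p \<cdot> t = ident A P"
  obtains s where "s \<in> Hom A Y X" "s \<cdot> j = ident A X"
proof -
  have ob: "X \<in> Obj A" "Y \<in> Obj A" "P \<in> Obj A" and j: "j \<in> Hom A X Y" and p: "p \<in> Hom A Y P"
    and pj: "p \<cdot> j = zero_mor A X P"
    using assms(1) unfolding is_kernel_def by blast+
  note t = assms(2)
  have tp: "t \<cdot> p \<in> Hom A Y Y" using comp_hom[OF ob(2,3,2) p t] .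
  obtain n where n: "n \<in> Hom A Y Y" "n \<boxplus> (t \<cdot> p) = ident A Y"
    using ex_complement[OF ob(2,2) tp ident_hom[OF ob(2)]] .
  have "(p \<cdot> n) \<boxplus> p = p"
    using comp_add[OF ob(2,2,3) n(1) tp p] n(2) comp_assoc[OF ob(2,3,2,3) p t p] assms(3)
      comp_ident[OF ob(2,3) p] ident_comp[OF ob(2,3) p] by simp
  then have "p \<cdot> n = zero_mor A Y P"
    by (rule add_eq_right_imp_zero[OF ob(2,3) comp_hom[OF ob(2,2,3) n(1) p] p])
  then obtain s where s: "s \<in> Hom A Y X" "n = j \<cdot> s"
    using kernel_annihilates_iff[OF assms(1) ob(2) n(1)] by blast
  have "(n \<cdot> j) \<boxplus> ((t \<cdot> p) \<cdot> j) = j"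
    using add_comp[OF ob(1,2,2) n(1) tp j] n(2) ident_comp[OF ob(1,2) j] by simp
  moreover have "(t \<cdot> p) \<cdot> j = zero_mor A X Y"
    using comp_assoc[OF ob(1,2,3,2) j p t] pj comp_zero[OF ob(1,3,2) t] by simp
  ultimately have "j \<cdot> (s \<cdot> j) = j \<cdot> ident A X"
    using add_zero[OF ob(1,2) comp_hom[OF ob(1,2,2) j n(1)]] s(2) comp_assoc[OF ob(1,2,1,2) j s(1) j]
      comp_ident[OF ob(1,2) j] by simp
  then have "s \<cdot> j = ident A X"
    using kernel_imp_mono[OF assms(1)] comp_hom[OF ob(1,2,1) j s(1)] ident_hom[OF ob(1)] ob
    unfolding is_mono_def by metis
  then show thesis using that s by blast
qed

end

section \<open>Relative injective resolutions\<close>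

lemma (in comm_group) subgroup_comm_group:
  assumes "subgroup H G"
  shows "comm_group (G\<lparr>carrier := H\<rparr>)"
proof -
  interpret H: group "G\<lparr>carrier := H\<rparr>" using subgroup_imp_group[OF assms] .
  show ?thesis
    by (rule H.group_comm_groupI) (use subgroup.subset[OF assms] m_comm in auto)
qed

context category
begin

lemma is_monoD:
  "\<lbrakk>is_mono A X Y f; W \<in> Obj A; g \<in> Hom A W X; h \<in> Hom A W X; f \<cdot> g = f \<cdot> h\<rbrakk> \<Longrightarrow> g = h"
  unfolding is_mono_def by blast

lemma rel_injectiveI:
  assumes "Q \<in> Obj A"
    and "\<And>X Y j f. \<lbrakk>X \<in> Obj A; Y \<in> Obj A; j \<in> Hom A X Y; I X Y j; f \<in> Hom A X Q\<rbrakk>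
      \<Longrightarrow> \<exists>g\<in>Hom A Y Q. g \<cdot> j = f"
  shows "rel_injective A I Q"
proof -
  have "(\<lambda>g. g \<cdot> j) ` Hom A Y Q = Hom A X Q"
    if j: "X \<in> Obj A" "Y \<in> Obj A" "j \<in> Hom A X Y" "I X Y j" for X Y j
    using comp_hom[OF j(1,2) assms(1) j(3)] assms(2)[OF j] by blast
  then show ?thesis using assms(1) unfolding rel_injective_def by blast
qed

lemma rel_injectiveD:
  assumes "rel_injective A I Q" "X \<in> Obj A" "Y \<in> Obj A" "j \<in> Hom A X Y" "I X Y j" "f \<in> Hom A X Q"
  obtains g where "g \<in> Hom A Y Q" "g \<cdot> j = f"
proof -
  have "f \<in> (\<lambda>g. g \<cdot> j) ` Hom A Y Q" using assms unfolding rel_injective_def by blast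
  then show thesis using that by blast
qed

lemma rel_injective_retract:
  assumes Q: "rel_injective A I Q" and N: "N \<in> Obj A"
    and i: "i \<in> Hom A N Q" and r: "r \<in> Hom A Q N" and ri: "r \<cdot> i = ident A N"
  shows "rel_injective A I N"
proof (rule rel_injectiveI[OF N])
  fix X Y j f assume *: "X \<in> Obj A" "Y \<in> Obj A" "j \<in> Hom A X Y" "I X Y j" "f \<in> Hom A X N"
  have Qo: "Q \<in> Obj A" using Q unfolding rel_injective_def by blast
  obtain g where g: "g \<in> Hom A Y Q" "g \<cdot> j = i \<cdot> f"
    using rel_injectiveD[OF Q *(1-4) comp_hom[OF *(1) N Qo *(5) i]] .
  have "(r \<cdot> g) \<cdot> j = f"
    using comp_assoc[OF *(1,2) Qo N *(3) g(1) r] comp_assoc[OF *(1) N Qo N *(5) i r] g(2) ri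
      ident_comp[OF *(1) N *(5)] by simp
  then show "\<exists>g\<in>Hom A Y N. g \<cdot> j = f" using comp_hom[OF *(2) Qo N g(1) r] by blast
qed

end

section \<open>Cohomology of relative injective resolutions\<close>

context preadditive_category
begin

lemma kernel_mono_comp_iff:
  assumes "is_mono A Y Z j" "X \<in> Obj A" "p \<in> Hom A X Y"
  shows "is_kernel A X Z (j \<cdot> p) K k \<longleftrightarrow> is_kernel A X Y p K k"
proof -
  have ob: "Y \<in> Obj A" "Z \<in> Obj A" "j \<in> Hom A Y Z"
    and mono: "\<And>W g h. \<lbrakk>W \<in> Obj A; g \<in> Hom A W Y; h \<in> Hom A W Y; j \<cdot> g = j \<cdot> h\<rbrakk> \<Longrightarrow> g = h"
    using assms(1) unfolding is_mono_def by blast+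
  have *: "(j \<cdot> p) \<cdot> h = zero_mor A W Z \<longleftrightarrow> p \<cdot> h = zero_mor A W Y"
    if W: "W \<in> Obj A" "h \<in> Hom A W X" for W h
    using comp_assoc[OF W(1) assms(2) ob(1,2) W(2) assms(3) ob(3)] comp_zero[OF W(1) ob]
      mono[OF W(1) comp_hom[OF W(1) assms(2) ob(1) W(2) assms(3)] zero_hom[OF W(1) ob(1)]] by metis
  show ?thesis
    using kernel_cong[of X Z "j \<cdot> p" K k Y p] kernel_cong[of X Y p K k Z "j \<cdot> p"] * ob assms(3)
      comp_hom[OF assms(2) ob(1,2) assms(3) ob(3)] by blast
qed

lemma cokernel_comp_epi:
  assumes "is_epi A X Y p" "is_cokernel A Y Z j Q q"
  shows "is_cokernel A X Z (j \<cdot> p) Q q"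
proof -
  have ob: "X \<in> Obj A" "Y \<in> Obj A" "p \<in> Hom A X Y" "Z \<in> Obj A" "j \<in> Hom A Y Z"
    and epi: "\<And>W g h. \<lbrakk>W \<in> Obj A; g \<in> Hom A Y W; h \<in> Hom A Y W; g \<cdot> p = h \<cdot> p\<rbrakk> \<Longrightarrow> g = h"
    using assms unfolding is_epi_def is_cokernel_def by blast+
  have *: "h \<cdot> j = zero_mor A Y W \<longleftrightarrow> h \<cdot> (j \<cdot> p) = zero_mor A X W"
    if W: "W \<in> Obj A" "h \<in> Hom A Z W" for W h
    using comp_assoc[OF ob(1,2,4) W(1) ob(3,5) W(2)] zero_comp[OF ob(1,2) W(1) ob(3)]
      epi[OF W(1) comp_hom[OF ob(2,4) W(1) ob(5) W(2)] zero_hom[OF ob(2) W(1)]] by metis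
  show ?thesis
    using cokernel_cong[OF assms(2) ob(1) comp_hom[OF ob(1,2,4,3,5)] *] .
qed

text \<open>A factor group is trivial iff every cocycle has the coset of the coboundaries as its
  own, that is, lies in it. The degree is \<open>Suc n\<close> because in degree 0 the coboundaries
  are set to zero instead of being the image of a differential.\<close>

lemma trivial_cohomology_iff:
  assumes X: "X \<in> Obj A" and Q: "\<And>n. Q n \<in> Obj A" and d: "\<And>n. d n \<in> Hom A (Q n) (Q (Suc n))"
    and dd: "d (Suc n) \<cdot> d n = zero_mor A (Q n) (Q (Suc (Suc n)))"
  shows "trivial_group (hom_cohomology A X Q d (Suc n)) \<longleftrightarrow>
    (\<forall>f\<in>Hom A X (Q (Suc n)). d (Suc n) \<cdot> f = zero_mor A X (Q (Suc (Suc n))) \<longrightarrow>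
      (\<exists>g\<in>Hom A X (Q n). f = d n \<cdot> g))"
proof -
  let ?G = "\<lambda>n. hom_group A X (Q n)"
  let ?Z = "hom_cocycles A X Q d (Suc n)" and ?B = "hom_coboundaries A X Q d (Suc n)"
  have cg: "comm_group (?G m)" for m using hom_comm_group[OF X Q] .
  have gh: "group_hom (?G m) (?G (Suc m)) (\<lambda>f. d m \<cdot> f)" for m
    unfolding group_hom_def group_hom_axioms_def hom_def
    using cg comm_group.axioms(2) comp_hom[OF X Q Q _ d] comp_add[OF X Q Q _ _ d] by auto
  have Z: "subgroup ?Z (?G (Suc n))"
    using group_hom.subgroup_kernel[OF gh] unfolding hom_cocycles_def by simp
  have B: "subgroup ?B (?G (Suc n))"
    using group_hom.img_is_subgroup[OF gh, of n] by simp
  have BZ: "?B \<subseteq> ?Z"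
  proof
    fix b assume "b \<in> ?B"
    then obtain g where g: "g \<in> Hom A X (Q n)" "b = d n \<cdot> g" by auto
    then have "d (Suc n) \<cdot> b = zero_mor A X (Q (Suc (Suc n)))"
      using comp_assoc[OF X Q Q Q g(1) d d] dd zero_comp[OF X Q Q g(1)] by simp
    then show "b \<in> ?Z"
      using g comp_hom[OF X Q Q g(1) d] by (simp add: hom_cocycles_def kernel_def)
  qed
  let ?K = "(?G (Suc n))\<lparr>carrier := ?Z\<rparr>"
  have Kg: "comm_group ?K" using comm_group.subgroup_comm_group[OF cg Z] .
  have BK: "subgroup ?B ?K"
    using group.subgroup_incl[OF comm_group.axioms(2)[OF cg] B Z BZ] .
  interpret K: comm_group ?K by fact
  interpret N: normal ?B ?K using K.subgroup_imp_normal[OF BK] .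
  have "trivial_group (?K Mod ?B) \<longleftrightarrow> rcosets\<^bsub>?K\<^esub> ?B = {?B}"
    unfolding trivial_group_def using N.factorgroup_is_group by (simp add: FactGroup_def)
  also have "\<dots> \<longleftrightarrow> ?Z \<subseteq> ?B"
  proof
    assume "rcosets\<^bsub>?K\<^esub> ?B = {?B}"
    then have "?B #>\<^bsub>?K\<^esub> z = ?B" if "z \<in> ?Z" for z
      using that K.rcosetsI[OF N.subset, of z] by simp
    then show "?Z \<subseteq> ?B"
      using K.rcos_self[OF _ BK] by fastforce
  next
    assume "?Z \<subseteq> ?B"
    then have eq: "?Z = ?B" using BZ by blast
    have "?B #>\<^bsub>?K\<^esub> z = ?B" if "z \<in> ?Z" for z
      using that eq K.coset_join2[OF _ BK, of z] by simp
    moreover have "\<exists>z. z \<in> ?Z" using subgroup.one_closed[OF Z] by blast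
    ultimately show "rcosets\<^bsub>?K\<^esub> ?B = {?B}" unfolding RCOSETS_def by auto
  qed
  also have "\<dots> \<longleftrightarrow> (\<forall>f\<in>Hom A X (Q (Suc n)). d (Suc n) \<cdot> f = zero_mor A X (Q (Suc (Suc n))) \<longrightarrow>
      (\<exists>g\<in>Hom A X (Q n). f = d n \<cdot> g))"
    by (auto simp: hom_cocycles_def kernel_def image_def subset_iff)
  finally show ?thesis unfolding hom_cohomology_def .
qed

text \<open>\<open>f \<cdot> k\<close> is zero, so \<open>k\<close> is zero and the identity of
  \<open>X\<close> factors through its cokernel \<open>p\<close>. This is needed because the
  canonical factorization of the augmentation passes through an object that is only isomorphic to
  \<open>N\<close>.\<close>

lemma coimage_of_mono_iso:
  assumes m: "is_mono A X Y f" and c: "is_coimage A X Y f E p"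
  obtains v where "E \<in> Obj A" "p \<in> Hom A X E" "v \<in> Hom A E X" "v \<cdot> p = ident A X" "p \<cdot> v = ident A E"
proof -
  obtain K k where K: "is_kernel A X Y f K k" "is_cokernel A K X k E p"
    using c unfolding is_coimage_def by blast
  have ob: "X \<in> Obj A" "Y \<in> Obj A" "f \<in> Hom A X Y" "K \<in> Obj A" "k \<in> Hom A K X"
    "E \<in> Obj A" "p \<in> Hom A X E" and fk: "f \<cdot> k = zero_mor A K Y"
    using K unfolding is_kernel_def is_cokernel_def by blast+
  have "k = zero_mor A K X"
    using m fk comp_zero[OF ob(4,1,2,3)] zero_hom[OF ob(4,1)] ob unfolding is_mono_def by metis
  then have "ident A X \<cdot> k = zero_mor A K X"
    using ident_comp[OF ob(4,1,5)] by simp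
  then obtain v where v: "v \<in> Hom A E X" "ident A X = v \<cdot> p"
    using cokernel_annihilates_iff[OF K(2) ob(1) ident_hom[OF ob(1)]] by blast
  have "(p \<cdot> v) \<cdot> p = ident A E \<cdot> p"
    using comp_assoc[OF ob(1,6,1,6,7) v(1) ob(7)] v(2)[symmetric] comp_ident[OF ob(1,6,7)]
      ident_comp[OF ob(1,6,7)] by simp
  then have "p \<cdot> v = ident A E"
    using cokernel_imp_epi[OF K(2)] comp_hom[OF ob(6,1,6) v(1) ob(7)] ident_hom[OF ob(6)] ob(6)
    unfolding is_epi_def by blast
  then show thesis using that ob v by simp
qed

text \<open>By exactness the kernel of \<open>d n\<close> is the image of the preceding map, and the
  cokernel of that kernel is the coimage of \<open>d n\<close>; the comparison lemmas let the
  factorizations coming from admissibility serve in both places. \<open>u\<close> and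
  \<open>v\<close> identify \<open>N\<close> with \<open>E 0\<close>, the object through which
  \<open>\<eta>\<close> factors.\<close>

lemma resolution_short_exact:
  assumes "rel_injective_resolution A I N Q d \<eta>"
  obtains E j p u v where
    "\<And>n. is_kernel A (Q n) (Q (Suc n)) (d n) (E n) (j n)"
    "\<And>n. I (E n) (Q n) (j n)"
    "\<And>n. is_cokernel A (E n) (Q n) (j n) (E (Suc n)) (p n)"
    "\<And>n. d n = j (Suc n) \<cdot> p n"
    "u \<in> Hom A N (E 0)" "v \<in> Hom A (E 0) N" "v \<cdot> u = ident A N" "u \<cdot> v = ident A (E 0)"
proof -
  have mono: "is_mono A N (Q 0) \<eta>"
    and ex0: "exact_at A N \<eta> (Q 0) (d 0) (Q (Suc 0))"
    and ex: "\<And>n. exact_at A (Q n) (d n) (Q (Suc n)) (d (Suc n)) (Q (Suc (Suc n)))"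
    and ad0: "admissible A I N (Q 0) \<eta>"
    and ad: "\<And>n. admissible A I (Q n) (Q (Suc n)) (d n)"
    using assms unfolding rel_injective_resolution_def by simp_all
  obtain E0 j0 u where 0: "canonical_factorization A N (Q 0) \<eta> E0 j0 u" "I E0 (Q 0) j0"
    using ad0 unfolding admissible_def by blast
  obtain v where uv: "u \<in> Hom A N E0" "v \<in> Hom A E0 N" "v \<cdot> u = ident A N" "u \<cdot> v = ident A E0"
    using coimage_of_mono_iso[OF mono] 0(1) unfolding canonical_factorization_def by metis
  have "\<exists>E j p. canonical_factorization A (Q n) (Q (Suc n)) (d n) E j p \<and> I E (Q (Suc n)) j" for n
    using ad[of n] unfolding admissible_def .
  then obtain E1 j1 p where
    1: "\<And>n. canonical_factorization A (Q n) (Q (Suc n)) (d n) (E1 n) (j1 n) (p n)"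
       "\<And>n. I (E1 n) (Q (Suc n)) (j1 n)" by metis
  \<comment> \<open>Index shift: the image \<open>E1 n\<close> of \<open>d n\<close> lives in
    \<open>Q (Suc n)\<close>, so it becomes \<open>E (Suc n)\<close>; slot 0 holds the image of the
    augmentation.\<close>
  define E where "E = case_nat E0 E1"
  define j where "j = case_nat j0 j1"
  have k: "is_kernel A (Q n) (Q (Suc n)) (d n) (E n) (j n)" for n
  proof (cases n)
    case 0
    then show ?thesis
      using exact_at_image_is_kernel[OF ex0] \<open>canonical_factorization A N (Q 0) \<eta> E0 j0 u\<close>
      unfolding canonical_factorization_def by (auto simp: E_def j_def)
  next
    case (Suc m)
    then show ?thesis
      using exact_at_image_is_kernel[OF ex] 1(1)[of m]
      unfolding canonical_factorization_def by (auto simp: E_def j_def)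
  qed
  have c: "is_cokernel A (E n) (Q n) (j n) (E (Suc n)) (p n)" for n
  proof -
    obtain K k' where "is_kernel A (Q n) (Q (Suc n)) (d n) K k'" "is_cokernel A K (Q n) k' (E1 n) (p n)"
      using 1(1)[of n] unfolding canonical_factorization_def is_coimage_def by blast
    then show ?thesis using cokernel_of_kernel_unique[OF _ k] by (simp add: E_def)
  qed
  have "I (E n) (Q n) (j n)" for n
    using 0(2) 1(2) by (cases n) (simp_all add: E_def j_def)
  moreover have "d n = j (Suc n) \<cdot> p n" for n
    using 1(1)[of n] by (simp add: j_def canonical_factorization_def)
  ultimately show thesis using that[OF k _ c] uv by (simp add: E_def)
qed

lemma resolution_trivial_cohomology_iff:
  assumes "rel_injective_resolution A I N Q d \<eta>" "X \<in> Obj A"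
  shows "trivial_group (hom_cohomology A X Q d (Suc n)) \<longleftrightarrow>
    (\<forall>f\<in>Hom A X (Q (Suc n)). d (Suc n) \<cdot> f = zero_mor A X (Q (Suc (Suc n))) \<longrightarrow>
      (\<exists>g\<in>Hom A X (Q n). f = d n \<cdot> g))"
proof -
  obtain E j p u v where
    k: "\<And>n. is_kernel A (Q n) (Q (Suc n)) (d n) (E n) (j n)" and
    c: "\<And>n. is_cokernel A (E n) (Q n) (j n) (E (Suc n)) (p n)" and
    d: "\<And>n. d n = j (Suc n) \<cdot> p n"
    using resolution_short_exact[OF assms(1)] by metis
  have ob: "\<And>n. Q n \<in> Obj A" "\<And>n. d n \<in> Hom A (Q n) (Q (Suc n))"
    using k unfolding is_kernel_def by blast+
  have "p n \<in> Hom A (Q n) (E (Suc n))" for n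
    using c unfolding is_cokernel_def by blast
  \<comment> \<open>\<open>d n\<close> ends in \<open>j (Suc n)\<close>, the kernel of
    \<open>d (Suc n)\<close>.\<close>
  then have "d (Suc n) \<cdot> d n = zero_mor A (Q n) (Q (Suc (Suc n)))" for n
    using kernel_annihilates_iff[OF k ob, of n] d[of n] by blast
  then show ?thesis by (intro trivial_cohomology_iff assms(2) ob)
qed

lemma rel_injective_if_first_cohomology_trivial:
  assumes res: "rel_injective_resolution A I N Q d \<eta>" and N: "N \<in> Obj A"
    and triv: "\<And>X. X \<in> Obj A \<Longrightarrow> trivial_group (hom_cohomology A X Q d 1)"
  shows "rel_injective A I N"
proof -
  obtain E j p u v where
    k: "\<And>n. is_kernel A (Q n) (Q (Suc n)) (d n) (E n) (j n)" and
    c: "\<And>n. is_cokernel A (E n) (Q n) (j n) (E (Suc n)) (p n)" and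
    d: "\<And>n. d n = j (Suc n) \<cdot> p n" and
    uv: "u \<in> Hom A N (E 0)" "v \<in> Hom A (E 0) N" "v \<cdot> u = ident A N"
    using resolution_short_exact[OF res] by metis
  have Q: "rel_injective A I (Q n)" for n
    using res unfolding rel_injective_resolution_def by blast
  have ob: "\<And>n. Q n \<in> Obj A" "\<And>n. E n \<in> Obj A" "\<And>n. j n \<in> Hom A (E n) (Q n)"
      "\<And>n. p n \<in> Hom A (Q n) (E (Suc n))"
      "\<And>n. d n \<cdot> j n = zero_mor A (E n) (Q (Suc n))"
    using k c unfolding is_kernel_def is_cokernel_def by blast+
  \<comment> \<open>The hypothesis is tested at \<open>X = E 1\<close>; \<open>j 1\<close> is a
    cocycle because it is the kernel of \<open>d 1\<close>.\<close>
  obtain t where t: "t \<in> Hom A (E 1) (Q 0)" "j 1 = d 0 \<cdot> t"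
    using triv[OF ob(2)[of 1]] resolution_trivial_cohomology_iff[OF res ob(2)[of 1], of 0] ob(3,5)[of 1]
    by auto
  \<comment> \<open>Since \<open>d 0 = j 1 \<cdot> p 0\<close>, cancelling the monomorphism
    \<open>j 1\<close> turns the coboundary equation into a section of \<open>p 0\<close>.\<close>
  have "j 1 \<cdot> (p 0 \<cdot> t) = j 1 \<cdot> ident A (E 1)"
    using comp_assoc[OF ob(2,1,2,1) t(1), of "p 0" 1 "j 1" 1] ob(3,4) t(2) d[of 0]
      comp_ident[OF ob(2,1,3)[of 1]] by simp
  then have "p 0 \<cdot> t = ident A (E 1)"
    using is_monoD[OF kernel_imp_mono[OF k] ob(2)] comp_hom[OF ob(2,1,2) t(1), of "p 0" 1] ob(4)[of 0]
      ident_hom[OF ob(2)] by simp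
  moreover have "is_kernel A (Q 0) (E 1) (p 0) (E 0) (j 0)"
    using kernel_mono_comp_iff[OF kernel_imp_mono[OF k] ob(1), of "p 0" 0 1] k[of 0] d[of 0] ob(4)[of 0]
    by simp
  ultimately obtain s where "s \<in> Hom A (Q 0) (E 0)" "s \<cdot> j 0 = ident A (E 0)"
    using split_epi_kernel t(1) by metis
  then have "rel_injective A I (E 0)"
    using rel_injective_retract[OF Q ob(2,3)] by blast
  then show ?thesis using rel_injective_retract N uv by blast
qed

text \<open>When \<open>E n\<close> is relatively injective, its identity extends along
  \<open>j n\<close>; this splits the sequence and makes \<open>E (Suc n)\<close> a retract of
  \<open>Q n\<close>, which is the induction step. A cocycle factors through
  \<open>j (Suc n)\<close> as \<open>w\<close>, and the section of \<open>p n\<close> lifts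
  \<open>w\<close> to \<open>Q n\<close>.\<close>

lemma cohomology_trivial_if_rel_injective:
  assumes res: "rel_injective_resolution A I N Q d \<eta>" and N: "rel_injective A I N"
    and X: "X \<in> Obj A"
  shows "trivial_group (hom_cohomology A X Q d (Suc n))"
proof -
  obtain E j p u v where
    k: "\<And>n. is_kernel A (Q n) (Q (Suc n)) (d n) (E n) (j n)" and
    I: "\<And>n. I (E n) (Q n) (j n)" and
    c: "\<And>n. is_cokernel A (E n) (Q n) (j n) (E (Suc n)) (p n)" and
    d: "\<And>n. d n = j (Suc n) \<cdot> p n" and
    uv: "u \<in> Hom A N (E 0)" "v \<in> Hom A (E 0) N" "u \<cdot> v = ident A (E 0)"
    using resolution_short_exact[OF res] by metis
  have Q: "rel_injective A I (Q n)" for n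
    using res unfolding rel_injective_resolution_def by blast
  have ob: "\<And>n. Q n \<in> Obj A" "\<And>n. E n \<in> Obj A" "\<And>n. j n \<in> Hom A (E n) (Q n)"
      "\<And>n. p n \<in> Hom A (Q n) (E (Suc n))"
    using k c unfolding is_kernel_def is_cokernel_def by blast+
  have sect: "\<exists>t\<in>Hom A (E (Suc n)) (Q n). p n \<cdot> t = ident A (E (Suc n))"
    if inj: "rel_injective A I (E n)" for n
  proof -
    obtain s where "s \<in> Hom A (Q n) (E n)" "s \<cdot> j n = ident A (E n)"
      using rel_injectiveD[OF inj ob(2,1,3) I ident_hom[OF ob(2)]] .
    then show ?thesis using split_mono_cokernel[OF c] by metis
  qed
  have "rel_injective A I (E n)" for n
  proof (induction n)
    case 0
    show ?case using rel_injective_retract[OF N ob(2) uv(2,1,3)] .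
  next
    case (Suc n)
    then obtain t where "t \<in> Hom A (E (Suc n)) (Q n)" "p n \<cdot> t = ident A (E (Suc n))"
      using sect by blast
    then show ?case using rel_injective_retract[OF Q ob(2) _ ob(4)] by blast
  qed
  then obtain t where t: "t \<in> Hom A (E (Suc n)) (Q n)" "p n \<cdot> t = ident A (E (Suc n))"
    using sect by blast
  show ?thesis
    unfolding resolution_trivial_cohomology_iff[OF res X]
  proof (intro ballI impI)
    fix f assume f: "f \<in> Hom A X (Q (Suc n))" "d (Suc n) \<cdot> f = zero_mor A X (Q (Suc (Suc n)))"
    then obtain w where w: "w \<in> Hom A X (E (Suc n))" "f = j (Suc n) \<cdot> w"
      using kernel_annihilates_iff[OF k X] by blast
    have "d n \<cdot> (t \<cdot> w) = j (Suc n) \<cdot> (p n \<cdot> (t \<cdot> w))"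
      using comp_assoc[OF X ob(1,2,1) comp_hom[OF X ob(2,1) w(1) t(1)] ob(4,3)] d by simp
    also have "p n \<cdot> (t \<cdot> w) = w"
      using comp_assoc[OF X ob(2,1,2) w(1) t(1) ob(4)] t(2) ident_comp[OF X ob(2) w(1)] by simp
    finally show "\<exists>g\<in>Hom A X (Q n). f = d n \<cdot> g"
      using w(2) comp_hom[OF X ob(2,1) w(1) t(1)] by metis
  qed
qed

text \<open>Splicing: \<open>E n\<close> is the \<open>n\<close>-th iterated cokernel, and
  \<open>d n\<close> passes from \<open>Q n\<close> to \<open>Q (Suc n)\<close> through
  \<open>E (Suc n)\<close>. Composing with a monomorphism keeps kernels and composing with an
  epimorphism keeps cokernels, which yields exactness and the canonical factorizations
  together.\<close>

lemma ex_rel_injective_resolution: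
  assumes zero: "\<exists>Z. is_zero_object A Z"
    and embed: "\<And>N. N \<in> Obj A \<Longrightarrow>
      \<exists>Q P j p. rel_injective A I Q \<and> I N Q j \<and> is_cokernel A N Q j P p \<and> is_kernel A Q P p N j"
    and N: "N \<in> Obj A"
  shows "\<exists>Q d \<eta>. rel_injective_resolution A I N Q d \<eta>"
proof -
  obtain FQ FP Fj Fp where F: "\<And>N. N \<in> Obj A \<Longrightarrow> rel_injective A I (FQ N) \<and> I N (FQ N) (Fj N) \<and>
      is_cokernel A N (FQ N) (Fj N) (FP N) (Fp N) \<and> is_kernel A (FQ N) (FP N) (Fp N) N (Fj N)"
    using embed by metis
  define E where "E n = (FP ^^ n) N" for n
  have E0 [simp]: "E 0 = N" and ES: "FP (E n) = E (Suc n)" for n by (simp_all add: E_def)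
  have Eo: "E n \<in> Obj A" for n
  proof (induction n)
    case (Suc n)
    then show ?case using F[of "E n"] unfolding ES[symmetric] is_cokernel_def by blast
  qed (simp add: N)
  define Q where "Q n = FQ (E n)" for n
  define j where "j n = Fj (E n)" for n
  define p where "p n = Fp (E n)" for n
  define d where "d n = j (Suc n) \<cdot> p n" for n
  have inj: "rel_injective A I (Q n)" and I: "I (E n) (Q n) (j n)"
    and c: "is_cokernel A (E n) (Q n) (j n) (E (Suc n)) (p n)"
    and k: "is_kernel A (Q n) (E (Suc n)) (p n) (E n) (j n)" for n
    using F[OF Eo[of n]] by (simp_all add: Q_def j_def p_def ES)
  have ob: "\<And>n. Q n \<in> Obj A" "\<And>n. j n \<in> Hom A (E n) (Q n)" "\<And>n. p n \<in> Hom A (Q n) (E (Suc n))"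
    using k c unfolding is_kernel_def is_cokernel_def by blast+
  have mono: "is_mono A (E n) (Q n) (j n)" for n using kernel_imp_mono[OF k] .
  have kd: "is_kernel A (Q n) (Q (Suc n)) (d n) (E n) (j n)" for n
    using kernel_mono_comp_iff[OF mono ob(1,3)] k unfolding d_def by blast
  have cd: "is_cokernel A (Q n) (Q (Suc n)) (d n) (E (Suc (Suc n))) (p (Suc n))" for n
    using cokernel_comp_epi[OF cokernel_imp_epi[OF c] c] unfolding d_def .
  have im: "is_image A (Q n) (Q (Suc n)) (d n) (E (Suc n)) (j (Suc n))" for n
    using cd k unfolding is_image_def by blast
  have im0: "is_image A N (Q 0) (j 0) N (j 0)"
    using c[of 0] k[of 0] unfolding is_image_def by auto
  have co: "is_coimage A (Q n) (Q (Suc n)) (d n) (E (Suc n)) (p n)" for n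
    using kd c unfolding is_coimage_def by blast
  \<comment> \<open>The augmentation is mono, so its kernel is the zero object and its coimage is
    the identity of \<open>N\<close>.\<close>
  have co0: "is_coimage A N (Q 0) (j 0) N (ident A N)"
  proof -
    obtain Z where Z: "Z \<in> Obj A" "\<And>X f g. \<lbrakk>X \<in> Obj A; f \<in> Hom A X Z; g \<in> Hom A X Z\<rbrakk> \<Longrightarrow> f = g"
      using zero unfolding is_zero_object_def by metis
    note z = zero_hom[OF Z(1) N]
    have "is_kernel A N (Q 0) (j 0) Z (zero_mor A Z N)"
      unfolding is_kernel_def
    proof (intro conjI ballI impI)
      fix W h assume W: "W \<in> Obj A" "h \<in> Hom A W N" "j 0 \<cdot> h = zero_mor A W (Q 0)"
      then have "h = zero_mor A W N"
        using mono[of 0] comp_zero[OF W(1) N ob(1), of "j 0" 0] ob(2)[of 0] zero_hom[OF W(1) N] W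
        unfolding is_mono_def by simp
      then show "\<exists>!u. u \<in> Hom A W Z \<and> zero_mor A Z N \<cdot> u = h"
        using zero_hom[OF W(1) Z(1)] Z(2)[OF W(1)] comp_zero[OF W(1) Z(1) N z] by blast
    qed (use N Z ob(1) ob(2)[of 0] z comp_zero[OF Z(1) N ob(1)] in auto)
    moreover have "is_cokernel A Z N (zero_mor A Z N) N (ident A N)"
      unfolding is_cokernel_def
    proof (intro conjI ballI impI)
      fix W h assume W: "W \<in> Obj A" "h \<in> Hom A N W"
      then show "\<exists>!u. u \<in> Hom A N W \<and> u \<cdot> ident A N = h"
        using comp_ident[OF N W(1)] by auto
    qed (use N Z z ident_hom[OF N] ident_comp[OF Z(1) N z] in auto)
    ultimately show ?thesis unfolding is_coimage_def by blast
  qed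
  have "admissible A I (Q n) (Q (Suc n)) (d n)" for n
    unfolding admissible_def canonical_factorization_def using co im I d_def by blast
  moreover have "admissible A I N (Q 0) (j 0)"
    unfolding admissible_def canonical_factorization_def
    using co0 im0 I[of 0] comp_ident[OF N ob(1), of "j 0" 0] ob(2)[of 0] by (metis E0)
  moreover have "exact_at A N (j 0) (Q 0) (d 0) (Q 1)"
    unfolding exact_at_def using im0 kd[of 0] by auto
  moreover have "exact_at A (Q n) (d n) (Q (Suc n)) (d (Suc n)) (Q (Suc (Suc n)))" for n
    unfolding exact_at_def using im kd by blast
  ultimately show ?thesis
    unfolding rel_injective_resolution_def using inj mono[of 0] by auto
qed

theorem rel_injective_iff_rel_Ext_trivial:
  assumes "\<exists>Z. is_zero_object A Z"
    and "\<And>N. N \<in> Obj A \<Longrightarrow>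
      \<exists>Q P j p. rel_injective A I Q \<and> I N Q j \<and> is_cokernel A N Q j P p \<and> is_kernel A Q P p N j"
    and N: "N \<in> Obj A"
  shows "rel_injective A I N \<longleftrightarrow> (\<forall>X\<in>Obj A. trivial_group (rel_Ext A I 1 X N))"
    and "rel_injective A I N \<longleftrightarrow> (\<forall>X\<in>Obj A. \<forall>n>0. trivial_group (rel_Ext A I n X N))"
proof -
  \<comment> \<open>\<open>rel_Ext\<close> computes with the resolution picked by
    \<open>SOME\<close>. Existence makes the pick a genuine resolution, and both implications hold
    for every resolution, hence for this one.\<close>
  obtain Q d \<eta> where eq: "(SOME (Q, d, \<eta>). rel_injective_resolution A I N Q d \<eta>) = (Q, d, \<eta>)"
    by (metis prod_cases3)
  have "\<exists>t. case t of (Q, d, \<eta>) \<Rightarrow> rel_injective_resolution A I N Q d \<eta>"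
    using ex_rel_injective_resolution[OF assms] by auto
  from someI_ex[OF this] have res: "rel_injective_resolution A I N Q d \<eta>"
    unfolding eq by simp
  have ext: "rel_Ext A I n X N = hom_cohomology A X Q d n" for n X
    unfolding rel_Ext_def eq by simp
  have 1: "rel_injective A I N" if "\<forall>X\<in>Obj A. trivial_group (rel_Ext A I 1 X N)"
    using rel_injective_if_first_cohomology_trivial[OF res N] that unfolding ext by blast
  have 2: "\<forall>X\<in>Obj A. \<forall>n>0. trivial_group (rel_Ext A I n X N)" if "rel_injective A I N"
    using cohomology_trivial_if_rel_injective[OF res that] unfolding ext by (metis gr0_conv_Suc)
  show "rel_injective A I N \<longleftrightarrow> (\<forall>X\<in>Obj A. trivial_group (rel_Ext A I 1 X N))"
    and "rel_injective A I N \<longleftrightarrow> (\<forall>X\<in>Obj A. \<forall>n>0. trivial_group (rel_Ext A I n X N))"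
    using 1 2 by (meson zero_less_one)+
qed

end

section \<open>Arrows with source and target\<close>

text \<open>An arrow bundled with its source and target, so that the side conditions of the category
  axioms become equations between objects that rewriting can discharge.\<close>

datatype ('o, 'm) arrow = Arrow (src: 'o) (mor: 'm) (tgt: 'o)

context category
begin

definition arr :: "('o, 'm) arrow \<Rightarrow> bool" where
  "arr f \<longleftrightarrow> src f \<in> Obj A \<and> tgt f \<in> Obj A \<and> mor f \<in> Hom A (src f) (tgt f)"

definition cmp :: "('o, 'm) arrow \<Rightarrow> ('o, 'm) arrow \<Rightarrow> ('o, 'm) arrow"  (infixr \<open>\<bullet>\<close> 70) where
  "g \<bullet> f = Arrow (src f) (mor g \<cdot> mor f) (tgt g)"

definition idn :: "'o \<Rightarrow> ('o, 'm) arrow" where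
  "idn X = Arrow X (ident A X) X"

lemma arr_obj [simp]: "arr f \<Longrightarrow> src f \<in> Obj A" "arr f \<Longrightarrow> tgt f \<in> Obj A"
  by (simp_all add: arr_def)

lemma cmp_simps [simp]:
  "src (g \<bullet> f) = src f" "tgt (g \<bullet> f) = tgt g" "mor (g \<bullet> f) = mor g \<cdot> mor f"
  by (simp_all add: cmp_def)

lemma arr_cmp [simp]: "\<lbrakk>arr f; arr g; tgt f = src g\<rbrakk> \<Longrightarrow> arr (g \<bullet> f)"
  unfolding arr_def by (auto intro: comp_hom)

lemma idn_simps [simp]: "src (idn X) = X" "tgt (idn X) = X" "mor (idn X) = ident A X"
  by (simp_all add: idn_def)

lemma arr_idn [simp]: "X \<in> Obj A \<Longrightarrow> arr (idn X)"
  unfolding arr_def by (simp add: ident_hom)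

lemma idn_cmp [simp]: "\<lbrakk>arr f; tgt f = X\<rbrakk> \<Longrightarrow> idn X \<bullet> f = f"
  unfolding arr_def by (auto simp: ident_comp intro!: arrow.expand)

lemma cmp_idn [simp]: "\<lbrakk>arr f; src f = X\<rbrakk> \<Longrightarrow> f \<bullet> idn X = f"
  unfolding arr_def by (auto simp: comp_ident intro!: arrow.expand)

lemma cmp_assoc [simp]:
  "\<lbrakk>arr f; arr g; arr h; tgt f = src g; tgt g = src h\<rbrakk> \<Longrightarrow> (h \<bullet> g) \<bullet> f = h \<bullet> (g \<bullet> f)"
  unfolding arr_def by (auto intro!: arrow.expand comp_assoc)

text \<open>Simplification nests composites to the right, so an equation for
  \<open>g \<bullet> f\<close> does not match inside a longer composite; this form rewrites
  \<open>g \<bullet> f\<close> when a further arrow \<open>k\<close> stands to its right.\<close>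

lemma cmp_extend:
  assumes "g \<bullet> f = h" "arr f" "arr g" "tgt f = src g" "arr k" "tgt k = src f"
  shows "g \<bullet> (f \<bullet> k) = h \<bullet> k"
  using cmp_assoc[of k f g] assms by simp

lemma inverse_unique:
  assumes "X \<in> Obj A" "Y \<in> Obj A" "is_inverse A X Y f g" "is_inverse A X Y f h"
  shows "g = h"
  using assms comp_assoc[of Y X Y X h f g] comp_ident[of Y X g] ident_comp[of Y X h]
  unfolding is_inverse_def by metis

lemma inverse_mor_inverse:
  assumes "X \<in> Obj A" "Y \<in> Obj A" "is_iso A X Y f"
  shows "is_inverse A X Y f (inverse_mor A X Y f)"
  using assms inverse_unique unfolding is_iso_def inverse_mor_def by (metis (mono_tags, lifting) theI)

end

section \<open>Monoidal coherence for bundled arrows\<close>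

context monoidal_category
begin

notation cmp  (infixr \<open>\<bullet>\<close> 70)

abbreviation II :: 'o where "II \<equiv> unit_obj M"

definition tns :: "('o, 'm) arrow \<Rightarrow> ('o, 'm) arrow \<Rightarrow> ('o, 'm) arrow"  (infixr \<open>\<odot>\<close> 75) where
  "f \<odot> g = Arrow (src f \<boxtimes> src g) (mor f \<star> mor g) (tgt f \<boxtimes> tgt g)"

definition asc :: "'o \<Rightarrow> 'o \<Rightarrow> 'o \<Rightarrow> ('o, 'm) arrow" where
  "asc X Y Z = Arrow ((X \<boxtimes> Y) \<boxtimes> Z) (associator M X Y Z) (X \<boxtimes> (Y \<boxtimes> Z))"

definition asc' :: "'o \<Rightarrow> 'o \<Rightarrow> 'o \<Rightarrow> ('o, 'm) arrow" where
  "asc' X Y Z = Arrow (X \<boxtimes> (Y \<boxtimes> Z))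
    (inverse_mor M ((X \<boxtimes> Y) \<boxtimes> Z) (X \<boxtimes> (Y \<boxtimes> Z)) (associator M X Y Z)) ((X \<boxtimes> Y) \<boxtimes> Z)"

definition lun :: "'o \<Rightarrow> ('o, 'm) arrow" where
  "lun X = Arrow (II \<boxtimes> X) (lunitor M X) X"

definition run :: "'o \<Rightarrow> ('o, 'm) arrow" where
  "run X = Arrow (X \<boxtimes> II) (runitor M X) X"

lemmas [simp] = unit_obj tensor_obj

lemma tns_simps [simp]:
  "src (f \<odot> g) = src f \<boxtimes> src g" "tgt (f \<odot> g) = tgt f \<boxtimes> tgt g" "mor (f \<odot> g) = mor f \<star> mor g"
  by (simp_all add: tns_def)

lemma arr_tns [simp]: "\<lbrakk>arr f; arr g\<rbrakk> \<Longrightarrow> arr (f \<odot> g)"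
  unfolding arr_def by (auto intro: tensor_hom)

lemma tns_idn [simp]: "\<lbrakk>X \<in> Obj M; Y \<in> Obj M\<rbrakk> \<Longrightarrow> idn X \<odot> idn Y = idn (X \<boxtimes> Y)"
  by (auto intro!: arrow.expand simp: tensor_ident)

lemma tns_cmp:
  "\<lbrakk>arr f; arr f'; arr g; arr g'; tgt f = src f'; tgt g = src g'\<rbrakk>
    \<Longrightarrow> (f' \<bullet> f) \<odot> (g' \<bullet> g) = (f' \<odot> g') \<bullet> (f \<odot> g)"
  using tensor_comp[of "src f" "src f'" "tgt f'" "src g" "src g'" "tgt g'" "mor f" "mor f'" "mor g" "mor g'"]
  unfolding arr_def by (simp add: arrow.expand)

lemma asc_simps [simp]:
  "src (asc X Y Z) = (X \<boxtimes> Y) \<boxtimes> Z" "tgt (asc X Y Z) = X \<boxtimes> (Y \<boxtimes> Z)" "mor (asc X Y Z) = associator M X Y Z"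
  "src (asc' X Y Z) = X \<boxtimes> (Y \<boxtimes> Z)" "tgt (asc' X Y Z) = (X \<boxtimes> Y) \<boxtimes> Z"
  by (simp_all add: asc_def asc'_def)

lemma asc_arr [simp]:
  assumes "X \<in> Obj M" "Y \<in> Obj M" "Z \<in> Obj M"
  shows "arr (asc X Y Z)" "arr (asc' X Y Z)"
    "asc X Y Z \<bullet> asc' X Y Z = idn (X \<boxtimes> (Y \<boxtimes> Z))" "asc' X Y Z \<bullet> asc X Y Z = idn ((X \<boxtimes> Y) \<boxtimes> Z)"
  using inverse_mor_inverse[OF _ _ associator_iso[OF assms]] assms
  by (auto simp del: arr_obj simp: is_inverse_def arr_def asc_def asc'_def cmp_def idn_def)

lemma asc_cancel [simp]:
  assumes "X \<in> Obj M" "Y \<in> Obj M" "Z \<in> Obj M" "arr f"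
  shows "tgt f = X \<boxtimes> (Y \<boxtimes> Z) \<Longrightarrow> asc X Y Z \<bullet> (asc' X Y Z \<bullet> f) = f"
    "tgt f = (X \<boxtimes> Y) \<boxtimes> Z \<Longrightarrow> asc' X Y Z \<bullet> (asc X Y Z \<bullet> f) = f"
  using assms by (simp_all add: cmp_extend[OF asc_arr(3)] cmp_extend[OF asc_arr(4)])

lemma asc_nat:
  "\<lbrakk>arr f; arr g; arr h; tgt f = X; tgt g = Y; tgt h = Z\<rbrakk>
    \<Longrightarrow> asc X Y Z \<bullet> ((f \<odot> g) \<odot> h) = (f \<odot> (g \<odot> h)) \<bullet> asc (src f) (src g) (src h)"
  using associator_natural[of "src f" X "src g" Y "src h" Z "mor f" "mor g" "mor h"]
  unfolding arr_def by (auto intro!: arrow.expand)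

text \<open>Naturality of the associator, conjugated by the inverse associators.\<close>

lemma asc'_nat:
  assumes "arr f" "arr g" "arr h" "tgt f = X" "tgt g = Y" "tgt h = Z"
  shows "asc' X Y Z \<bullet> (f \<odot> (g \<odot> h)) = ((f \<odot> g) \<odot> h) \<bullet> asc' (src f) (src g) (src h)"
proof -
  have "asc' X Y Z \<bullet> (f \<odot> (g \<odot> h)) =
      asc' X Y Z \<bullet> ((f \<odot> (g \<odot> h)) \<bullet> asc (src f) (src g) (src h)) \<bullet> asc' (src f) (src g) (src h)"
    using assms by simp
  also have "\<dots> = asc' X Y Z \<bullet> (asc X Y Z \<bullet> ((f \<odot> g) \<odot> h)) \<bullet> asc' (src f) (src g) (src h)"
    using assms by (simp only: asc_nat)
  also have "\<dots> = ((f \<odot> g) \<odot> h) \<bullet> asc' (src f) (src g) (src h)"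
    using assms by (auto simp del: tns_simps(3))
  finally show ?thesis .
qed

lemma lun_simps [simp]:
  "src (lun X) = II \<boxtimes> X" "tgt (lun X) = X" "mor (lun X) = lunitor M X"
  "src (run X) = X \<boxtimes> II" "tgt (run X) = X" "mor (run X) = runitor M X"
  by (simp_all add: lun_def run_def)

lemma lun_run_arr [simp]: "X \<in> Obj M \<Longrightarrow> arr (lun X)" "X \<in> Obj M \<Longrightarrow> arr (run X)"
  using lunitor_iso[of X] runitor_iso[of X] by (auto simp del: arr_obj simp: arr_def is_iso_def is_inverse_def)

lemma lun_nat: "\<lbrakk>arr f; tgt f = Y\<rbrakk> \<Longrightarrow> lun Y \<bullet> (idn II \<odot> f) = f \<bullet> lun (src f)"
  using lunitor_natural[of "src f" Y "mor f"]
  unfolding arr_def by (auto intro!: arrow.expand)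

lemma run_nat: "\<lbrakk>arr f; tgt f = Y\<rbrakk> \<Longrightarrow> run Y \<bullet> (f \<odot> idn II) = f \<bullet> run (src f)"
  using runitor_natural[of "src f" Y "mor f"]
  unfolding arr_def by (auto intro!: arrow.expand)

text \<open>A right inverse \<open>K\<close> of the isomorphism \<open>lun X\<close> cancels it;
  together with \<open>lun_nat\<close> this makes \<open>idn II \<odot> -\<close> faithful.\<close>

lemma lun_epi:
  assumes "arr f" "arr g" "src f = X" "src g = X" "f \<bullet> lun X = g \<bullet> lun X"
  shows "f = g"
proof -
  have X: "X \<in> Obj M" using assms by auto
  obtain k where k: "k \<in> Hom M X (II \<boxtimes> X)" "lunitor M X \<cdot> k = ident M X"
    using lunitor_iso[OF X] by (auto simp: is_iso_def is_inverse_def)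
  define K where "K = Arrow X k (II \<boxtimes> X)"
  have K: "arr K" "src K = X" "tgt K = II \<boxtimes> X" "lun X \<bullet> K = idn X"
    using k X by (simp_all del: arr_obj add: K_def arr_def cmp_def idn_def)
  have "f = (f \<bullet> lun X) \<bullet> K" "g = (g \<bullet> lun X) \<bullet> K"
    using assms(1-4) K X by simp_all
  then show ?thesis using assms(5) by simp
qed

lemma run_epi:
  assumes "arr f" "arr g" "src f = X" "src g = X" "f \<bullet> run X = g \<bullet> run X"
  shows "f = g"
proof -
  have X: "X \<in> Obj M" using assms by auto
  obtain k where k: "k \<in> Hom M X (X \<boxtimes> II)" "runitor M X \<cdot> k = ident M X"
    using runitor_iso[OF X] by (auto simp: is_iso_def is_inverse_def)
  define K where "K = Arrow X k (X \<boxtimes> II)"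
  have K: "arr K" "src K = X" "tgt K = X \<boxtimes> II" "run X \<bullet> K = idn X"
    using k X by (simp_all del: arr_obj add: K_def arr_def cmp_def idn_def)
  have "f = (f \<bullet> run X) \<bullet> K" "g = (g \<bullet> run X) \<bullet> K"
    using assms(1-4) K X by simp_all
  then show ?thesis using assms(5) by simp
qed

lemma pentagon_arr:
  "\<lbrakk>W \<in> Obj M; X \<in> Obj M; Y \<in> Obj M; Z \<in> Obj M\<rbrakk> \<Longrightarrow> asc W X (Y \<boxtimes> Z) \<bullet> asc (W \<boxtimes> X) Y Z =
    (idn W \<odot> asc X Y Z) \<bullet> asc W (X \<boxtimes> Y) Z \<bullet> (asc W X Y \<odot> idn Z)"
  using pentagon[of W X Y Z] by (auto intro!: arrow.expand)

lemma triangle_arr: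
  "\<lbrakk>X \<in> Obj M; Y \<in> Obj M\<rbrakk> \<Longrightarrow> (idn X \<odot> lun Y) \<bullet> asc X II Y = run X \<odot> idn Y"
  using triangle[of X Y] by (auto intro!: arrow.expand)

lemma tns_cmp_idn:
  "\<lbrakk>arr f; arr g; tgt f = src g; X \<in> Obj M\<rbrakk> \<Longrightarrow> (g \<bullet> f) \<odot> idn X = (g \<odot> idn X) \<bullet> (f \<odot> idn X)"
  "\<lbrakk>arr f; arr g; tgt f = src g; X \<in> Obj M\<rbrakk> \<Longrightarrow> idn X \<odot> (g \<bullet> f) = (idn X \<odot> g) \<bullet> (idn X \<odot> f)"
  using tns_cmp[of f g "idn X" "idn X"] tns_cmp[of "idn X" "idn X" f g] by simp_all

text \<open>Kelly's two triangles, obtained from the triangle for \<open>(II, X)\<close> resp. \<open>(Y, II)\<close> and the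
  pentagon since tensoring with the unit object is faithful.\<close>

lemma lun_tensor:
  assumes XY: "X \<in> Obj M" "Y \<in> Obj M"
  shows "lun (X \<boxtimes> Y) \<bullet> asc II X Y = lun X \<odot> idn Y"
proof -
  let ?s = "asc II (II \<boxtimes> X) Y" and ?t = "asc II II X \<odot> idn Y"
  let ?t' = "asc' II II X \<odot> idn Y" and ?s' = "asc' II (II \<boxtimes> X) Y"
  \<comment> \<open>Precomposing with the invertible \<open>?s \<bullet> ?t\<close> produces the
    right-hand side of the pentagon for \<open>II, II, X, Y\<close>.\<close>
  have "(idn II \<odot> (lun (X \<boxtimes> Y) \<bullet> asc II X Y)) \<bullet> ?s \<bullet> ?t =
      (idn II \<odot> lun (X \<boxtimes> Y)) \<bullet> ((idn II \<odot> asc II X Y) \<bullet> ?s \<bullet> ?t)"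
    using XY by (simp add: tns_cmp_idn)
  also have "\<dots> = (idn II \<odot> lun (X \<boxtimes> Y)) \<bullet> (asc II II (X \<boxtimes> Y) \<bullet> asc (II \<boxtimes> II) X Y)"
    using XY by (simp add: pentagon_arr)
  also have "\<dots> = (run II \<odot> (idn X \<odot> idn Y)) \<bullet> asc (II \<boxtimes> II) X Y"
    using XY by (simp add: triangle_arr cmp_extend[OF triangle_arr])
  also have "\<dots> = asc II X Y \<bullet> ((run II \<odot> idn X) \<odot> idn Y)"
    using XY by (simp add: asc_nat del: tns_idn)
  also have "\<dots> = asc II X Y \<bullet> (((idn II \<odot> lun X) \<odot> idn Y) \<bullet> ?t)"
    using XY by (simp add: triangle_arr[symmetric] tns_cmp_idn)
  also have "\<dots> = (idn II \<odot> (lun X \<odot> idn Y)) \<bullet> ?s \<bullet> ?t"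
    using XY by (simp add: asc_nat cmp_extend[OF asc_nat])
  finally have eq: "(idn II \<odot> (lun (X \<boxtimes> Y) \<bullet> asc II X Y)) \<bullet> ?s \<bullet> ?t =
    (idn II \<odot> (lun X \<odot> idn Y)) \<bullet> ?s \<bullet> ?t" .
  have tt: "?t \<bullet> ?t' = idn ((II \<boxtimes> (II \<boxtimes> X)) \<boxtimes> Y)"
    using XY by (simp add: tns_cmp_idn(1)[symmetric])
  have c: "(f \<bullet> ?s \<bullet> ?t) \<bullet> ?t' \<bullet> ?s' = f" if "arr f" "src f = II \<boxtimes> ((II \<boxtimes> X) \<boxtimes> Y)" for f
    using XY that by (simp add: cmp_extend[OF tt])
  have "idn II \<odot> (lun (X \<boxtimes> Y) \<bullet> asc II X Y) =
      ((idn II \<odot> (lun (X \<boxtimes> Y) \<bullet> asc II X Y)) \<bullet> ?s \<bullet> ?t) \<bullet> ?t' \<bullet> ?s'"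
    by (rule c[symmetric]) (use XY in simp_all)
  also have "\<dots> = ((idn II \<odot> (lun X \<odot> idn Y)) \<bullet> ?s \<bullet> ?t) \<bullet> ?t' \<bullet> ?s'"
    by (simp only: eq)
  also have "\<dots> = idn II \<odot> (lun X \<odot> idn Y)"
    by (rule c) (use XY in simp_all)
  finally have "idn II \<odot> (lun (X \<boxtimes> Y) \<bullet> asc II X Y) = idn II \<odot> (lun X \<odot> idn Y)" .
  then have "(lun (X \<boxtimes> Y) \<bullet> asc II X Y) \<bullet> lun ((II \<boxtimes> X) \<boxtimes> Y) = (lun X \<odot> idn Y) \<bullet> lun ((II \<boxtimes> X) \<boxtimes> Y)"
    using XY lun_nat[of "lun (X \<boxtimes> Y) \<bullet> asc II X Y" "X \<boxtimes> Y"] lun_nat[of "lun X \<odot> idn Y" "X \<boxtimes> Y"]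
    by (simp del: cmp_assoc)
  then show ?thesis
    by (rule lun_epi[rotated 4]) (use XY in simp_all)
qed

lemma run_tensor:
  assumes XY: "X \<in> Obj M" "Y \<in> Obj M"
  shows "(idn X \<odot> run Y) \<bullet> asc X Y II = run (X \<boxtimes> Y)"
proof -
  \<comment> \<open>Composing with the associator lets naturality expose
    \<open>run Y \<odot> idn II\<close>, where the triangle for \<open>(Y, II)\<close> and then the
    pentagon for \<open>X, Y, II, II\<close> apply.\<close>
  have "asc X Y II \<bullet> (((idn X \<odot> run Y) \<bullet> asc X Y II) \<odot> idn II) =
      asc X Y II \<bullet> ((idn X \<odot> run Y) \<odot> idn II) \<bullet> (asc X Y II \<odot> idn II)"
    using XY by (simp add: tns_cmp_idn)
  also have "\<dots> = (idn X \<odot> (run Y \<odot> idn II)) \<bullet> asc X (Y \<boxtimes> II) II \<bullet> (asc X Y II \<odot> idn II)"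
    using XY by (simp add: cmp_extend[OF asc_nat])
  also have "\<dots> = (idn X \<odot> (idn Y \<odot> lun II)) \<bullet>
      ((idn X \<odot> asc Y II II) \<bullet> asc X (Y \<boxtimes> II) II \<bullet> (asc X Y II \<odot> idn II))"
    using XY by (simp add: triangle_arr[symmetric] tns_cmp_idn)
  also have "\<dots> = (idn X \<odot> (idn Y \<odot> lun II)) \<bullet> (asc X Y (II \<boxtimes> II) \<bullet> asc (X \<boxtimes> Y) II II)"
    using XY by (simp add: pentagon_arr)
  also have "\<dots> = (asc X Y II \<bullet> ((idn X \<odot> idn Y) \<odot> lun II)) \<bullet> asc (X \<boxtimes> Y) II II"
    using XY by (simp add: asc_nat del: tns_idn)
  also have "\<dots> = asc X Y II \<bullet> (run (X \<boxtimes> Y) \<odot> idn II)"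
    using XY by (simp add: triangle_arr)
  finally have eq: "asc X Y II \<bullet> (((idn X \<odot> run Y) \<bullet> asc X Y II) \<odot> idn II) =
    asc X Y II \<bullet> (run (X \<boxtimes> Y) \<odot> idn II)" .
  have "((idn X \<odot> run Y) \<bullet> asc X Y II) \<odot> idn II = run (X \<boxtimes> Y) \<odot> idn II"
    using arg_cong[OF eq, of "\<lambda>f. asc' X Y II \<bullet> f"] XY by simp
  then have "((idn X \<odot> run Y) \<bullet> asc X Y II) \<bullet> run ((X \<boxtimes> Y) \<boxtimes> II) = run (X \<boxtimes> Y) \<bullet> run ((X \<boxtimes> Y) \<boxtimes> II)"
    using XY run_nat[of "(idn X \<odot> run Y) \<bullet> asc X Y II" "X \<boxtimes> Y"] run_nat[of "run (X \<boxtimes> Y)" "X \<boxtimes> Y"]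
    by (simp del: cmp_assoc)
  then show ?thesis
    by (rule run_epi[rotated 4]) (use XY in simp_all)
qed

end

section \<open>The two comonads of a coalgebra\<close>

context monoidal_category
begin

lemma tns_interchange:
  assumes "arr f" "arr g"
  shows "(f \<odot> idn (tgt g)) \<bullet> (idn (src f) \<odot> g) = f \<odot> g"
    and "(idn (tgt f) \<odot> g) \<bullet> (f \<odot> idn (src g)) = f \<odot> g"
  using assms by (simp_all add: tns_cmp[symmetric])

lemma run_tensor':
  assumes "X \<in> Obj M" "Y \<in> Obj M"
  shows "run (X \<boxtimes> Y) \<bullet> asc' X Y II = idn X \<odot> run Y"
  using assms by (simp add: run_tensor[symmetric])

lemma triangle_arr':
  assumes "X \<in> Obj M" "Y \<in> Obj M"
  shows "(run X \<odot> idn Y) \<bullet> asc' X II Y = idn X \<odot> lun Y"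
  using assms by (simp add: triangle_arr[symmetric])

end

context coalgebra
begin

definition LL :: "('o, 'm) arrow \<Rightarrow> ('o, 'm) arrow" where "LL f = idn C \<odot> f"
definition RR :: "('o, 'm) arrow \<Rightarrow> ('o, 'm) arrow" where "RR f = f \<odot> idn C"

definition DD :: "('o, 'm) arrow" where "DD = Arrow C \<Delta> (C \<boxtimes> C)"
definition EE :: "('o, 'm) arrow" where "EE = Arrow C \<epsilon> II"

text \<open>\<open>dl\<close>, \<open>el\<close> are the comultiplication and counit of the comonad \<open>C \<otimes> -\<close>, and \<open>dr\<close>, \<open>er\<close> those of
  \<open>- \<otimes> C\<close>; \<open>ph\<close> is the distributive law between them, with inverse \<open>ph'\<close>.\<close>

definition dl :: "'o \<Rightarrow> ('o, 'm) arrow" where "dl X = asc C C X \<bullet> (DD \<odot> idn X)"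
definition el :: "'o \<Rightarrow> ('o, 'm) arrow" where "el X = lun X \<bullet> (EE \<odot> idn X)"
definition dr :: "'o \<Rightarrow> ('o, 'm) arrow" where "dr X = asc' X C C \<bullet> (idn X \<odot> DD)"
definition er :: "'o \<Rightarrow> ('o, 'm) arrow" where "er X = run X \<bullet> (idn X \<odot> EE)"
definition ph :: "'o \<Rightarrow> ('o, 'm) arrow" where "ph X = asc C X C"
definition ph' :: "'o \<Rightarrow> ('o, 'm) arrow" where "ph' X = asc' C X C"

lemmas [simp] = coalg_obj

lemma DD_simps [simp]: "src DD = C" "tgt DD = C \<boxtimes> C" "mor DD = \<Delta>" "arr DD"
  using comult_hom by (simp_all add: DD_def arr_def del: arr_obj)

lemma EE_simps [simp]: "src EE = C" "tgt EE = II" "mor EE = \<epsilon>" "arr EE"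
  using counit_hom by (simp_all add: EE_def arr_def del: arr_obj)

lemma DD_coassoc: "asc C C C \<bullet> (DD \<odot> idn C) \<bullet> DD = (idn C \<odot> DD) \<bullet> DD"
  using coassociative by (auto intro!: arrow.expand)

lemma EE_counit: "lun C \<bullet> (EE \<odot> idn C) \<bullet> DD = idn C" "run C \<bullet> (idn C \<odot> EE) \<bullet> DD = idn C"
  using counit_left counit_right by (auto intro!: arrow.expand)

lemma LL_RR_simps [simp]:
  "src (LL f) = C \<boxtimes> src f" "tgt (LL f) = C \<boxtimes> tgt f" "mor (LL f) = ident M C \<star> mor f"
  "src (RR f) = src f \<boxtimes> C" "tgt (RR f) = tgt f \<boxtimes> C" "mor (RR f) = mor f \<star> ident M C"
  "arr f \<Longrightarrow> arr (LL f)" "arr f \<Longrightarrow> arr (RR f)"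
  "X \<in> Obj M \<Longrightarrow> LL (idn X) = idn (C \<boxtimes> X)" "X \<in> Obj M \<Longrightarrow> RR (idn X) = idn (X \<boxtimes> C)"
  by (simp_all add: LL_def RR_def)

lemma LL_cmp: "\<lbrakk>arr f; arr g; tgt f = src g\<rbrakk> \<Longrightarrow> LL (g \<bullet> f) = LL g \<bullet> LL f"
  by (simp add: LL_def tns_cmp_idn)

lemma RR_cmp: "\<lbrakk>arr f; arr g; tgt f = src g\<rbrakk> \<Longrightarrow> RR (g \<bullet> f) = RR g \<bullet> RR f"
  by (simp add: RR_def tns_cmp_idn)

lemma comonad_simps [simp]:
  "src (dl X) = C \<boxtimes> X" "tgt (dl X) = C \<boxtimes> (C \<boxtimes> X)" "src (el X) = C \<boxtimes> X" "tgt (el X) = X"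
  "src (dr X) = X \<boxtimes> C" "tgt (dr X) = (X \<boxtimes> C) \<boxtimes> C" "src (er X) = X \<boxtimes> C" "tgt (er X) = X"
  "src (ph X) = (C \<boxtimes> X) \<boxtimes> C" "tgt (ph X) = C \<boxtimes> (X \<boxtimes> C)"
  "src (ph' X) = C \<boxtimes> (X \<boxtimes> C)" "tgt (ph' X) = (C \<boxtimes> X) \<boxtimes> C"
  by (simp_all add: dl_def el_def dr_def er_def ph_def ph'_def)

lemma comonad_arr [simp]:
  assumes "X \<in> Obj M"
  shows "arr (dl X)" "arr (el X)" "arr (dr X)" "arr (er X)" "arr (ph X)" "arr (ph' X)"
    "ph X \<bullet> ph' X = idn (C \<boxtimes> (X \<boxtimes> C))" "ph' X \<bullet> ph X = idn ((C \<boxtimes> X) \<boxtimes> C)"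
  using assms by (simp_all add: dl_def el_def dr_def er_def ph_def ph'_def)

lemma ph_cancel [simp]:
  assumes "X \<in> Obj M" "arr f"
  shows "tgt f = C \<boxtimes> (X \<boxtimes> C) \<Longrightarrow> ph X \<bullet> (ph' X \<bullet> f) = f"
    "tgt f = (C \<boxtimes> X) \<boxtimes> C \<Longrightarrow> ph' X \<bullet> (ph X \<bullet> f) = f"
  using assms by (simp_all add: ph_def ph'_def)

section \<open>Naturality of the comonad structures and of the distributive law\<close>

lemma dl_nat:
  assumes "arr f" "src f = X" "tgt f = Y"
  shows "dl Y \<bullet> LL f = LL (LL f) \<bullet> dl X"
proof -
  have ob: "X \<in> Obj M" "Y \<in> Obj M" using assms by auto
  have "dl Y \<bullet> LL f = asc C C Y \<bullet> ((idn (C \<boxtimes> C) \<odot> f) \<bullet> (DD \<odot> idn X))"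
    using assms ob tns_interchange[of DD f] by (simp add: dl_def LL_def)
  \<comment> \<open>The identity of \<open>C \<boxtimes> C\<close> is split into two factors to
    expose the triple tensor required by \<open>asc_nat\<close>; disabling \<open>tns_idn\<close> in
    the next step keeps the factors apart. The same device recurs below.\<close>
  also have "\<dots> = (asc C C Y \<bullet> ((idn C \<odot> idn C) \<odot> f)) \<bullet> (DD \<odot> idn X)"
    using assms ob by simp
  also have "\<dots> = LL (LL f) \<bullet> dl X"
    using assms ob by (simp add: asc_nat dl_def LL_def del: tns_idn)
  finally show ?thesis .
qed

lemma el_nat:
  assumes "arr f" "src f = X" "tgt f = Y"
  shows "el Y \<bullet> LL f = f \<bullet> el X"
proof -
  have ob: "X \<in> Obj M" "Y \<in> Obj M" using assms by auto
  have "el Y \<bullet> LL f = (lun Y \<bullet> (idn II \<odot> f)) \<bullet> (EE \<odot> idn X)"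
    using assms ob tns_interchange[of EE f] by (simp add: el_def LL_def)
  also have "\<dots> = f \<bullet> el X"
    using assms ob by (simp add: lun_nat el_def)
  finally show ?thesis .
qed

lemma dr_nat:
  assumes "arr f" "src f = X" "tgt f = Y"
  shows "dr Y \<bullet> RR f = RR (RR f) \<bullet> dr X"
proof -
  have ob: "X \<in> Obj M" "Y \<in> Obj M" using assms by auto
  have "dr Y \<bullet> RR f = asc' Y C C \<bullet> ((f \<odot> idn (C \<boxtimes> C)) \<bullet> (idn X \<odot> DD))"
    using assms ob tns_interchange[of f DD] by (simp add: dr_def RR_def)
  also have "\<dots> = (asc' Y C C \<bullet> (f \<odot> (idn C \<odot> idn C))) \<bullet> (idn X \<odot> DD)"
    using assms ob by simp
  also have "\<dots> = RR (RR f) \<bullet> dr X"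
    using assms ob by (simp add: asc'_nat dr_def RR_def del: tns_idn)
  finally show ?thesis .
qed

lemma er_nat:
  assumes "arr f" "src f = X" "tgt f = Y"
  shows "er Y \<bullet> RR f = f \<bullet> er X"
proof -
  have ob: "X \<in> Obj M" "Y \<in> Obj M" using assms by auto
  have "er Y \<bullet> RR f = (run Y \<bullet> (f \<odot> idn II)) \<bullet> (idn X \<odot> EE)"
    using assms ob tns_interchange[of f EE] by (simp add: er_def RR_def)
  also have "\<dots> = f \<bullet> er X"
    using assms ob by (simp add: run_nat er_def)
  finally show ?thesis .
qed

lemma ph_nat: "\<lbrakk>arr f; src f = X; tgt f = Y\<rbrakk> \<Longrightarrow> ph Y \<bullet> RR (LL f) = LL (RR f) \<bullet> ph X"
  by (auto simp: ph_def LL_def RR_def asc_nat)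

lemma ph'_nat: "\<lbrakk>arr f; src f = X; tgt f = Y\<rbrakk> \<Longrightarrow> ph' Y \<bullet> LL (RR f) = RR (LL f) \<bullet> ph' X"
  by (auto simp: ph'_def LL_def RR_def asc'_nat)

text \<open>Coassociativity of \<open>DD\<close> tensored with \<open>X\<close>, transported by the
  pentagon for \<open>C, C, C, X\<close>.\<close>

lemma dl_dl:
  assumes X: "X \<in> Obj M"
  shows "dl (C \<boxtimes> X) \<bullet> dl X = LL (dl X) \<bullet> dl X"
proof -
  have "dl (C \<boxtimes> X) \<bullet> dl X =
      asc C C (C \<boxtimes> X) \<bullet> ((DD \<odot> (idn C \<odot> idn X)) \<bullet> asc C C X) \<bullet> (DD \<odot> idn X)"
    using X by (simp add: dl_def)
  also have "\<dots> = asc C C (C \<boxtimes> X) \<bullet> (asc (C \<boxtimes> C) C X \<bullet> ((DD \<odot> idn C) \<odot> idn X)) \<bullet> (DD \<odot> idn X)"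
    using X by (simp add: asc_nat del: tns_idn)
  also have "\<dots> = (asc C C (C \<boxtimes> X) \<bullet> asc (C \<boxtimes> C) C X) \<bullet> (((DD \<odot> idn C) \<bullet> DD) \<odot> idn X)"
    using X by (simp add: tns_cmp_idn)
  also have "\<dots> = (idn C \<odot> asc C C X) \<bullet> asc C (C \<boxtimes> C) X \<bullet>
      ((asc C C C \<bullet> (DD \<odot> idn C) \<bullet> DD) \<odot> idn X)"
    using X by (simp add: pentagon_arr tns_cmp_idn)
  also have "\<dots> = (idn C \<odot> asc C C X) \<bullet> asc C (C \<boxtimes> C) X \<bullet> ((idn C \<odot> DD) \<odot> idn X) \<bullet> (DD \<odot> idn X)"
    using X by (simp add: DD_coassoc tns_cmp_idn)
  also have "\<dots> = LL (dl X) \<bullet> dl X"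
    using X by (simp add: cmp_extend[OF asc_nat] dl_def LL_def tns_cmp_idn)
  finally show ?thesis .
qed

text \<open>The two counit laws of C \<otimes> - have different sources: here the left counit of
  \<open>C\<close> and Kelly's triangle, in \<open>LL_el_dl\<close> the right counit and the
  triangle axiom.\<close>

lemma el_dl:
  assumes X: "X \<in> Obj M"
  shows "el (C \<boxtimes> X) \<bullet> dl X = idn (C \<boxtimes> X)"
proof -
  have "el (C \<boxtimes> X) \<bullet> dl X =
      lun (C \<boxtimes> X) \<bullet> ((EE \<odot> (idn C \<odot> idn X)) \<bullet> asc C C X) \<bullet> (DD \<odot> idn X)"
    using X by (simp add: dl_def el_def)
  also have "\<dots> = (lun (C \<boxtimes> X) \<bullet> asc II C X) \<bullet> ((EE \<odot> idn C) \<odot> idn X) \<bullet> (DD \<odot> idn X)"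
    using X by (simp add: asc_nat cmp_extend[OF asc_nat] del: tns_idn)
  also have "\<dots> = (lun C \<bullet> (EE \<odot> idn C) \<bullet> DD) \<odot> idn X"
    using X by (simp add: lun_tensor tns_cmp_idn)
  also have "\<dots> = idn (C \<boxtimes> X)"
    using X by (simp only: EE_counit tns_idn coalg_obj)
  finally show ?thesis .
qed

lemma LL_el_dl:
  assumes X: "X \<in> Obj M"
  shows "LL (el X) \<bullet> dl X = idn (C \<boxtimes> X)"
proof -
  have "LL (el X) \<bullet> dl X =
      (idn C \<odot> lun X) \<bullet> ((idn C \<odot> (EE \<odot> idn X)) \<bullet> asc C C X) \<bullet> (DD \<odot> idn X)"
    using X by (simp add: dl_def el_def LL_def tns_cmp_idn)
  also have "\<dots> = ((idn C \<odot> lun X) \<bullet> asc C II X) \<bullet> ((idn C \<odot> EE) \<odot> idn X) \<bullet> (DD \<odot> idn X)"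
    using X by (simp add: asc_nat cmp_extend[OF asc_nat])
  also have "\<dots> = (run C \<bullet> (idn C \<odot> EE) \<bullet> DD) \<odot> idn X"
    using X by (simp add: triangle_arr tns_cmp_idn)
  also have "\<dots> = idn (C \<boxtimes> X)"
    using X by (simp only: EE_counit tns_idn coalg_obj)
  finally show ?thesis .
qed

text \<open>\<open>dr\<close> contains inverse associators, while the pentagon speaks of
  associators. Both sides are therefore compared after composing with the invertible
  \<open>?a \<bullet> ?b\<close>, where the pentagon for \<open>X, C, C, C\<close> applies, and
  \<open>c\<close> cancels that factor again.\<close>

lemma dr_dr:
  assumes X: "X \<in> Obj M"
  shows "dr (X \<boxtimes> C) \<bullet> dr X = RR (dr X) \<bullet> dr X"
proof -
  let ?a = "asc X C (C \<boxtimes> C)" and ?b = "asc (X \<boxtimes> C) C C"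
  have "?a \<bullet> ?b \<bullet> dr (X \<boxtimes> C) \<bullet> dr X = (?a \<bullet> ((idn X \<odot> idn C) \<odot> DD)) \<bullet> dr X"
    using X by (simp add: dr_def)
  also have "\<dots> = (idn X \<odot> ((idn C \<odot> DD) \<bullet> DD))"
    using X by (simp add: asc_nat dr_def tns_cmp_idn del: tns_idn)
  also have "\<dots> = (idn X \<odot> asc C C C) \<bullet> ((idn X \<odot> (DD \<odot> idn C)) \<bullet> asc X C C) \<bullet> dr X"
    using X by (simp add: DD_coassoc[symmetric] tns_cmp_idn dr_def)
  also have "\<dots> = (idn X \<odot> asc C C C) \<bullet> (asc X (C \<boxtimes> C) C \<bullet> ((idn X \<odot> DD) \<odot> idn C)) \<bullet> dr X"
    using X by (simp add: asc_nat)
  also have "\<dots> = ((idn X \<odot> asc C C C) \<bullet> asc X (C \<boxtimes> C) C \<bullet> (asc X C C \<odot> idn C)) \<bullet> RR (dr X) \<bullet> dr X"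
  proof -
    have "(asc X C C \<odot> idn C) \<bullet> RR (dr X) = (idn X \<odot> DD) \<odot> idn C"
      using X by (simp add: RR_def dr_def tns_cmp_idn(1)[symmetric])
    from cmp_extend[OF this] show ?thesis using X by simp
  qed
  also have "\<dots> = ?a \<bullet> ?b \<bullet> RR (dr X) \<bullet> dr X"
    using X by (simp add: cmp_extend[OF pentagon_arr])
  finally have eq: "?a \<bullet> ?b \<bullet> dr (X \<boxtimes> C) \<bullet> dr X = ?a \<bullet> ?b \<bullet> RR (dr X) \<bullet> dr X" .
  have c: "f = asc' (X \<boxtimes> C) C C \<bullet> asc' X C (C \<boxtimes> C) \<bullet> (?a \<bullet> ?b \<bullet> f)"
    if "arr f" "tgt f = ((X \<boxtimes> C) \<boxtimes> C) \<boxtimes> C" for f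
    using X that by simp
  show ?thesis
    by (rule trans[OF c trans[OF arg_cong[OF eq, of "\<lambda>f. asc' (X \<boxtimes> C) C C \<bullet> asc' X C (C \<boxtimes> C) \<bullet> f"] c[symmetric]]])
      (use X in simp_all)
qed

lemma er_dr:
  assumes X: "X \<in> Obj M"
  shows "er (X \<boxtimes> C) \<bullet> dr X = idn (X \<boxtimes> C)"
proof -
  have "er (X \<boxtimes> C) \<bullet> dr X =
      run (X \<boxtimes> C) \<bullet> (((idn X \<odot> idn C) \<odot> EE) \<bullet> asc' X C C) \<bullet> (idn X \<odot> DD)"
    using X by (simp add: dr_def er_def)
  also have "\<dots> = (run (X \<boxtimes> C) \<bullet> asc' X C II) \<bullet> (idn X \<odot> (idn C \<odot> EE)) \<bullet> (idn X \<odot> DD)"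
    using X by (simp add: asc'_nat cmp_extend[OF asc'_nat] del: tns_idn)
  also have "\<dots> = idn X \<odot> (run C \<bullet> (idn C \<odot> EE) \<bullet> DD)"
    using X by (simp add: run_tensor' tns_cmp_idn)
  also have "\<dots> = idn (X \<boxtimes> C)"
    using X by (simp only: EE_counit tns_idn coalg_obj)
  finally show ?thesis .
qed

lemma RR_er_dr:
  assumes X: "X \<in> Obj M"
  shows "RR (er X) \<bullet> dr X = idn (X \<boxtimes> C)"
proof -
  have "RR (er X) \<bullet> dr X =
      (run X \<odot> idn C) \<bullet> (((idn X \<odot> EE) \<odot> idn C) \<bullet> asc' X C C) \<bullet> (idn X \<odot> DD)"
    using X by (simp add: dr_def er_def RR_def tns_cmp_idn)
  also have "\<dots> = ((run X \<odot> idn C) \<bullet> asc' X II C) \<bullet> (idn X \<odot> (EE \<odot> idn C)) \<bullet> (idn X \<odot> DD)"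
    using X by (simp add: asc'_nat cmp_extend[OF asc'_nat])
  also have "\<dots> = idn X \<odot> (lun C \<bullet> (EE \<odot> idn C) \<bullet> DD)"
    using X by (simp add: triangle_arr' tns_cmp_idn)
  also have "\<dots> = idn (X \<boxtimes> C)"
    using X by (simp only: EE_counit tns_idn coalg_obj)
  finally show ?thesis .
qed

section \<open>Compatibility of the two comonads with the distributive law\<close>

lemma dl_ph:
  assumes X: "X \<in> Obj M"
  shows "dl (X \<boxtimes> C) \<bullet> ph X = LL (ph X) \<bullet> ph (C \<boxtimes> X) \<bullet> RR (dl X)"
proof -
  have "dl (X \<boxtimes> C) \<bullet> ph X = asc C C (X \<boxtimes> C) \<bullet> ((DD \<odot> (idn X \<odot> idn C)) \<bullet> asc C X C)"
    using X by (simp add: dl_def ph_def)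
  also have "\<dots> = (asc C C (X \<boxtimes> C) \<bullet> asc (C \<boxtimes> C) X C) \<bullet> ((DD \<odot> idn X) \<odot> idn C)"
    using X by (simp add: asc_nat del: tns_idn)
  \<comment> \<open>The pentagon for \<open>C, C, X, C\<close>.\<close>
  also have "\<dots> = LL (ph X) \<bullet> ph (C \<boxtimes> X) \<bullet> RR (dl X)"
    using X by (simp add: pentagon_arr LL_def RR_def ph_def dl_def tns_cmp_idn)
  finally show ?thesis .
qed

lemma el_ph:
  assumes X: "X \<in> Obj M"
  shows "el (X \<boxtimes> C) \<bullet> ph X = RR (el X)"
proof -
  have "el (X \<boxtimes> C) \<bullet> ph X = lun (X \<boxtimes> C) \<bullet> ((EE \<odot> (idn X \<odot> idn C)) \<bullet> asc C X C)"
    using X by (simp add: el_def ph_def)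
  also have "\<dots> = (lun (X \<boxtimes> C) \<bullet> asc II X C) \<bullet> ((EE \<odot> idn X) \<odot> idn C)"
    using X by (simp add: asc_nat del: tns_idn)
  also have "\<dots> = RR (el X)"
    using X by (simp add: lun_tensor RR_def el_def tns_cmp_idn)
  finally show ?thesis .
qed

lemma er_ph:
  assumes X: "X \<in> Obj M"
  shows "LL (er X) \<bullet> ph X = er (C \<boxtimes> X)"
proof -
  have "LL (er X) \<bullet> ph X = (idn C \<odot> run X) \<bullet> ((idn C \<odot> (idn X \<odot> EE)) \<bullet> asc C X C)"
    using X by (simp add: er_def ph_def LL_def tns_cmp_idn)
  also have "\<dots> = ((idn C \<odot> run X) \<bullet> asc C X II) \<bullet> ((idn C \<odot> idn X) \<odot> EE)"
    using X by (simp add: asc_nat del: tns_idn)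
  also have "\<dots> = er (C \<boxtimes> X)"
    using X by (simp add: run_tensor er_def)
  finally show ?thesis .
qed

text \<open>The pentagon for \<open>C, X, C, C\<close>; composing with \<open>?b\<close> first
  clears the inverse associator hidden in \<open>dr X\<close>.\<close>

lemma dr_ph:
  assumes X: "X \<in> Obj M"
  shows "LL (dr X) \<bullet> ph X = ph (X \<boxtimes> C) \<bullet> RR (ph X) \<bullet> dr (C \<boxtimes> X)"
proof -
  let ?b = "idn C \<odot> asc X C C"
  have b: "(idn C \<odot> asc' X C C) \<bullet> ?b = idn (C \<boxtimes> ((X \<boxtimes> C) \<boxtimes> C))"
    using X by (simp add: tns_cmp_idn(2)[symmetric])
  have bd: "?b \<bullet> LL (dr X) = idn C \<odot> (idn X \<odot> DD)"
    using X by (simp add: LL_def dr_def tns_cmp_idn(2)[symmetric])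
  have "?b \<bullet> LL (dr X) \<bullet> ph X = (idn C \<odot> (idn X \<odot> DD)) \<bullet> ph X"
    using X by (simp add: cmp_extend[OF bd])
  also have "\<dots> = asc C X (C \<boxtimes> C) \<bullet> ((idn C \<odot> idn X) \<odot> DD)"
    using X by (simp add: asc_nat ph_def del: tns_idn)
  also have "\<dots> = (asc C X (C \<boxtimes> C) \<bullet> asc (C \<boxtimes> X) C C) \<bullet> dr (C \<boxtimes> X)"
    using X by (simp add: dr_def)
  also have "\<dots> = ?b \<bullet> (ph (X \<boxtimes> C) \<bullet> RR (ph X) \<bullet> dr (C \<boxtimes> X))"
    using X by (simp add: pentagon_arr ph_def RR_def)
  finally have eq: "?b \<bullet> LL (dr X) \<bullet> ph X = ?b \<bullet> (ph (X \<boxtimes> C) \<bullet> RR (ph X) \<bullet> dr (C \<boxtimes> X))" .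
  have c: "f = (idn C \<odot> asc' X C C) \<bullet> (?b \<bullet> f)" if "arr f" "tgt f = C \<boxtimes> ((X \<boxtimes> C) \<boxtimes> C)" for f
    using X that by (simp add: cmp_extend[OF b])
  show ?thesis
    by (rule trans[OF c trans[OF arg_cong[OF eq, of "\<lambda>f. (idn C \<odot> asc' X C C) \<bullet> f"] c[symmetric]]]) (use X in simp_all)
qed

end

section \<open>Comodules\<close>

lemma arrow_eq_iff: "f = g \<longleftrightarrow> src f = src g \<and> mor f = mor g \<and> tgt f = tgt g"
  using arrow.expand by blast

context coalgebra
begin

text \<open>The coaction alone stands for the comodule, since a bundled arrow carries its
  source.\<close>

definition lcom :: "('o, 'm) arrow \<Rightarrow> bool" where
  "lcom l \<longleftrightarrow> arr l \<and> tgt l = C \<boxtimes> src l \<and> dl (src l) \<bullet> l = LL l \<bullet> l \<and> el (src l) \<bullet> l = idn (src l)"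

definition rcom :: "('o, 'm) arrow \<Rightarrow> bool" where
  "rcom r \<longleftrightarrow> arr r \<and> tgt r = src r \<boxtimes> C \<and> dr (src r) \<bullet> r = RR r \<bullet> r \<and> er (src r) \<bullet> r = idn (src r)"

definition bcom :: "('o, 'm) arrow \<Rightarrow> ('o, 'm) arrow \<Rightarrow> bool" where
  "bcom l r \<longleftrightarrow> lcom l \<and> rcom r \<and> src r = src l \<and> ph (src l) \<bullet> RR l \<bullet> r = LL r \<bullet> l"

definition lmap :: "('o, 'm) arrow \<Rightarrow> ('o, 'm) arrow \<Rightarrow> ('o, 'm) arrow \<Rightarrow> bool" where
  "lmap l l' f \<longleftrightarrow> arr f \<and> src f = src l \<and> tgt f = src l' \<and> l' \<bullet> f = LL f \<bullet> l"

definition rmap :: "('o, 'm) arrow \<Rightarrow> ('o, 'm) arrow \<Rightarrow> ('o, 'm) arrow \<Rightarrow> bool" where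
  "rmap r r' f \<longleftrightarrow> arr f \<and> src f = src r \<and> tgt f = src r' \<and> r' \<bullet> f = RR f \<bullet> r"

definition bmap where
  "bmap l r l' r' f \<longleftrightarrow> lmap l l' f \<and> rmap r r' f"

lemma lcomD:
  assumes "lcom l"
  shows "arr l" "tgt l = C \<boxtimes> src l" "el (src l) \<bullet> l = idn (src l)"
  using assms by (simp_all add: lcom_def)

lemma rcomD:
  assumes "rcom r"
  shows "arr r" "tgt r = src r \<boxtimes> C" "er (src r) \<bullet> r = idn (src r)"
  using assms by (simp_all add: rcom_def)

lemma lmap_idn: "lcom l \<Longrightarrow> lmap l l (idn (src l))"
  by (simp add: lmap_def lcomD)

lemma rmap_idn: "rcom r \<Longrightarrow> rmap r r (idn (src r))"
  by (simp add: rmap_def rcomD)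

lemma lmap_cmp:
  assumes "lcom l" "lcom l'" "lcom l''" "lmap l l' f" "lmap l' l'' g"
  shows "lmap l l'' (g \<bullet> f)"
proof -
  have *: "l'' \<bullet> g = LL g \<bullet> l'" "l' \<bullet> f = LL f \<bullet> l"
    "arr f" "src f = src l" "tgt f = src l'" "arr g" "src g = src l'" "tgt g = src l''"
    using assms by (auto simp: lmap_def)
  then show ?thesis
    using assms(1-3) by (simp add: lmap_def LL_cmp cmp_extend[OF *(1)] lcomD)
qed

lemma rmap_cmp:
  assumes "rcom r" "rcom r'" "rcom r''" "rmap r r' f" "rmap r' r'' g"
  shows "rmap r r'' (g \<bullet> f)"
proof -
  have *: "r'' \<bullet> g = RR g \<bullet> r'" "r' \<bullet> f = RR f \<bullet> r"
    "arr f" "src f = src r" "tgt f = src r'" "arr g" "src g = src r'" "tgt g = src r''"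
    using assms by (auto simp: rmap_def)
  then show ?thesis
    using assms(1-3) by (simp add: rmap_def RR_cmp cmp_extend[OF *(1)] rcomD)
qed

lemma bmap_cmp:
  "\<lbrakk>bcom l r; bcom l' r'; bcom l'' r''; bmap l r l' r' f; bmap l' r' l'' r'' g\<rbrakk>
    \<Longrightarrow> bmap l r l'' r'' (g \<bullet> f)"
  unfolding bmap_def bcom_def using lmap_cmp rmap_cmp by blast

section \<open>Cofree comodules, cofree bicomodules and their adjunctions\<close>

lemma rcom_dr: "N \<in> Obj M \<Longrightarrow> rcom (dr N)"
  by (simp add: rcom_def dr_dr er_dr)

text \<open>Coassociativity read as colinearity: the coaction is the unit of the adjunction between
  forgetting the coaction and - \<otimes> C.\<close>

lemma rmap_coaction: "rcom r \<Longrightarrow> rmap r (dr (src r)) r"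
  by (simp add: rmap_def rcom_def)

text \<open>The distributive law lifts C \<otimes> - to right comodules, which is the origin of the
  right coaction \<open>ph' Y \<bullet> LL r\<close>. Taking \<open>r = dr N\<close> gives C
  \<otimes> (N \<otimes> C), and \<open>r = DD\<close> gives C \<otimes> C with its two outer
  coactions.\<close>

lemma bcom_cofree:
  assumes r: "rcom r" and Y: "src r = Y"
  shows "bcom (dl Y) (ph' Y \<bullet> LL r)"
proof -
  have Yo: "Y \<in> Obj M" using rcomD(1)[OF r] Y by auto
  note [simp] = rcomD[OF r] Y Yo
  let ?r = "ph' Y \<bullet> LL r"
  have "lcom (dl Y)" by (simp add: lcom_def dl_dl el_dl)
  moreover have "rcom ?r"
  proof -
    have "er (C \<boxtimes> Y) \<bullet> ?r = LL (er Y) \<bullet> ph Y \<bullet> ph' Y \<bullet> LL r"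
      by (simp add: er_ph[symmetric])
    also have "\<dots> = LL (er Y \<bullet> r)" by (simp add: LL_cmp)
    also have "\<dots> = idn (C \<boxtimes> Y)" using rcomD(3)[OF r] by simp
    finally have 1: "er (C \<boxtimes> Y) \<bullet> ?r = idn (C \<boxtimes> Y)" .
    \<comment> \<open>\<open>dr_ph\<close> is stated with \<open>ph\<close>, so coassociativity is
      checked after composing with the invertible \<open>?p\<close>, which \<open>?p'\<close> then
      cancels.\<close>
    let ?p = "ph (Y \<boxtimes> C) \<bullet> RR (ph Y)"
    have "?p \<bullet> RR ?r \<bullet> ?r = ph (Y \<boxtimes> C) \<bullet> RR (ph Y \<bullet> ph' Y \<bullet> LL r) \<bullet> ph' Y \<bullet> LL r"
      by (simp add: RR_cmp del: ph_cancel)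
    also have "\<dots> = ph (Y \<boxtimes> C) \<bullet> RR (LL r) \<bullet> ph' Y \<bullet> LL r" by simp
    also have "\<dots> = LL (RR r) \<bullet> LL r"
      by (simp add: cmp_extend[OF ph_nat[OF rcomD(1)[OF r]]])
    also have "\<dots> = LL (dr Y) \<bullet> LL r"
      using r by (simp add: LL_cmp[symmetric] rcom_def)
    also have "\<dots> = (LL (dr Y) \<bullet> ph Y) \<bullet> ?r" by simp
    also have "\<dots> = ?p \<bullet> dr (C \<boxtimes> Y) \<bullet> ?r" by (simp add: dr_ph)
    finally have eq: "?p \<bullet> RR ?r \<bullet> ?r = ?p \<bullet> dr (C \<boxtimes> Y) \<bullet> ?r" .
    let ?p' = "RR (ph' Y) \<bullet> ph' (Y \<boxtimes> C)"
    have "RR (ph' Y) \<bullet> RR (ph Y) = idn (((C \<boxtimes> Y) \<boxtimes> C) \<boxtimes> C)" by (simp add: RR_cmp[symmetric])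
    from cmp_extend[OF this] have c: "?p' \<bullet> ?p \<bullet> f = f"
      if "arr f" "tgt f = ((C \<boxtimes> Y) \<boxtimes> C) \<boxtimes> C" for f
      using that by simp
    have "dr (C \<boxtimes> Y) \<bullet> ?r = ?p' \<bullet> ?p \<bullet> dr (C \<boxtimes> Y) \<bullet> ?r" by (rule c[symmetric]) simp_all
    also have "\<dots> = ?p' \<bullet> ?p \<bullet> RR ?r \<bullet> ?r" by (simp only: eq)
    also have "\<dots> = RR ?r \<bullet> ?r" by (rule c) simp_all
    finally show ?thesis using 1 by (simp add: rcom_def)
  qed
  moreover have "ph (C \<boxtimes> Y) \<bullet> RR (dl Y) \<bullet> ?r = LL ?r \<bullet> dl Y"
  proof -
    have "LL (ph' Y) \<bullet> LL (ph Y) = idn (C \<boxtimes> (C \<boxtimes> Y) \<boxtimes> C)" by (simp add: LL_cmp[symmetric])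
    note c = cmp_extend[OF this]
    have "ph (C \<boxtimes> Y) \<bullet> RR (dl Y) \<bullet> ?r = LL (ph' Y) \<bullet> (LL (ph Y) \<bullet> ph (C \<boxtimes> Y) \<bullet> RR (dl Y)) \<bullet> ?r"
      by (simp add: c)
    also have "\<dots> = LL (ph' Y) \<bullet> (dl (Y \<boxtimes> C) \<bullet> ph Y) \<bullet> ph' Y \<bullet> LL r"
      by (simp only: dl_ph Yo)
    also have "\<dots> = LL (ph' Y) \<bullet> (dl (Y \<boxtimes> C) \<bullet> LL r)" by simp
    also have "\<dots> = LL (ph' Y) \<bullet> (LL (LL r) \<bullet> dl Y)"
      by (subst dl_nat[of r]) simp_all
    also have "\<dots> = LL ?r \<bullet> dl Y" by (simp add: LL_cmp)
    finally show ?thesis .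
  qed
  ultimately show ?thesis by (simp add: bcom_def)
qed

lemma bmap_cofree:
  assumes "rcom r" "rcom r'" "rmap r r' g" "src r = X" "src r' = Y"
  shows "bmap (dl X) (ph' X \<bullet> LL r) (dl Y) (ph' Y \<bullet> LL r') (LL g)"
proof -
  have g: "arr g" "src g = X" "tgt g = Y" "r' \<bullet> g = RR g \<bullet> r"
    using assms by (auto simp: rmap_def)
  have ob: "X \<in> Obj M" "Y \<in> Obj M" using g by auto
  note [simp] = rcomD[OF assms(1)] rcomD[OF assms(2)] assms(4,5) ob g(1-3)
  have "(ph' Y \<bullet> LL r') \<bullet> LL g = ph' Y \<bullet> LL (RR g) \<bullet> LL r"
    by (simp add: LL_cmp[symmetric] g(4))
  also have "\<dots> = RR (LL g) \<bullet> ph' X \<bullet> LL r"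
    by (simp add: cmp_extend[OF ph'_nat[OF g(1-3)]])
  finally have "rmap (ph' X \<bullet> LL r) (ph' Y \<bullet> LL r') (LL g)"
    by (simp add: rmap_def)
  moreover have "lmap (dl X) (dl Y) (LL g)" by (simp add: lmap_def dl_nat)
  ultimately show ?thesis by (simp add: bmap_def)
qed

text \<open>Unit of the adjunction between forgetting the left coaction and C \<otimes> -. Left
  colinearity is coassociativity of \<open>l\<close>; right colinearity is the compatibility of the
  two coactions.\<close>

lemma bmap_left_coaction:
  assumes "bcom l r" "src l = X"
  shows "bmap l r (dl X) (ph' X \<bullet> LL r) l"
proof -
  have b: "lcom l" "rcom r" "src r = X" "LL r \<bullet> l = ph X \<bullet> RR l \<bullet> r" and X: "X \<in> Obj M"
    using assms lcomD(1)[of l] by (auto simp: bcom_def)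
  note [simp] = lcomD[OF b(1)] rcomD[OF b(2)] assms(2) b(3) X
  have "(ph' X \<bullet> LL r) \<bullet> l = RR l \<bullet> r" by (simp add: b(4))
  then have "rmap r (ph' X \<bullet> LL r) l" by (simp add: rmap_def)
  moreover have "lmap l (dl X) l" using b(1) by (simp add: lmap_def lcom_def)
  ultimately show ?thesis by (simp add: bmap_def)
qed

text \<open>Counit of that adjunction: it consumes the left factor, and \<open>el_ph\<close> says
  that this does not disturb the right coaction.\<close>

lemma rmap_el:
  assumes "rcom r" "src r = Y"
  shows "rmap (ph' Y \<bullet> LL r) r (el Y)"
proof -
  have Y: "Y \<in> Obj M" using rcomD(1)[OF assms(1)] assms(2) by auto
  note [simp] = rcomD[OF assms(1)] assms(2) Y
  have "RR (el Y) \<bullet> ph' Y \<bullet> LL r = el (Y \<boxtimes> C) \<bullet> LL r"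
    by (simp add: el_ph[symmetric])
  also have "\<dots> = r \<bullet> el Y" by (rule el_nat) simp_all
  finally show ?thesis by (simp add: rmap_def)
qed

text \<open>Relative injectivity among right comodules. The retraction \<open>s\<close> of
  \<open>j\<close> is an arbitrary arrow of the underlying category, not a comodule map.\<close>

definition rext :: "('o, 'm) arrow \<Rightarrow> bool" where
  "rext r0 \<longleftrightarrow> rcom r0 \<and> (\<forall>r r' j s f. rcom r \<longrightarrow> rcom r' \<longrightarrow> rmap r r' j \<longrightarrow> arr s \<longrightarrow>
    src s = src r' \<longrightarrow> tgt s = src r \<longrightarrow> s \<bullet> j = idn (src r) \<longrightarrow> rmap r r0 f \<longrightarrow>
    (\<exists>g. rmap r' r0 g \<and> g \<bullet> j = f))"

lemma rext_dr:
  assumes N: "N \<in> Obj M"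
  shows "rext (dr N)"
  unfolding rext_def
proof (intro conjI allI impI)
  show "rcom (dr N)" using rcom_dr[OF N] .
  fix r r' j s f
  assume r: "rcom r" and r': "rcom r'" and j: "rmap r r' j" and s: "arr s" "src s = src r'" "tgt s = src r"
    and sj: "s \<bullet> j = idn (src r)" and f: "rmap r (dr N) f"
  have j': "arr j" "src j = src r" "tgt j = src r'" "r' \<bullet> j = RR j \<bullet> r"
    and f': "arr f" "src f = src r" "tgt f = N \<boxtimes> C" "dr N \<bullet> f = RR f \<bullet> r"
    using j f by (simp_all add: rmap_def)
  note [simp] = rcomD[OF r] rcomD[OF r'] N s j'(1-3) f'(1-3)
  \<comment> \<open>\<open>er N \<bullet> f\<close> is the transpose of \<open>f\<close> under the
    cofree adjunction; precomposing with \<open>s\<close> extends it along \<open>j\<close>, and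
    \<open>RR h \<bullet> r'\<close> transposes back.\<close>
  define h where "h = er N \<bullet> f \<bullet> s"
  have h [simp]: "arr h" "src h = src r'" "tgt h = N" by (simp_all add: h_def)
  have "dr N \<bullet> RR h \<bullet> r' = RR (RR h) \<bullet> dr (src r') \<bullet> r'"
    by (simp add: cmp_extend[OF dr_nat[OF h]])
  also have "\<dots> = RR (RR h \<bullet> r') \<bullet> r'" using r' by (simp add: rcom_def RR_cmp)
  finally have "rmap r' (dr N) (RR h \<bullet> r')" by (simp add: rmap_def)
  moreover have "(RR h \<bullet> r') \<bullet> j = f"
  proof -
    have "(RR h \<bullet> r') \<bullet> j = RR (h \<bullet> j) \<bullet> r" by (simp add: j'(4) RR_cmp)
    also have "h \<bullet> j = er N \<bullet> f" by (simp add: h_def sj)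
    also have "RR (er N \<bullet> f) \<bullet> r = (RR (er N) \<bullet> dr N) \<bullet> f" by (simp add: RR_cmp f'(4))
    also have "\<dots> = f" by (simp only: RR_er_dr N idn_cmp f')
    finally show ?thesis .
  qed
  ultimately show "\<exists>g. rmap r' (dr N) g \<and> g \<bullet> j = f" by blast
qed

lemma rext_retract:
  assumes r1: "rext r1" and r0: "rcom r0" and i: "rmap r0 r1 i" and p: "rmap r1 r0 p"
    and pi: "p \<bullet> i = idn (src r0)"
  shows "rext r0"
  unfolding rext_def
proof (intro conjI allI impI)
  show "rcom r0" by fact
  have r1c: "rcom r1" using r1 by (simp add: rext_def)
  fix r r' j s f
  assume *: "rcom r" "rcom r'" "rmap r r' j" "arr s" "src s = src r'" "tgt s = src r"
    "s \<bullet> j = idn (src r)" and f: "rmap r r0 f"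
  obtain g where g: "rmap r' r1 g" "g \<bullet> j = i \<bullet> f"
    using r1 * rmap_cmp[OF *(1) r0 r1c f i] unfolding rext_def by blast
  have "(p \<bullet> g) \<bullet> j = f"
    using g * f i p pi cmp_extend[OF pi] rcomD(1)[OF r0] by (simp add: rmap_def)
  then show "\<exists>g. rmap r' r0 g \<and> g \<bullet> j = f" using rmap_cmp[OF *(2) r1c r0 g(1) p] by blast
qed

lemma bcom_DD: "bcom DD DD"
proof -
  have "lcom DD" using DD_coassoc EE_counit by (simp add: lcom_def dl_def el_def LL_def)
  moreover have "rcom DD"
    using EE_counit by (simp add: rcom_def dr_def er_def RR_def DD_coassoc[symmetric])
  ultimately show ?thesis using DD_coassoc by (simp add: bcom_def ph_def LL_def RR_def)
qed

lemma dr_C: "dr C = ph' C \<bullet> LL DD"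
  by (simp add: dr_def ph'_def LL_def)

text \<open>\<open>C\<close> is a retract of the cofree right comodule on itself: \<open>DD\<close>
  is the inclusion, and \<open>el C\<close> is a right colinear retraction because it consumes the
  left factor.\<close>

lemma rext_DD: "rext DD"
proof (rule rext_retract[OF rext_dr])
  have r: "rcom DD" using bcom_DD by (simp add: bcom_def)
  then show "rcom DD" .
  show "rmap DD (dr C) DD" using rmap_coaction[OF r] by simp
  show "rmap (dr C) DD (el C)" using rmap_el[OF r] by (simp add: dr_C)
  show "el C \<bullet> DD = idn (src DD)" using bcom_DD by (simp add: bcom_def lcom_def)
qed simp

text \<open>A bicomodule map \<open>f\<close> into C \<otimes> Y is transposed to the right comodule
  map \<open>el Y \<bullet> f\<close> into \<open>Y\<close>; \<open>rext\<close> extends it to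
  \<open>h\<close>, and \<open>LL h \<bullet> l'\<close> transposes back. \<open>LL_el_dl\<close> is
  the triangle identity that recovers \<open>f\<close>.\<close>

lemma cofree_extension:
  assumes r0: "rext r0" "src r0 = Y"
    and b: "bcom l r" "bcom l' r'" "bmap l r l' r' j"
    and s: "arr s" "src s = src l'" "tgt s = src l" "s \<bullet> j = idn (src l)"
    and f: "bmap l r (dl Y) (ph' Y \<bullet> LL r0) f"
  obtains g where "bmap l' r' (dl Y) (ph' Y \<bullet> LL r0) g" "g \<bullet> j = f"
proof -
  have r0c: "rcom r0" using r0 by (simp add: rext_def)
  note bY = bcom_cofree[OF r0c r0(2)]
  have bc: "lcom l" "rcom r" "src r = src l" "lcom l'" "rcom r'" "src r' = src l'"
    "rcom (ph' Y \<bullet> LL r0)" using b bY by (simp_all add: bcom_def)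
  have Y: "Y \<in> Obj M" using rcomD(1)[OF r0c] r0(2) by auto
  have j: "arr j" "src j = src l" "tgt j = src l'" "l' \<bullet> j = LL j \<bullet> l" "rmap r r' j"
    using b(3) by (simp_all add: bmap_def lmap_def)
  have f': "arr f" "src f = src l" "tgt f = C \<boxtimes> Y" "dl Y \<bullet> f = LL f \<bullet> l" "rmap r (ph' Y \<bullet> LL r0) f"
    using f by (simp_all add: bmap_def lmap_def)
  have "rmap r r0 (el Y \<bullet> f)"
    using rmap_cmp[OF bc(2,7) r0c f'(5) rmap_el[OF r0c r0(2)]] .
  then obtain h where h: "rmap r' r0 h" "h \<bullet> j = el Y \<bullet> f"
    using r0(1) bc j(5) s unfolding rext_def by metis
  have h': "arr h" "src h = src l'" "tgt h = Y" using h(1) bc r0(2) by (simp_all add: rmap_def)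
  have "bmap l' r' (dl Y) (ph' Y \<bullet> LL r0) (LL h \<bullet> l')"
    using bmap_cmp[OF b(2) bcom_cofree[OF bc(5,6)] bY bmap_left_coaction[OF b(2) refl]
        bmap_cofree[OF bc(5) r0c h(1) bc(6) r0(2)]] .
  moreover have "(LL h \<bullet> l') \<bullet> j = f"
  proof -
    note [simp] = lcomD[OF bc(1)] lcomD[OF bc(4)] j(1-3) f'(1-3) h' Y
    have "(LL h \<bullet> l') \<bullet> j = LL (h \<bullet> j) \<bullet> l" by (simp add: j(4) LL_cmp)
    also have "\<dots> = (LL (el Y) \<bullet> dl Y) \<bullet> f" by (simp add: h(2) LL_cmp f'(4))
    also have "\<dots> = f" by (simp only: LL_el_dl Y idn_cmp f')
    finally show ?thesis .
  qed
  ultimately show thesis using that by blast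
qed

section \<open>Descent of coactions along split epimorphisms\<close>

lemma split_epi_cancel:
  assumes "f \<bullet> p = g \<bullet> p" "p \<bullet> t = idn (tgt p)" "arr f" "arr g" "arr p" "arr t" "tgt t = src p"
    "src f = tgt p" "src g = tgt p"
  shows "f = g"
proof -
  have "f = (f \<bullet> p) \<bullet> t" "g = (g \<bullet> p) \<bullet> t" using assms(2-) by simp_all
  then show ?thesis using assms(1) by simp
qed

text \<open>Each axiom is checked after composing with \<open>p\<close>, where naturality of the
  comonad structures and of \<open>ph\<close> turns it into the axiom for \<open>l\<close> and
  \<open>r\<close>. The section \<open>t\<close>, which need not be colinear, makes \<open>p\<close>
  cancellable.\<close>

lemma bcom_quotient:
  assumes b: "bcom l r"
    and p: "arr p" "src p = src l" and t: "arr t" "tgt t = src l" "p \<bullet> t = idn (tgt p)"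
    and l': "arr l'" "src l' = tgt p" "tgt l' = C \<boxtimes> tgt p" "l' \<bullet> p = LL p \<bullet> l"
    and r': "arr r'" "src r' = tgt p" "tgt r' = tgt p \<boxtimes> C" "r' \<bullet> p = RR p \<bullet> r"
  shows "bcom l' r'"
proof -
  have bc: "lcom l" "rcom r" "src r = src l" using b by (simp_all add: bcom_def)
  let ?P = "tgt p"
  have P: "?P \<in> Obj M" "src l \<in> Obj M" using arr_obj[OF p(1)] p(2) by auto
  have st: "src t = ?P" using arg_cong[OF t(3), of src] by simp
  note [simp] = lcomD[OF bc(1)] rcomD[OF bc(2)] bc(3) p t(1,2) st l'(1-3) r'(1-3) P
  have cancel: "f = g" if "f \<bullet> p = g \<bullet> p" "arr f" "arr g" "src f = ?P" "src g = ?P" for f g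
    using split_epi_cancel[OF that(1) t(3)] that by simp
  have nat: "dl ?P \<bullet> LL p = LL (LL p) \<bullet> dl (src l)" "el ?P \<bullet> LL p = p \<bullet> el (src l)"
     "dr ?P \<bullet> RR p = RR (RR p) \<bullet> dr (src l)" "er ?P \<bullet> RR p = p \<bullet> er (src l)"
     "ph ?P \<bullet> RR (LL p) = LL (RR p) \<bullet> ph (src l)"
    by (simp_all add: dl_nat el_nat dr_nat er_nat ph_nat)
  have "dl ?P \<bullet> l' = LL l' \<bullet> l'"
  proof (rule cancel)
    have "(dl ?P \<bullet> l') \<bullet> p = LL (LL p) \<bullet> dl (src l) \<bullet> l"
      by (simp add: l'(4) cmp_extend[OF nat(1)])
    also have "\<dots> = LL (l' \<bullet> p) \<bullet> l" using bc(1) by (simp add: lcom_def l'(4) LL_cmp)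
    also have "\<dots> = (LL l' \<bullet> l') \<bullet> p" by (simp add: LL_cmp l'(4)[symmetric])
    finally show "(dl ?P \<bullet> l') \<bullet> p = (LL l' \<bullet> l') \<bullet> p" .
  qed simp_all
  moreover have "el ?P \<bullet> l' = idn ?P"
    by (rule cancel) (simp_all add: l'(4) cmp_extend[OF nat(2)])
  moreover have "dr ?P \<bullet> r' = RR r' \<bullet> r'"
  proof (rule cancel)
    have "(dr ?P \<bullet> r') \<bullet> p = RR (RR p) \<bullet> dr (src l) \<bullet> r"
      by (simp add: r'(4) cmp_extend[OF nat(3)])
    also have "\<dots> = RR (r' \<bullet> p) \<bullet> r" using bc(2) by (simp add: rcom_def r'(4) RR_cmp)
    also have "\<dots> = (RR r' \<bullet> r') \<bullet> p" by (simp add: RR_cmp r'(4)[symmetric])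
    finally show "(dr ?P \<bullet> r') \<bullet> p = (RR r' \<bullet> r') \<bullet> p" .
  qed simp_all
  moreover have "er ?P \<bullet> r' = idn ?P"
    by (rule cancel) (use rcomD(3)[OF bc(2)] in \<open>simp_all add: r'(4) cmp_extend[OF nat(4)]\<close>)
  moreover have "ph ?P \<bullet> RR l' \<bullet> r' = LL r' \<bullet> l'"
  proof (rule cancel)
    have "(ph ?P \<bullet> RR l' \<bullet> r') \<bullet> p = ph ?P \<bullet> RR (l' \<bullet> p) \<bullet> r" by (simp add: r'(4) RR_cmp)
    also have "\<dots> = LL (RR p) \<bullet> ph (src l) \<bullet> RR l \<bullet> r"
      by (simp add: l'(4) RR_cmp cmp_extend[OF nat(5)])
    also have "\<dots> = LL (r' \<bullet> p) \<bullet> l" using b by (simp add: bcom_def r'(4) LL_cmp)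
    also have "\<dots> = (LL r' \<bullet> l') \<bullet> p" by (simp add: LL_cmp l'(4))
    finally show "(ph ?P \<bullet> RR l' \<bullet> r') \<bullet> p = (LL r' \<bullet> l') \<bullet> p" .
  qed simp_all
  ultimately show ?thesis by (simp add: bcom_def lcom_def rcom_def)
qed

end

section \<open>The category of bicomodules\<close>

context preadditive_category
begin

text \<open>The set is the equalizer of two group homomorphisms, composition with \<open>l'\<close>
  and \<open>f\<close> mapped to \<open>F f \<cdot> l\<close>. \<open>F\<close> stands for tensoring
  with \<open>C\<close> on either side.\<close>

lemma intertwiners_subgroup:
  assumes ob: "X \<in> Obj A" "Y \<in> Obj A" "X' \<in> Obj A" "Y' \<in> Obj A"
    and l: "l \<in> Hom A X X'" "l' \<in> Hom A Y Y'"
    and F: "\<And>f. f \<in> Hom A X Y \<Longrightarrow> F f \<in> Hom A X' Y'"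
    and F_add: "\<And>f g. \<lbrakk>f \<in> Hom A X Y; g \<in> Hom A X Y\<rbrakk> \<Longrightarrow> F (f \<boxplus> g) = F f \<boxplus> F g"
  shows "subgroup {f \<in> Hom A X Y. l' \<cdot> f = F f \<cdot> l} (hom_group A X Y)"
proof -
  interpret G: comm_group "hom_group A X Y" using hom_comm_group ob by blast
  interpret H: comm_group "hom_group A X Y'" using hom_comm_group ob by blast
  have 1: "(\<lambda>f. l' \<cdot> f) \<in> hom (hom_group A X Y) (hom_group A X Y')"
    using comp_hom[OF ob(1,2,4) _ l(2)] comp_add[OF ob(1,2,4) _ _ l(2)] by (simp add: hom_def)
  have 2: "(\<lambda>f. F f \<cdot> l) \<in> hom (hom_group A X Y) (hom_group A X Y')"
    using comp_hom[OF ob(1,3,4) l(1) F] add_comp[OF ob(1,3,4) F F l(1)] F_add by (simp add: hom_def)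
  interpret h1: group_hom "hom_group A X Y" "hom_group A X Y'" "\<lambda>f. l' \<cdot> f"
    by (unfold_locales) (rule 1)
  interpret h2: group_hom "hom_group A X Y" "hom_group A X Y'" "\<lambda>f. F f \<cdot> l"
    by (unfold_locales) (rule 2)
  show ?thesis
  proof (rule G.subgroupI)
    show "{f \<in> Hom A X Y. l' \<cdot> f = F f \<cdot> l} \<noteq> {}"
      using h1.hom_one h2.hom_one G.one_closed by auto
  next
    fix a assume "a \<in> {f \<in> Hom A X Y. l' \<cdot> f = F f \<cdot> l}"
    then have a: "a \<in> carrier (hom_group A X Y)" "l' \<cdot> a = F a \<cdot> l" by auto
    show "inv\<^bsub>hom_group A X Y\<^esub> a \<in> {f \<in> Hom A X Y. l' \<cdot> f = F f \<cdot> l}"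
      using h1.hom_inv[OF a(1)] h2.hom_inv[OF a(1)] G.inv_closed[OF a(1)] a(2) by simp
  next
    fix a b assume "a \<in> {f \<in> Hom A X Y. l' \<cdot> f = F f \<cdot> l}" "b \<in> {f \<in> Hom A X Y. l' \<cdot> f = F f \<cdot> l}"
    then have ab: "a \<in> carrier (hom_group A X Y)" "l' \<cdot> a = F a \<cdot> l"
      "b \<in> carrier (hom_group A X Y)" "l' \<cdot> b = F b \<cdot> l" by auto
    show "a \<otimes>\<^bsub>hom_group A X Y\<^esub> b \<in> {f \<in> Hom A X Y. l' \<cdot> f = F f \<cdot> l}"
      using h1.hom_mult[OF ab(1,3)] h2.hom_mult[OF ab(1,3)] G.m_closed[OF ab(1,3)] ab(2,4) by simp
  qed auto
qed

end

locale abelian_coalgebra = abelian_monoidal_category M + coalgebra M C \<Delta> \<epsilon>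
  for M :: "('o, 'm, 'x) monoidal_scheme" (structure) and C :: 'o and \<Delta> \<epsilon> :: 'm
begin

abbreviation BC :: "('o \<times> 'm \<times> 'm, 'm) preadditive" where
  "BC \<equiv> bicomodule_category M C \<Delta> \<epsilon>"

lemma BC_simps [simp]:
  "comp BC = comp M" "add BC = add M" "ident BC (X, l, r) = ident M X"
  "zero_mor BC (X, l, r) (Y, l', r') = zero_mor M X Y"
  by (simp_all add: bicomodule_category_def)

definition bob :: "('o, 'm) arrow \<Rightarrow> ('o, 'm) arrow \<Rightarrow> 'o \<times> 'm \<times> 'm" where
  "bob l r = (src l, mor l, mor r)"

lemma bob_simps [simp]:
  "ident BC (bob l r) = ident M (src l)" "fst (bob l r) = src l"
  "zero_mor BC (bob l r) (bob l' r') = zero_mor M (src l) (src l')"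
  by (simp_all add: bob_def)

lemma bicomodule_iff:
  "bicomodule M C \<Delta> \<epsilon> X l r \<longleftrightarrow> bcom (Arrow X l (C \<boxtimes> X)) (Arrow X r (X \<boxtimes> C))"
proof (cases "X \<in> Obj M \<and> l \<in> Hom M X (C \<boxtimes> X) \<and> r \<in> Hom M X (X \<boxtimes> C)")
  case False
  then show ?thesis
    by (auto simp: bicomodule_def left_comodule_def right_comodule_def bcom_def lcom_def rcom_def arr_def
        simp del: arr_obj)
next
  case True
  define L where "L = Arrow X l (C \<boxtimes> X)"
  define R where "R = Arrow X r (X \<boxtimes> C)"
  have [simp]: "arr L" "src L = X" "tgt L = C \<boxtimes> X" "mor L = l"
    "arr R" "src R = X" "tgt R = X \<boxtimes> C" "mor R = r" "X \<in> Obj M"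
    using True by (simp_all add: L_def R_def arr_def del: arr_obj)
  have 1: "left_comodule M C \<Delta> \<epsilon> X l \<longleftrightarrow> lcom L"
  proof -
    have "dl X \<bullet> L = asc C C X \<bullet> (DD \<odot> idn X) \<bullet> L" "el X \<bullet> L = lun X \<bullet> (EE \<odot> idn X) \<bullet> L"
      by (simp_all add: dl_def el_def)
    then show ?thesis using True
      by (simp add: left_comodule_def lcom_def arrow_eq_iff)
  qed
  have 2: "right_comodule M C \<Delta> \<epsilon> X r \<longleftrightarrow> rcom R"
  proof -
    \<comment> \<open>The associator is moved across the equation: \<open>right_comodule\<close>
      composes with it on one side, while \<open>dr\<close> contains its inverse on the
      other.\<close>
    have "dr X \<bullet> R = RR R \<bullet> R \<longleftrightarrow> asc X C C \<bullet> RR R \<bullet> R = (idn X \<odot> DD) \<bullet> R" (is "?a \<longleftrightarrow> ?b")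
    proof
      assume ?a
      then have "asc X C C \<bullet> RR R \<bullet> R = asc X C C \<bullet> dr X \<bullet> R" by simp
      also have "\<dots> = (idn X \<odot> DD) \<bullet> R" by (simp add: dr_def)
      finally show ?b .
    next
      assume ?b
      then have "asc' X C C \<bullet> (asc X C C \<bullet> RR R \<bullet> R) = dr X \<bullet> R" by (simp add: dr_def)
      then show ?a by simp
    qed
    moreover have "er X \<bullet> R = run X \<bullet> (idn X \<odot> EE) \<bullet> R" by (simp add: er_def)
    ultimately show ?thesis using True
      by (simp add: right_comodule_def rcom_def arrow_eq_iff)
  qed
  have "associator M C X C \<cdot> (l \<star> ident M C) \<cdot> r = (ident M C \<star> r) \<cdot> l \<longleftrightarrow>
      ph X \<bullet> RR L \<bullet> R = LL R \<bullet> L"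
    by (simp add: arrow_eq_iff ph_def)
  then show ?thesis
    unfolding bicomodule_def bcom_def L_def[symmetric] R_def[symmetric] 1 2 by simp
qed

lemma bcom_arrow_eq:
  assumes "bcom l r"
  shows "Arrow (src l) (mor l) (C \<boxtimes> src l) = l" "Arrow (src l) (mor r) (src l \<boxtimes> C) = r"
  using assms lcomD(2)[of l] rcomD(2)[of r] by (auto simp: bcom_def arrow_eq_iff)

lemma bob_obj_iff: "B \<in> Obj BC \<longleftrightarrow> (\<exists>l r. B = bob l r \<and> bcom l r)"
proof
  assume "B \<in> Obj BC"
  then obtain X l r where "B = (X, l, r)" "bicomodule M C \<Delta> \<epsilon> X l r"
    by (auto simp: bicomodule_category_def)
  then show "\<exists>l r. B = bob l r \<and> bcom l r"
    unfolding bicomodule_iff bob_def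
    by (intro exI[of _ "Arrow X l (C \<boxtimes> X)"] exI[of _ "Arrow X r (X \<boxtimes> C)"]) simp
next
  assume "\<exists>l r. B = bob l r \<and> bcom l r"
  then obtain l r where "B = bob l r" "bcom l r" by blast
  then show "B \<in> Obj BC"
    using bcom_arrow_eq[of l r] by (simp add: bicomodule_category_def bob_def bicomodule_iff)
qed

lemma bob_obj [simp]: "bcom l r \<Longrightarrow> bob l r \<in> Obj BC"
  using bob_obj_iff by blast

lemma bob_hom_iff:
  assumes "bcom l r" "bcom l' r'"
  shows "f \<in> Hom BC (bob l r) (bob l' r') \<longleftrightarrow> bmap l r l' r' (Arrow (src l) f (src l'))"
proof -
  have "lcom l" "lcom l'" "rcom r" "rcom r'" "src r = src l" "src r' = src l'"
    using assms by (simp_all add: bcom_def)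
  then have "src l \<in> Obj M" "src l' \<in> Obj M" "tgt l = C \<boxtimes> src l" "tgt r = src l \<boxtimes> C"
     "tgt l' = C \<boxtimes> src l'" "tgt r' = src l' \<boxtimes> C" "src r = src l" "src r' = src l'"
    by (simp_all add: lcomD rcomD)
  then show ?thesis
    by (auto simp: bicomodule_category_def bicomodule_hom_def bob_def bmap_def lmap_def rmap_def
        arr_def arrow_eq_iff simp del: arr_obj)
qed

lemma bob_homI: "\<lbrakk>bcom l r; bcom l' r'; bmap l r l' r' f\<rbrakk> \<Longrightarrow> mor f \<in> Hom BC (bob l r) (bob l' r')"
proof -
  assume *: "bcom l r" "bcom l' r'" "bmap l r l' r' f"
  have "Arrow (src l) (mor f) (src l') = f"
    using *(3) by (simp add: bmap_def lmap_def arrow_eq_iff)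
  then show ?thesis using * by (simp add: bob_hom_iff)
qed

lemma bob_homE:
  assumes "bcom l r" "bcom l' r'" "f \<in> Hom BC (bob l r) (bob l' r')"
  obtains g where "f = mor g" "bmap l r l' r' g"
  using assms bob_hom_iff[OF assms(1,2)] by (metis arrow.sel(2))

lemma bmapD:
  assumes "bmap l r l' r' f"
  shows "arr f" "src f = src l" "tgt f = src l'" "l' \<bullet> f = LL f \<bullet> l" "r' \<bullet> f = RR f \<bullet> r"
  using assms by (simp_all add: bmap_def lmap_def rmap_def)

lemma bcomD:
  assumes "bcom l r"
  shows "arr l" "arr r" "tgt l = C \<boxtimes> src l" "tgt r = src l \<boxtimes> C" "src r = src l" "src l \<in> Obj M"
    "lcom l" "rcom r"
  using assms lcomD[of l] rcomD[of r] by (auto simp: bcom_def)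

section \<open>Bicomodules as a preadditive category with zero object\<close>

lemma BC_hom_subset: "f \<in> Hom BC B B' \<Longrightarrow> f \<in> Hom M (fst B) (fst B')"
  by (cases B; cases B') (simp add: bicomodule_category_def bicomodule_hom_def)

lemma BC_obj: "B \<in> Obj BC \<Longrightarrow> fst B \<in> Obj M"
  using bcomD(6) by (auto simp: bob_obj_iff)

lemma BC_ident: "ident BC B = ident M (fst B)"
  by (cases B) simp

lemma BC_zero: "zero_mor BC B B' = zero_mor M (fst B) (fst B')"
  by (cases B; cases B') simp

lemma BC_comp_hom:
  assumes "X \<in> Obj BC" "Y \<in> Obj BC" "Z \<in> Obj BC" "f \<in> Hom BC X Y" "g \<in> Hom BC Y Z"
  shows "g \<cdot> f \<in> Hom BC X Z"
proof -
  obtain l r l' r' l'' r'' where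
    b: "X = bob l r" "bcom l r" "Y = bob l' r'" "bcom l' r'" "Z = bob l'' r''" "bcom l'' r''"
    using assms(1-3) by (auto simp: bob_obj_iff)
  obtain F where F: "f = mor F" "bmap l r l' r' F" using bob_homE assms(4) b by metis
  obtain G where G: "g = mor G" "bmap l' r' l'' r'' G" using bob_homE assms(5) b by metis
  show ?thesis
    using bob_homI[OF b(2,6) bmap_cmp[OF b(2,4,6) F(2) G(2)]] b F G by simp
qed

lemma BC_hom_subgroup:
  assumes "X \<in> Obj BC" "Y \<in> Obj BC"
  shows "subgroup (Hom BC X Y) (hom_group M (fst X) (fst Y))"
proof -
  obtain l r l' r' where b: "X = bob l r" "bcom l r" "Y = bob l' r'" "bcom l' r'"
    using assms by (auto simp: bob_obj_iff)
  note ob = bcomD(6)[OF b(2)] bcomD(6)[OF b(4)]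
  have c: "C \<boxtimes> src l \<in> Obj M" "C \<boxtimes> src l' \<in> Obj M" "src l \<boxtimes> C \<in> Obj M" "src l' \<boxtimes> C \<in> Obj M"
    using ob by simp_all
  have h: "mor l \<in> Hom M (src l) (C \<boxtimes> src l)" "mor l' \<in> Hom M (src l') (C \<boxtimes> src l')"
     "mor r \<in> Hom M (src l) (src l \<boxtimes> C)" "mor r' \<in> Hom M (src l') (src l' \<boxtimes> C)"
    using bcomD[OF b(2)] bcomD[OF b(4)] unfolding arr_def by auto
  have "subgroup {f \<in> Hom M (src l) (src l'). mor l' \<cdot> f = (ident M C \<star> f) \<cdot> mor l}
      (hom_group M (src l) (src l'))"
    using ob by (intro intertwiners_subgroup[OF ob c(1,2) h(1,2)] tensor_hom tensor_add_right)
      (auto intro: ident_hom)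
  moreover have "subgroup {f \<in> Hom M (src l) (src l'). mor r' \<cdot> f = (f \<star> ident M C) \<cdot> mor r}
      (hom_group M (src l) (src l'))"
    using ob by (intro intertwiners_subgroup[OF ob c(3,4) h(3,4)] tensor_hom tensor_add_left)
      (auto intro: ident_hom)
  ultimately have "subgroup ({f \<in> Hom M (src l) (src l'). mor l' \<cdot> f = (ident M C \<star> f) \<cdot> mor l} \<inter>
      {f \<in> Hom M (src l) (src l'). mor r' \<cdot> f = (f \<star> ident M C) \<cdot> mor r})
      (hom_group M (src l) (src l'))"
    using group.subgroups_Inter_pair[OF comm_group.axioms(2)[OF hom_comm_group[OF ob]]] by blast
  moreover have "Hom BC X Y = {f \<in> Hom M (src l) (src l'). mor l' \<cdot> f = (ident M C \<star> f) \<cdot> mor l} \<inter>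
      {f \<in> Hom M (src l) (src l'). mor r' \<cdot> f = (f \<star> ident M C) \<cdot> mor r}"
    by (auto simp: b bob_def bicomodule_category_def bicomodule_hom_def)
  ultimately show ?thesis using b by simp
qed

text \<open>Composition and addition are those of \<open>M\<close>, so the equations restrict from
  the larger hom-sets; the content is that bicomodule maps contain identities and are closed under
  composition and the group operations.\<close>

lemma bicomodule_preadditive: "preadditive_category BC"
proof (intro preadditive_category.intro category.intro preadditive_category_axioms.intro)
  fix X assume "X \<in> Obj BC"
  then obtain l r where b: "X = bob l r" "bcom l r" by (auto simp: bob_obj_iff)
  have "bmap l r l r (idn (src l))"
    using lmap_idn[OF bcomD(7)[OF b(2)]] rmap_idn[OF bcomD(8)[OF b(2)]] bcomD(5)[OF b(2)]
    by (simp add: bmap_def)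
  from bob_homI[OF b(2,2) this] show "ident BC X \<in> Hom BC X X" using b by simp
next
  fix X Y Z f g assume "X \<in> Obj BC" "Y \<in> Obj BC" "Z \<in> Obj BC" "f \<in> Hom BC X Y" "g \<in> Hom BC Y Z"
  then show "g \<cdot>\<^bsub>BC\<^esub> f \<in> Hom BC X Z" using BC_comp_hom by simp
next
  fix X Y f assume "X \<in> Obj BC" "Y \<in> Obj BC" "f \<in> Hom BC X Y"
  then show "f \<cdot>\<^bsub>BC\<^esub> ident BC X = f" "ident BC Y \<cdot>\<^bsub>BC\<^esub> f = f"
    using comp_ident[OF BC_obj BC_obj BC_hom_subset] ident_comp[OF BC_obj BC_obj BC_hom_subset]
    by (simp_all add: BC_ident)
next
  fix W X Y Z f g h
  assume "W \<in> Obj BC" "X \<in> Obj BC" "Y \<in> Obj BC" "Z \<in> Obj BC"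
    "f \<in> Hom BC W X" "g \<in> Hom BC X Y" "h \<in> Hom BC Y Z"
  then show "(h \<cdot>\<^bsub>BC\<^esub> g) \<cdot>\<^bsub>BC\<^esub> f = h \<cdot>\<^bsub>BC\<^esub> g \<cdot>\<^bsub>BC\<^esub> f"
    using comp_assoc[OF BC_obj BC_obj BC_obj BC_obj BC_hom_subset BC_hom_subset BC_hom_subset] by simp
next
  fix X Y assume ob: "X \<in> Obj BC" "Y \<in> Obj BC"
  have "hom_group BC X Y = (hom_group M (fst X) (fst Y))\<lparr>carrier := Hom BC X Y\<rparr>"
    by (simp add: hom_group_def BC_zero)
  then show "comm_group (hom_group BC X Y)"
    using comm_group.subgroup_comm_group[OF hom_comm_group BC_hom_subgroup[OF ob]] ob BC_obj by simp
next
  fix X Y Z f g h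
  assume "X \<in> Obj BC" "Y \<in> Obj BC" "Z \<in> Obj BC" "f \<in> Hom BC X Y" "g \<in> Hom BC X Y" "h \<in> Hom BC Y Z"
  then show "h \<cdot>\<^bsub>BC\<^esub> (f \<boxplus>\<^bsub>BC\<^esub> g) = (h \<cdot>\<^bsub>BC\<^esub> f) \<boxplus>\<^bsub>BC\<^esub> (h \<cdot>\<^bsub>BC\<^esub> g)"
    using comp_add[OF BC_obj BC_obj BC_obj BC_hom_subset BC_hom_subset BC_hom_subset] by simp
next
  fix X Y Z f g h
  assume "X \<in> Obj BC" "Y \<in> Obj BC" "Z \<in> Obj BC" "f \<in> Hom BC Y Z" "g \<in> Hom BC Y Z" "h \<in> Hom BC X Y"
  then show "(f \<boxplus>\<^bsub>BC\<^esub> g) \<cdot>\<^bsub>BC\<^esub> h = (f \<cdot>\<^bsub>BC\<^esub> h) \<boxplus>\<^bsub>BC\<^esub> (g \<cdot>\<^bsub>BC\<^esub> h)"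
    using add_comp[OF BC_obj BC_obj BC_obj BC_hom_subset BC_hom_subset BC_hom_subset] by simp
qed

lemma tensor_zero:
  assumes "X \<in> Obj M" "Y \<in> Obj M" "Z \<in> Obj M"
  shows "ident M X \<star> zero_mor M Y Z = zero_mor M (X \<boxtimes> Y) (X \<boxtimes> Z)"
    "zero_mor M Y Z \<star> ident M X = zero_mor M (Y \<boxtimes> X) (Z \<boxtimes> X)"
  using tensor_add_right[OF assms zero_hom zero_hom] tensor_add_left[OF assms zero_hom zero_hom] assms
  by (auto intro!: add_idem_imp_zero tensor_hom zero_hom ident_hom simp: zero_add zero_hom)

lemma bicomodule_zero_object: "\<exists>Z. is_zero_object BC Z"
proof -
  obtain Z where Z: "is_zero_object M Z" using ex_zero_object by blast
  have Zo: "Z \<in> Obj M" using Z by (simp add: is_zero_object_def)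
  have from_Z: "f = g" if "arr f" "arr g" "src f = Z" "src g = Z" "tgt f = tgt g" for f g
    using Z that unfolding is_zero_object_def arr_def arrow_eq_iff by auto
  have to_Z: "f = zero_mor M X Z" if "X \<in> Obj M" "f \<in> Hom M X Z" for X f
    using Z that zero_hom[OF that(1) Zo] unfolding is_zero_object_def by blast
  have idZ: "ident M Z = zero_mor M Z Z" using to_Z[OF Zo ident_hom[OF Zo]] .
  \<comment> \<open>Additivity makes the identities of \<open>C \<boxtimes> Z\<close> and
    \<open>Z \<boxtimes> C\<close> zero, so all arrows into them vanish; this is what makes arrows
    into \<open>Z\<close> colinear.\<close>
  have tensor_Z: "f = zero_mor M X W"
    if W: "W = C \<boxtimes> Z \<or> W = Z \<boxtimes> C" and f: "X \<in> Obj M" "f \<in> Hom M X W" for X W f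
  proof -
    have Wo: "W \<in> Obj M" using W Zo by auto
    have "ident M W = zero_mor M W W"
      using W tensor_zero[OF coalg_obj Zo Zo] tensor_ident[OF coalg_obj Zo] tensor_ident[OF Zo coalg_obj] idZ
      by auto
    then show ?thesis using ident_comp[OF f(1) Wo f(2)] zero_comp[OF f(1) Wo Wo f(2)] by simp
  qed
  define l where "l = Arrow Z (zero_mor M Z (C \<boxtimes> Z)) (C \<boxtimes> Z)"
  define r where "r = Arrow Z (zero_mor M Z (Z \<boxtimes> C)) (Z \<boxtimes> C)"
  have lr [simp]: "arr l" "src l = Z" "tgt l = C \<boxtimes> Z" "arr r" "src r = Z" "tgt r = Z \<boxtimes> C" "Z \<in> Obj M"
    using Zo zero_hom by (simp_all add: l_def r_def arr_def del: arr_obj)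
  have b: "bcom l r"
    unfolding bcom_def lcom_def rcom_def by (auto intro!: from_Z)
  have "\<exists>!f. f \<in> Hom BC (bob l r) B" "\<exists>!f. f \<in> Hom BC B (bob l r)" if B: "B \<in> Obj BC" for B
  proof -
    obtain l' r' where b': "B = bob l' r'" "bcom l' r'" using B by (auto simp: bob_obj_iff)
    note [simp] = bcomD[OF b'(2)]
    let ?i = "Arrow Z (zero_mor M Z (src l')) (src l')" and ?o = "Arrow (src l') (zero_mor M (src l') Z) Z"
    have "arr ?i" "arr ?o" using zero_hom by (simp_all add: arr_def del: arr_obj)
    then have i: "bmap l r l' r' ?i" unfolding bmap_def lmap_def rmap_def
      by (auto intro!: from_Z)
    have "f = g" if "arr f" "arr g" "src f = src g" "tgt f = tgt g" "tgt f = C \<boxtimes> Z \<or> tgt f = Z \<boxtimes> C" for f g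
    proof -
      have "mor f = zero_mor M (src f) (tgt f)" "mor g = zero_mor M (src g) (tgt g)"
        using that by (auto intro!: tensor_Z simp: arr_def simp del: arr_obj)
      then show ?thesis using that by (simp add: arrow_eq_iff)
    qed
    with \<open>arr ?o\<close> have o: "bmap l' r' l r ?o" unfolding bmap_def lmap_def rmap_def by simp
    show "\<exists>!f. f \<in> Hom BC (bob l r) B"
    proof (rule ex1I)
      show "mor ?i \<in> Hom BC (bob l r) B" using bob_homI[OF b b'(2) i] b' by simp
      show "f = mor ?i" if "f \<in> Hom BC (bob l r) B" for f
      proof -
        have "\<exists>!f. f \<in> Hom M Z (src l')" using Z by (simp add: is_zero_object_def)
        then show ?thesis using BC_hom_subset[OF that] zero_hom[OF Zo bcomD(6)[OF b'(2)]] b'(1) by auto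
      qed
    qed
    show "\<exists>!f. f \<in> Hom BC B (bob l r)"
    proof (rule ex1I)
      show "mor ?o \<in> Hom BC B (bob l r)" using bob_homI[OF b'(2) b o] b' by simp
      show "f = mor ?o" if "f \<in> Hom BC B (bob l r)" for f
        using BC_hom_subset[OF that] b'(1) by (auto intro: to_Z)
    qed
  qed
  then show ?thesis using bob_obj[OF b] unfolding is_zero_object_def by blast
qed

text \<open>The cokernel \<open>p\<close> of \<open>j\<close> in \<open>M\<close> has a section
  \<open>t\<close>; neither \<open>s\<close> nor \<open>t\<close> need be colinear. Splitness makes
  the factorizations explicit: \<open>h \<bullet> t\<close> through \<open>p\<close> and
  \<open>s \<bullet> h\<close> through \<open>j\<close>. They are then shown to be colinear, using
  that \<open>LL\<close> and \<open>RR\<close> preserve composites, identities and zero.\<close>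

lemma split_mono_bicomodule_exact:
  assumes b: "bcom l r" "bcom l' r'" and j: "bmap l r l' r' j"
    and s: "arr s" "src s = src l'" "tgt s = src l" "s \<bullet> j = idn (src l)"
  obtains P p where "is_cokernel BC (bob l r) (bob l' r') (mor j) P p"
    "is_kernel BC (bob l' r') P p (bob l r) (mor j)"
proof -
  let ?N = "src l" and ?Q = "src l'"
  note [simp] = bcomD(1-6)[OF b(1)] bcomD(1-6)[OF b(2)] bmapD(1-3)[OF j] s(1-3)
  have jh: "mor j \<in> Hom M ?N ?Q" using bmapD(1-3)[OF j] unfolding arr_def by auto
  have sh: "mor s \<in> Hom M ?Q ?N" using s unfolding arr_def by auto
  have sj: "mor s \<cdot> mor j = ident M ?N" using arg_cong[OF s(4), of mor] by simp
  obtain P pm where ck: "is_cokernel M ?N ?Q (mor j) P pm"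
    using ex_cokernel[OF _ _ jh] by auto
  obtain tm where tm: "tm \<in> Hom M P ?Q" "pm \<cdot> tm = ident M P" "(tm \<cdot> pm) \<boxplus> (mor j \<cdot> mor s) = ident M ?Q"
    using split_mono_cokernel[OF ck sh sj] by metis
  have Po: "P \<in> Obj M" and pmh: "pm \<in> Hom M ?Q P" and pj: "pm \<cdot> mor j = zero_mor M ?N P"
    using ck by (simp_all add: is_cokernel_def)
  define p where "p = Arrow ?Q pm P"
  define t where "t = Arrow P tm ?Q"
  have [simp]: "arr p" "src p = ?Q" "tgt p = P" "arr t" "src t = P" "tgt t = ?Q" "P \<in> Obj M"
    and pt: "p \<bullet> t = idn P"
    using pmh tm Po by (simp_all add: p_def t_def arr_def arrow_eq_iff del: arr_obj)
  have coker: "(h \<bullet> t) \<bullet> p = h"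
    if h: "arr h" "src h = ?Q" "mor h \<cdot> mor j = zero_mor M ?N (tgt h)" for h
  proof -
    obtain u where u: "u \<in> Hom M P (tgt h)" "mor h = u \<cdot> pm"
      using cokernel_annihilates_iff[OF ck, of "tgt h" "mor h"] h unfolding arr_def by auto
    define U where "U = Arrow P u (tgt h)"
    have U: "arr U" "src U = P" "tgt U = tgt h" "h = U \<bullet> p"
      using u h by (simp_all add: U_def arr_def arrow_eq_iff p_def del: arr_obj)
    have "((U \<bullet> p) \<bullet> t) \<bullet> p = U \<bullet> p" using U(1-3) by (simp add: cmp_extend[OF pt])
    then show ?thesis using U(4) by simp
  qed
  \<comment> \<open>Insert the decomposition of the identity of \<open>?Q\<close> from
    \<open>tm\<close>; its first summand annihilates \<open>h\<close>.\<close>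
  have ker: "j \<bullet> s \<bullet> h = h"
    if h: "arr h" "tgt h = ?Q" "pm \<cdot> mor h = zero_mor M (src h) P" for h
  proof -
    have W: "src h \<in> Obj M" "mor h \<in> Hom M (src h) ?Q" using h(1,2) unfolding arr_def by auto
    have e: "tm \<cdot> pm \<in> Hom M ?Q ?Q" "mor j \<cdot> mor s \<in> Hom M ?Q ?Q"
      using comp_hom[OF _ Po _ pmh tm(1)] comp_hom[OF _ _ _ sh jh] by simp_all
    have "mor h = ((tm \<cdot> pm) \<cdot> mor h) \<boxplus> ((mor j \<cdot> mor s) \<cdot> mor h)"
      using add_comp[OF W(1) _ _ e W(2)] tm(3) ident_comp[OF W(1) _ W(2)] by simp
    also have "(tm \<cdot> pm) \<cdot> mor h = zero_mor M (src h) ?Q"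
      using comp_assoc[OF W(1) _ Po _ W(2) pmh tm(1)] h(3) comp_zero[OF W(1) Po _ tm(1)] by simp
    also have "zero_mor M (src h) ?Q \<boxplus> ((mor j \<cdot> mor s) \<cdot> mor h) = (mor j \<cdot> mor s) \<cdot> mor h"
      using zero_add[OF W(1) _ comp_hom[OF W(1) _ _ W(2) e(2)]] by simp
    finally have "(j \<bullet> s) \<bullet> h = h" using h by (simp add: arrow_eq_iff del: cmp_assoc)
    then show ?thesis using h by simp
  qed
  \<comment> \<open>The coactions on \<open>P\<close> are forced: composing the desired
    \<open>lP \<bullet> p = LL p \<bullet> l'\<close> with \<open>t\<close> leaves this
    formula.\<close>
  define lP where "lP = LL p \<bullet> l' \<bullet> t"
  define rP where "rP = RR p \<bullet> r' \<bullet> t"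
  have lP: "arr lP" "src lP = P" "tgt lP = C \<boxtimes> P" and rP: "arr rP" "src rP = P" "tgt rP = P \<boxtimes> C"
    by (simp_all add: lP_def rP_def)
  have z: "mor (p \<bullet> j) = zero_mor M ?N P"
    using pj by (simp add: p_def)
  have LRz: "LL p \<bullet> LL j = Arrow (C \<boxtimes> ?N) (zero_mor M (C \<boxtimes> ?N) (C \<boxtimes> P)) (C \<boxtimes> P)"
    "RR p \<bullet> RR j = Arrow (?N \<boxtimes> C) (zero_mor M (?N \<boxtimes> C) (P \<boxtimes> C)) (P \<boxtimes> C)"
    using tensor_zero[OF coalg_obj bcomD(6)[OF b(1)] Po] z
      LL_RR_simps(3)[of "p \<bullet> j"] LL_RR_simps(6)[of "p \<bullet> j"]
    by (simp_all add: arrow_eq_iff LL_cmp[symmetric] RR_cmp[symmetric] del: LL_RR_simps(3,6))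
  \<comment> \<open>\<open>LL p \<bullet> l'\<close> kills \<open>j\<close> because \<open>j\<close>
    is colinear and C \<otimes> - preserves the zero arrow \<open>p \<bullet> j\<close>; by
    \<open>coker\<close> it therefore factors through \<open>p\<close>.\<close>
  have "(LL p \<bullet> l') \<bullet> j = (LL p \<bullet> LL j) \<bullet> l" using bmapD(4)[OF j] by simp
  then have "mor (LL p \<bullet> l') \<cdot> mor j = zero_mor M ?N (C \<boxtimes> P)"
    using zero_comp[of ?N "C \<boxtimes> ?N" "C \<boxtimes> P" "mor l"] bcomD(1)[OF b(1)] LRz(1)
    by (simp add: arrow_eq_iff arr_def del: arr_obj)
  then have lPp: "lP \<bullet> p = LL p \<bullet> l'"
    using coker[of "LL p \<bullet> l'"] by (simp add: lP_def)
  have "(RR p \<bullet> r') \<bullet> j = (RR p \<bullet> RR j) \<bullet> r" using bmapD(5)[OF j] by simp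
  then have "mor (RR p \<bullet> r') \<cdot> mor j = zero_mor M ?N (P \<boxtimes> C)"
    using zero_comp[of ?N "?N \<boxtimes> C" "P \<boxtimes> C" "mor r"] bcomD(2)[OF b(1)] LRz(2)
    by (simp add: arrow_eq_iff arr_def del: arr_obj)
  then have rPp: "rP \<bullet> p = RR p \<bullet> r'"
    using coker[of "RR p \<bullet> r'"] by (simp add: rP_def)
  have bP: "bcom lP rP"
    by (rule bcom_quotient[OF b(2), of p t]) (use lP rP lPp rPp pt in simp_all)
  have pmap: "bmap l' r' lP rP p"
    using lP rP lPp rPp by (simp add: bmap_def lmap_def rmap_def)
  have ph: "mor p \<in> Hom BC (bob l' r') (bob lP rP)" using bob_homI[OF b(2) bP pmap] .
  have jB: "mor j \<in> Hom BC (bob l r) (bob l' r')" using bob_homI[OF b j] .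
  have pjB: "mor p \<cdot> mor j = zero_mor M ?N P" using pj by (simp add: p_def)
  have cancel: "f = g" if "f \<bullet> p = g \<bullet> p" "arr f" "arr g" "src f = P" "src g = P" for f g
    using split_epi_cancel[of f p g t] that pt by simp
  have "is_cokernel BC (bob l r) (bob l' r') (mor j) (bob lP rP) (mor p)"
    unfolding is_cokernel_def
  proof (intro conjI ballI impI)
    fix B h assume B: "B \<in> Obj BC" and h: "h \<in> Hom BC (bob l' r') B"
      and hj: "h \<cdot>\<^bsub>BC\<^esub> mor j = zero_mor BC (bob l r) B"
    obtain m n where mn: "B = bob m n" "bcom m n" using B by (auto simp: bob_obj_iff)
    obtain H where H: "h = mor H" "bmap l' r' m n H" using bob_homE[OF b(2) mn(2)] h mn(1) by metis
    note [simp] = bcomD(1-6)[OF mn(2)] bmapD(1-3)[OF H(2)] lP rP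
    define U where "U = H \<bullet> t"
    have Up: "U \<bullet> p = H" using coker[of H] hj H(1) mn(1) by (simp add: U_def)
    have U [simp]: "arr U" "src U = P" "tgt U = src m" by (simp_all add: U_def)
    have "m \<bullet> U = LL U \<bullet> lP"
    proof (rule cancel)
      have "(m \<bullet> U) \<bullet> p = LL (U \<bullet> p) \<bullet> l'" using bmapD(4)[OF H(2)] by (simp add: Up)
      also have "\<dots> = (LL U \<bullet> lP) \<bullet> p" by (simp add: LL_cmp lPp)
      finally show "(m \<bullet> U) \<bullet> p = (LL U \<bullet> lP) \<bullet> p" .
    qed simp_all
    moreover have "n \<bullet> U = RR U \<bullet> rP"
    proof (rule cancel)
      have "(n \<bullet> U) \<bullet> p = RR (U \<bullet> p) \<bullet> r'" using bmapD(5)[OF H(2)] by (simp add: Up)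
      also have "\<dots> = (RR U \<bullet> rP) \<bullet> p" by (simp add: RR_cmp rPp)
      finally show "(n \<bullet> U) \<bullet> p = (RR U \<bullet> rP) \<bullet> p" .
    qed simp_all
    ultimately have Um: "bmap lP rP m n U" by (simp add: bmap_def lmap_def rmap_def)
    show "\<exists>!u. u \<in> Hom BC (bob lP rP) B \<and> u \<cdot>\<^bsub>BC\<^esub> mor p = h"
    proof (rule ex1I)
      show "mor U \<in> Hom BC (bob lP rP) B \<and> mor U \<cdot>\<^bsub>BC\<^esub> mor p = h"
        using bob_homI[OF bP mn(2) Um] mn(1) H(1) arg_cong[OF Up, of mor] by simp
      fix u assume u: "u \<in> Hom BC (bob lP rP) B \<and> u \<cdot>\<^bsub>BC\<^esub> mor p = h"
      then obtain V where V: "u = mor V" "bmap lP rP m n V" using bob_homE[OF bP mn(2)] mn(1) by metis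
      have "V \<bullet> p = U \<bullet> p" using u V H(1) bmapD(1-3)[OF V(2)] Up by (simp add: arrow_eq_iff)
      then have "V = U" by (rule cancel) (use bmapD(1-3)[OF V(2)] in simp_all)
      then show "u = mor U" using V by simp
    qed
  qed (use b bP ph jB pjB lP in simp_all)
  moreover have "is_kernel BC (bob l' r') (bob lP rP) (mor p) (bob l r) (mor j)"
    unfolding is_kernel_def
  proof (intro conjI ballI impI)
    fix B h assume B: "B \<in> Obj BC" and h: "h \<in> Hom BC B (bob l' r')"
      and hj: "mor p \<cdot>\<^bsub>BC\<^esub> h = zero_mor BC B (bob lP rP)"
    obtain m n where mn: "B = bob m n" "bcom m n" using B by (auto simp: bob_obj_iff)
    obtain H where H: "h = mor H" "bmap m n l' r' H" using bob_homE[OF mn(2) b(2)] h mn(1) by metis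
    note [simp] = bcomD(1-6)[OF mn(2)] bmapD(1-3)[OF H(2)] lP rP
    define U where "U = s \<bullet> H"
    have jU: "j \<bullet> U = H" using ker[of H] hj H(1) mn(1) by (simp add: U_def p_def)
    have U [simp]: "arr U" "src U = src m" "tgt U = ?N" by (simp_all add: U_def)
    have Ls: "LL s \<bullet> LL j = idn (C \<boxtimes> ?N)" "RR s \<bullet> RR j = idn (?N \<boxtimes> C)"
      by (simp_all add: LL_cmp[symmetric] RR_cmp[symmetric] s(4))
    \<comment> \<open>\<open>LL s\<close> is a left inverse of \<open>LL j\<close>, so left
      colinearity of \<open>j \<bullet> U = H\<close> passes to \<open>U\<close>;
      \<open>RR s\<close> does the same on the right.\<close>
    have "l \<bullet> U = LL s \<bullet> (LL j \<bullet> l) \<bullet> U" by (simp add: cmp_extend[OF Ls(1)])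
    also have "\<dots> = LL s \<bullet> l' \<bullet> (j \<bullet> U)" by (simp add: bmapD(4)[OF j, symmetric])
    also have "\<dots> = LL s \<bullet> LL (j \<bullet> U) \<bullet> m" using bmapD(4)[OF H(2)] by (simp add: jU)
    also have "\<dots> = LL U \<bullet> m" by (simp add: LL_cmp cmp_extend[OF Ls(1)])
    finally have 1: "l \<bullet> U = LL U \<bullet> m" .
    have "r \<bullet> U = RR s \<bullet> (RR j \<bullet> r) \<bullet> U" by (simp add: cmp_extend[OF Ls(2)])
    also have "\<dots> = RR s \<bullet> r' \<bullet> (j \<bullet> U)" by (simp add: bmapD(5)[OF j, symmetric])
    also have "\<dots> = RR s \<bullet> RR (j \<bullet> U) \<bullet> n" using bmapD(5)[OF H(2)] by (simp add: jU)
    also have "\<dots> = RR U \<bullet> n" by (simp add: RR_cmp cmp_extend[OF Ls(2)])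
    finally have Um: "bmap m n l r U" using 1 by (simp add: bmap_def lmap_def rmap_def)
    show "\<exists>!u. u \<in> Hom BC B (bob l r) \<and> mor j \<cdot>\<^bsub>BC\<^esub> u = h"
    proof (rule ex1I)
      show "mor U \<in> Hom BC B (bob l r) \<and> mor j \<cdot>\<^bsub>BC\<^esub> mor U = h"
        using bob_homI[OF mn(2) b(1) Um] mn(1) H(1) arg_cong[OF jU, of mor] by simp
      fix u assume u: "u \<in> Hom BC B (bob l r) \<and> mor j \<cdot>\<^bsub>BC\<^esub> u = h"
      then obtain V where V: "u = mor V" "bmap m n l r V" using bob_homE[OF mn(2) b(1)] mn(1) by metis
      note [simp] = bmapD(1-3)[OF V(2)]
      have "j \<bullet> V = H" using u V H(1) by (simp add: arrow_eq_iff)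
      then have "s \<bullet> j \<bullet> V = U" by (simp add: U_def)
      then have "V = U" by (simp add: cmp_extend[OF s(4)])
      then show "u = mor U" using V by simp
    qed
  qed (use b bP ph jB pjB lP in simp_all)
  ultimately show thesis using that by blast
qed

end

section \<open>Cofree bicomodules and coseparability\<close>

context abelian_coalgebra
begin

lemma split_mono_classI:
  assumes "bcom l r" "bcom l' r'" "bmap l r l' r' j"
    and s: "arr s" "src s = src l'" "tgt s = src l" "s \<bullet> j = idn (src l)"
  shows "split_mono_class M C \<Delta> \<epsilon> (bob l r) (bob l' r') (mor j)"
proof -
  obtain P p where "is_kernel BC (bob l' r') P p (bob l r) (mor j)"
    using split_mono_bicomodule_exact[OF assms] .
  then have "is_mono BC (bob l r) (bob l' r') (mor j)"
    using preadditive_category.kernel_imp_mono[OF bicomodule_preadditive] by blast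
  moreover have "mor s \<in> Hom M (src l') (src l)" using s unfolding arr_def by auto
  moreover have "mor s \<cdot> mor j = ident M (src l)" using arg_cong[OF s(4), of mor] by simp
  ultimately show ?thesis
    unfolding split_mono_class_def has_retraction_def by auto
qed

lemma rel_injective_cofree:
  assumes r0: "rext r0" "src r0 = Y"
  shows "rel_injective BC (split_mono_class M C \<Delta> \<epsilon>) (bob (dl Y) (ph' Y \<bullet> LL r0))"
proof (rule category.rel_injectiveI)
  show "category BC"
    using bicomodule_preadditive by (simp add: preadditive_category_def)
  have bY: "bcom (dl Y) (ph' Y \<bullet> LL r0)"
    using bcom_cofree r0 by (simp add: rext_def)
  then show "bob (dl Y) (ph' Y \<bullet> LL r0) \<in> Obj BC" by simp
  fix B B' j f assume *: "B \<in> Obj BC" "B' \<in> Obj BC" "j \<in> Hom BC B B'"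
    "split_mono_class M C \<Delta> \<epsilon> B B' j" "f \<in> Hom BC B (bob (dl Y) (ph' Y \<bullet> LL r0))"
  obtain l r l' r' where b: "B = bob l r" "bcom l r" "B' = bob l' r'" "bcom l' r'"
    using *(1,2) by (auto simp: bob_obj_iff)
  obtain J where J: "j = mor J" "bmap l r l' r' J" using bob_homE[OF b(2,4)] *(3) b(1,3) by metis
  obtain F where F: "f = mor F" "bmap l r (dl Y) (ph' Y \<bullet> LL r0) F"
    using bob_homE[OF b(2) bY] *(5) b(1) by metis
  obtain s where s: "s \<in> Hom M (src l') (src l)" "s \<cdot> j = ident M (src l)"
    using *(4) b unfolding split_mono_class_def has_retraction_def by auto
  define S where "S = Arrow (src l') s (src l)"
  have "arr S" "src S = src l'" "tgt S = src l" "S \<bullet> J = idn (src l)"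
    using s bcomD(6)[OF b(2)] bcomD(6)[OF b(4)] J bmapD(2)[OF J(2)]
    by (simp_all add: S_def arr_def arrow_eq_iff del: arr_obj)
  then obtain g where g: "bmap l' r' (dl Y) (ph' Y \<bullet> LL r0) g" "g \<bullet> J = F"
    using cofree_extension[OF r0 b(2,4) J(2) _ _ _ _ F(2)] by metis
  then show "\<exists>g\<in>Hom BC B' (bob (dl Y) (ph' Y \<bullet> LL r0)). g \<cdot>\<^bsub>BC\<^esub> j = f"
    using bob_homI[OF b(4) bY g(1)] b(3) J(1) F(1) arg_cong[OF g(2), of mor] by auto
qed

lemma bicomodule_embed:
  assumes "N \<in> Obj BC"
  shows "\<exists>Q P j p. rel_injective BC (split_mono_class M C \<Delta> \<epsilon>) Q \<and> split_mono_class M C \<Delta> \<epsilon> N Q j \<and>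
    is_cokernel BC N Q j P p \<and> is_kernel BC Q P p N j"
proof -
  obtain l r where b: "N = bob l r" "bcom l r" using assms by (auto simp: bob_obj_iff)
  let ?X = "src l"
  note bd = bcomD[OF b(2)]
  note [simp] = bd(1-6) lcomD[OF bd(7)]
  let ?l = "dl (?X \<boxtimes> C)" and ?r = "ph' (?X \<boxtimes> C) \<bullet> LL (dr ?X)"
  have d: "rcom (dr ?X)" using rcom_dr by simp
  have bQ: "bcom ?l ?r" using bcom_cofree[OF d] by simp
  \<comment> \<open>The embedding composes the units of the two adjunctions: the left coaction,
    followed by C \<otimes> - applied to the right coaction.\<close>
  have j: "bmap l r ?l ?r (LL r \<bullet> l)"
    using bmap_cmp[OF b(2) bcom_cofree[OF bd(8) refl] bQ] bmap_left_coaction[OF b(2) refl]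
      bmap_cofree[OF bd(8) d] rmap_coaction[OF bd(8)] by simp
  let ?s = "er ?X \<bullet> el (?X \<boxtimes> C)"
  have "?s \<bullet> LL r \<bullet> l = er ?X \<bullet> (el (?X \<boxtimes> C) \<bullet> LL r) \<bullet> l" by simp
  also have "\<dots> = er ?X \<bullet> (r \<bullet> el ?X) \<bullet> l"
    by (simp add: el_nat[of r ?X "?X \<boxtimes> C"])
  also have "\<dots> = idn ?X" using rcomD(3)[OF bd(8)] by simp
  finally have s: "?s \<bullet> LL r \<bullet> l = idn ?X" .
  have ss: "arr ?s" "src ?s = src ?l" "tgt ?s = ?X" by simp_all
  have "split_mono_class M C \<Delta> \<epsilon> N (bob ?l ?r) (mor (LL r \<bullet> l))"
    using split_mono_classI[OF b(2) bQ j ss s] b(1) by simp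
  moreover obtain P p where "is_cokernel BC N (bob ?l ?r) (mor (LL r \<bullet> l)) P p"
    "is_kernel BC (bob ?l ?r) P p N (mor (LL r \<bullet> l))"
    using split_mono_bicomodule_exact[OF b(2) bQ j ss s] unfolding b(1) .
  moreover have "rel_injective BC (split_mono_class M C \<Delta> \<epsilon>) (bob ?l ?r)"
    using rel_injective_cofree[OF rext_dr] by simp
  ultimately show ?thesis by blast
qed

section \<open>Coseparability and Hochschild cohomology of the coalgebra\<close>

lemma regular_bob: "regular_bicomodule C \<Delta> = bob DD DD"
  by (simp add: regular_bicomodule_def bob_def)

lemma tensor_square_bob: "tensor_square_bicomodule M C \<Delta> = bob (dl C) (ph' C \<bullet> LL DD)"
  by (simp add: tensor_square_bicomodule_def bob_def dl_def ph'_def asc'_def)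

text \<open>\<open>el C\<close> retracts \<open>\<Delta>\<close> in \<open>M\<close>, so
  \<open>\<Delta>\<close> itself lies in the class, and extending the identity of \<open>C\<close>
  along it yields a bicomodule retraction. Conversely a retraction makes \<open>C\<close> a retract
  of C \<otimes> C, which is relatively injective by \<open>rext_DD\<close>.\<close>

lemma coseparable_iff_rel_injective:
  "coseparable M C \<Delta> \<epsilon> \<longleftrightarrow>
    rel_injective BC (split_mono_class M C \<Delta> \<epsilon>) (regular_bicomodule C \<Delta>)"
proof -
  interpret B: preadditive_category BC by (rule bicomodule_preadditive)
  let ?I = "split_mono_class M C \<Delta> \<epsilon>" and ?T = "bob (dl C) (ph' C \<bullet> LL DD)"
  have bT: "bcom (dl C) (ph' C \<bullet> LL DD)" using bcom_cofree bcomD(8)[OF bcom_DD] by simp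
  have D: "bmap DD DD (dl C) (ph' C \<bullet> LL DD) DD"
    using bmap_left_coaction[OF bcom_DD] by simp
  have Dh: "\<Delta> \<in> Hom BC (bob DD DD) ?T" using bob_homI[OF bcom_DD bT D] by simp
  have o: "bob DD DD \<in> Obj BC" "?T \<in> Obj BC" using bcom_DD bT by simp_all
  have "el C \<bullet> DD = idn (src DD)" using bcom_DD by (simp add: bcom_def lcom_def)
  then have DI: "?I (bob DD DD) ?T \<Delta>"
    using split_mono_classI[OF bcom_DD bT D, of "el C"] by simp
  have cosep: "coseparable M C \<Delta> \<epsilon> \<longleftrightarrow> (\<exists>g\<in>Hom BC ?T (bob DD DD). g \<cdot>\<^bsub>BC\<^esub> \<Delta> = ident BC (bob DD DD))"
    unfolding coseparable_def has_retraction_def regular_bob tensor_square_bob ..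
  show ?thesis
    unfolding cosep regular_bob
  proof
    assume "\<exists>g\<in>Hom BC ?T (bob DD DD). g \<cdot>\<^bsub>BC\<^esub> \<Delta> = ident BC (bob DD DD)"
    then show "rel_injective BC ?I (bob DD DD)"
      using B.rel_injective_retract[OF rel_injective_cofree[OF rext_DD] o(1)] Dh by auto
  next
    assume "rel_injective BC ?I (bob DD DD)"
    then show "\<exists>g\<in>Hom BC ?T (bob DD DD). g \<cdot>\<^bsub>BC\<^esub> \<Delta> = ident BC (bob DD DD)"
      using B.rel_injectiveD[of ?I, OF _ o Dh DI B.ident_hom[OF o(1)]] by blast
  qed
qed

lemma rel_injective_iff_hochschild_trivial:
  "rel_injective BC (split_mono_class M C \<Delta> \<epsilon>) (regular_bicomodule C \<Delta>) \<longleftrightarrow>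
    (\<forall>X\<in>Obj BC. trivial_group (hochschild M C \<Delta> \<epsilon> 1 X))"
  "rel_injective BC (split_mono_class M C \<Delta> \<epsilon>) (regular_bicomodule C \<Delta>) \<longleftrightarrow>
    (\<forall>X\<in>Obj BC. \<forall>n>0. trivial_group (hochschild M C \<Delta> \<epsilon> n X))"
  unfolding hochschild_def regular_bob
  by (rule preadditive_category.rel_injective_iff_rel_Ext_trivial[OF bicomodule_preadditive
        bicomodule_zero_object bicomodule_embed bob_obj[OF bcom_DD]]; assumption)+

end

theorem proposition5p3:
  fixes M :: "('o, 'm, 'x) monoidal_scheme" and C :: 'o and \<Delta> \<epsilon> :: 'm
  assumes "abelian_monoidal_category M" and "coalgebra M C \<Delta> \<epsilon>"
  shows "(coseparable M C \<Delta> \<epsilon> \<longleftrightarrow>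
      rel_injective (bicomodule_category M C \<Delta> \<epsilon>) (split_mono_class M C \<Delta> \<epsilon>) (regular_bicomodule C \<Delta>)) \<and>
    (rel_injective (bicomodule_category M C \<Delta> \<epsilon>) (split_mono_class M C \<Delta> \<epsilon>) (regular_bicomodule C \<Delta>) \<longleftrightarrow>
      (\<forall>X\<in>Obj (bicomodule_category M C \<Delta> \<epsilon>). trivial_group (hochschild M C \<Delta> \<epsilon> 1 X))) \<and>
    ((\<forall>X\<in>Obj (bicomodule_category M C \<Delta> \<epsilon>). trivial_group (hochschild M C \<Delta> \<epsilon> 1 X)) \<longleftrightarrow>
      (\<forall>X\<in>Obj (bicomodule_category M C \<Delta> \<epsilon>). \<forall>n>0. trivial_group (hochschild M C \<Delta> \<epsilon> n X)))"
proof -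
  interpret abelian_coalgebra M C \<Delta> \<epsilon>
    using assms by (simp add: abelian_coalgebra_def)
  show ?thesis
    using coseparable_iff_rel_injective rel_injective_iff_hochschild_trivial by blast
qed

end
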